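(* Let $G$ be a Lie group acting smoothly and transitively on a manifold $M$, let $p\in M$ have isotropy group $K$, with the lifting and regularity assumptions listed in the context, and let $\mu$ be a continuous Finsler metric on $TG$ which is right-invariant for the action of $K$ and $L$-uniform. Let $g,h\in G$ and let $\Gamma:[a,b]\to G$ be a piecewise $C^1$ path with $\Gamma(a)=g$, $\Gamma(b)=h$. The following are equivalent: 1. $\mathrm{Length}_\mu(\Gamma)=\mathrm{dist}_\mu(g,hK)$ (in particular $\Gamma$ is short in $G$ and the distance from $g$ to $hK$ is realized). 2. $\gamma=\Gamma\cdot p\subset M$ is a short path joining $g\cdot p$ to $h\cdot p$ (i.e. $L_M(\gamma)=d_M(g\cdot p,h\cdot p)$), and $\Gamma$ is an isometric lift of $\gamma$, i.e. $\mathrm{Length}_\mu(\Gamma)=L_M(\gamma)$.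
   Context: Manifolds are modeled on Hausdorff locally convex topological vector spaces; a Lie group is a group which is a manifold with $(x,y)\mapsto xy^{-1}$ at least $C^2$. For $g,h\in G$, $v\in T_hG$, $gv\in T_{gh}G$ and $vg\in T_{hg}G$ denote the images of $v$ under the differentials of left and right multiplication by $g$. $\mathrm{Lie}(G)=T_1G$. A Finsler semi-norm on a locally convex space is a continuous function $|\cdot|\ge 0$ with $|v+w|\le|v|+|w|$ and $|\lambda v|=\lambda|v|$ for real $\lambda\ge 0$. A continuous Finsler metric on $TG$ is a continuous function $\mu:TG\to\mathbb R_{\ge0}$ whose restriction $|\cdot|_g$ to each $T_gG$ is a Finsler semi-norm. It is $L$-uniform if there is an upper semi-continuous $L:G\to\mathbb R_{\ge0}$ with $L(1)=1$ and $|gv|_{gh}\le L(g)|v|_h$ for all $g,h\in G$, $v\in T_hG$. Setting. $\pi:G\times M\to M$, $(g,x)\mapsto g\cdot x$, is a (at least $C^1$) transitive left action on a manifold $M$; $\pi_x(g)=g\cdot x$. A point $p\in M$ is fixed such that every piecewise $C^1$ path in $M$ starting at $p$ has a piecewise $C^1$ lift to $G$ through $\pi_p$ starting at $1$. (Hence every piecewise $C^1$ path in $M$ starting at $g\cdot p$ has a piecewise $C^1$ lift starting at $g$.) $K=\{g\in G:g\cdot p=p\}$ is a closed subgroup which is an initial Lie subgroup (it is a Lie group, and every smooth map from a manifold to $G$ with values in $K$ is smooth into $K$; in particular $\mathrm{Lie}(K)=\ker (\pi_p)_{*1}$), and it is regular: a piecewise smooth path $\alpha$ in $G$ lies in $K$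 iff it meets $K$ and $\alpha^{-1}\dot\alpha\subset\mathrm{Lie}(K)$, and for each smooth path $\xi$ in $\mathrm{Lie}(K)$ there is a smooth path $\alpha$ in $K$ with $\alpha(0)=1$, $\dot\alpha\alpha^{-1}=\xi$. Right-invariance of $\mu$ for $K$ means $|vu|_{gu}=|v|_g$ for $g\in G$, $u\in K$, $v\in T_gG$. Distances (not necessarily symmetric). $\mathrm{Length}_\mu(\alpha)=\int_a^b|\dot\alpha(t)|_{\alpha(t)}dt$, $\mathrm{dist}_\mu(g,h)$ is the infimum of the lengths of piecewise $C^1$ paths in $G$ from $g$ to $h$, and $\mathrm{dist}_\mu(g,hK)=\inf_{k\in K}\mathrm{dist}_\mu(g,hk)$. The quotient Finsler metric on $TM$ is, for $v=(\pi_p)_{*g}\dot g\in T_{g\cdot p}M$ with $\dot g\in T_gG$, $\mu(v)_{g\cdot p}=\inf\{|\dot g-gz|_g:z\in\mathrm{Lie}(K)\}$ (well defined). $L_M(\gamma)=\int\mu(\dot\gamma_t)_{\gamma_t}dt$ for piecewise $C^1$ paths $\gamma$ in $M$, and $d_M(x,y)$ is the infimum of $L_M(\gamma)$ over such paths from $x$ to $y$. A path is short if its length equals the distance from its initial to its final point. *)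

theory Defs
  imports "HOL-Analysis.Analysis" "HOL-Algebra.Group_Action"
begin

section \<open>Hausdorff locally convex spaces\<close>

class lcs = real_vector + topological_ab_group_add + t2_space +
  assumes tendsto_scaleR_Pair: "LIM x (nhds a \<times>\<^sub>F nhds b). fst x *\<^sub>R snd x :> nhds (a *\<^sub>R b)"
    and locally_convex_ax: "open U \<Longrightarrow> 0 \<in> U \<Longrightarrow> \<exists>V. open V \<and> 0 \<in> V \<and> V \<subseteq> U \<and>
      (\<forall>x\<in>V. \<forall>y\<in>V. \<forall>u\<ge>0. \<forall>v\<ge>0. u + v = 1 \<longrightarrow> u *\<^sub>R x + v *\<^sub>R y \<in> V)"

lemma locally_convex:
  fixes U :: "'a::lcs set"
  shows "open U \<Longrightarrow> 0 \<in> U \<Longrightarrow> \<exists>V. open V \<and> convex V \<and> 0 \<in> V \<and> V \<subseteq> U"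
  using locally_convex_ax[of U] unfolding convex_def by blast

instance real_normed_vector \<subseteq> lcs
proof
  fix r :: real and b :: 'a
  show "LIM x (nhds r \<times>\<^sub>F nhds b). fst x *\<^sub>R snd x :> nhds (r *\<^sub>R b)"
    by (intro tendsto_scaleR filterlim_fst filterlim_snd)
next
  fix U :: "'a set"
  assume "open U" "0 \<in> U"
  then obtain e where "e > 0" "ball 0 e \<subseteq> U"
    using open_contains_ball by blast
  then show "\<exists>V. open V \<and> 0 \<in> V \<and> V \<subseteq> U \<and>
      (\<forall>x\<in>V. \<forall>y\<in>V. \<forall>u\<ge>0. \<forall>v\<ge>0. u + v = 1 \<longrightarrow> u *\<^sub>R x + v *\<^sub>R y \<in> V)"
    using convex_ball[of "0::'a" e]
    by (intro exI[of _ "ball 0 e"] conjI) (simp_all add: convex_def)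
qed

lemma tendsto_scaleR_lcs:
  fixes g :: "'b \<Rightarrow> 'a::lcs"
  assumes "(f \<longlongrightarrow> a) F" "(g \<longlongrightarrow> b) F"
  shows "((\<lambda>x. f x *\<^sub>R g x) \<longlongrightarrow> a *\<^sub>R b) F"
  using filterlim_compose[OF tendsto_scaleR_Pair, of "\<lambda>x. (f x, g x)" a b F] assms
  by (simp add: nhds_prod[symmetric] tendsto_Pair)

instance prod :: (topological_monoid_add, topological_monoid_add) topological_monoid_add
proof
  fix a b :: "'a \<times> 'b"
  show "LIM x (nhds a \<times>\<^sub>F nhds b). fst x + snd x :> nhds (a + b)"
    unfolding plus_prod_def
    by (intro tendsto_Pair tendsto_add tendsto_fst tendsto_snd filterlim_fst filterlim_snd)
qed

instance prod :: (topological_comm_monoid_add, topological_comm_monoid_add) topological_comm_monoid_add ..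

instance prod :: (topological_group_add, topological_group_add) topological_group_add
proof
  fix a :: "'a \<times> 'b"
  show "(uminus \<longlongrightarrow> - a) (nhds a)"
    unfolding uminus_prod_def
    by (intro tendsto_Pair tendsto_minus tendsto_fst tendsto_snd filterlim_ident)
qed

instance prod :: (topological_ab_group_add, topological_ab_group_add) topological_ab_group_add ..

instance prod :: (lcs, lcs) lcs
proof
  fix r :: real and b :: "'a \<times> 'b"
  show "LIM x (nhds r \<times>\<^sub>F nhds b). fst x *\<^sub>R snd x :> nhds (r *\<^sub>R b)"
    unfolding scaleR_prod_def
    by (intro tendsto_Pair tendsto_scaleR_lcs tendsto_fst tendsto_snd filterlim_fst filterlim_snd)
next
  fix U :: "('a \<times> 'b) set"
  assume "open U" "0 \<in> U"
  then obtain A B where AB: "open A" "open B" "0 \<in> A" "0 \<in> B" "A \<times> B \<subseteq> U"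
    by (metis open_prod_elim mem_Sigma_iff zero_prod_def)
  obtain V where V: "open V" "convex V" "0 \<in> V" "V \<subseteq> A"
    using locally_convex[OF AB(1,3)] by blast
  obtain W where W: "open W" "convex W" "0 \<in> W" "W \<subseteq> B"
    using locally_convex[OF AB(2,4)] by blast
  have "open (V \<times> W)" "convex (V \<times> W)"
    using V W by (simp_all add: open_Times convex_Times)
  moreover have "0 \<in> V \<times> W" "V \<times> W \<subseteq> U"
    using AB(5) V(3,4) W(3,4) by (auto simp: zero_prod_def)
  ultimately show "\<exists>V. open V \<and> 0 \<in> V \<and> V \<subseteq> U \<and>
      (\<forall>x\<in>V. \<forall>y\<in>V. \<forall>u\<ge>0. \<forall>v\<ge>0. u + v = 1 \<longrightarrow> u *\<^sub>R x + v *\<^sub>R y \<in> V)"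
    unfolding convex_def by (intro exI[of _ "V \<times> W"] conjI)
qed

section \<open>Differential calculus in locally convex spaces\<close>

text \<open>Michal--Bastiani (Keller's $C^k_c$) calculus: the directional derivatives
  $d^nf(x;v_0,\dots,v_{n-1})$ exist and depend continuously on all arguments.
  The direction vectors form a sequence, of which \<open>iter_dir_deriv n\<close> only uses the first \<open>n\<close>
  entries, so continuity for the product topology on sequences is continuity on $U\times E^n$.\<close>

definition has_dir_deriv :: "('e::lcs \<Rightarrow> 'f::lcs) \<Rightarrow> 'e \<Rightarrow> 'e \<Rightarrow> 'f \<Rightarrow> bool" where
  "has_dir_deriv f x v y \<longleftrightarrow> ((\<lambda>t::real. (1 / t) *\<^sub>R (f (x + t *\<^sub>R v) - f x)) \<longlongrightarrow> y) (at 0)"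

definition dir_deriv :: "('e::lcs \<Rightarrow> 'f::lcs) \<Rightarrow> 'e \<Rightarrow> 'e \<Rightarrow> 'f" where
  "dir_deriv f x v = (THE y. has_dir_deriv f x v y)"

primrec iter_dir_deriv :: "nat \<Rightarrow> ('e::lcs \<Rightarrow> 'f::lcs) \<Rightarrow> 'e \<Rightarrow> (nat \<Rightarrow> 'e) \<Rightarrow> 'f" where
  "iter_dir_deriv 0 f x v = f x"
| "iter_dir_deriv (Suc n) f x v = dir_deriv (\<lambda>x'. iter_dir_deriv n f x' v) x (v n)"

definition Ck_on :: "enat \<Rightarrow> ('e::lcs \<Rightarrow> 'f::lcs) \<Rightarrow> 'e set \<Rightarrow> bool" where
  "Ck_on k f U \<longleftrightarrow> open U \<and>
     (\<forall>n. enat n \<le> k \<longrightarrow> continuous_on (U \<times> UNIV) (\<lambda>(x, v). iter_dir_deriv n f x v)) \<and>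
     (\<forall>n. enat n < k \<longrightarrow>
        (\<forall>x\<in>U. \<forall>v w. \<exists>y. has_dir_deriv (\<lambda>x'. iter_dir_deriv n f x' v) x w y))"

text \<open>Curves are differentiated within their parameter set, i.e. one-sidedly at end points.\<close>

definition has_curve_deriv :: "(real \<Rightarrow> 'e::lcs) \<Rightarrow> real set \<Rightarrow> real \<Rightarrow> 'e \<Rightarrow> bool" where
  "has_curve_deriv c S t y \<longleftrightarrow> ((\<lambda>s. (1 / (s - t)) *\<^sub>R (c s - c t)) \<longlongrightarrow> y) (at t within S)"

definition curve_deriv :: "(real \<Rightarrow> 'e::lcs) \<Rightarrow> real set \<Rightarrow> real \<Rightarrow> 'e" where
  "curve_deriv c S t = (THE y. has_curve_deriv c S t y)"

definition Ck_curve :: "enat \<Rightarrow> (real \<Rightarrow> 'e::lcs) \<Rightarrow> real set \<Rightarrow> bool" where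
  "Ck_curve k c S \<longleftrightarrow>
     (\<forall>n. enat n \<le> k \<longrightarrow> continuous_on S (((\<lambda>f. curve_deriv f S) ^^ n) c)) \<and>
     (\<forall>n. enat n < k \<longrightarrow> (\<forall>t\<in>S. \<exists>y. has_curve_deriv (((\<lambda>f. curve_deriv f S) ^^ n) c) S t y))"

section \<open>Manifolds\<close>

text \<open>A manifold is given by an atlas; its underlying set is the union of the chart domains.
  The values of a chart outside its domain are irrelevant.\<close>

type_synonym ('a, 'e) chart = "'a set \<times> ('a \<Rightarrow> 'e)"

definition points :: "('a, 'e) chart set \<Rightarrow> 'a set" where
  "points A = (\<Union>(U, \<phi>)\<in>A. U)"

definition charts_at :: "('a, 'e) chart set \<Rightarrow> 'a \<Rightarrow> ('a, 'e) chart set" where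
  "charts_at A x = {c \<in> A. x \<in> fst c}"

definition manifold_topology :: "('a, 'e::topological_space) chart set \<Rightarrow> 'a topology" where
  "manifold_topology A = topology (\<lambda>W. W \<subseteq> points A \<and>
     (\<forall>(U, \<phi>)\<in>A. \<exists>Q. open Q \<and> W \<inter> U = U \<inter> \<phi> -` Q))"

lemma openin_manifold_topology:
  "openin (manifold_topology A) W \<longleftrightarrow>
     W \<subseteq> points A \<and> (\<forall>(U, \<phi>)\<in>A. \<exists>Q. open Q \<and> W \<inter> U = U \<inter> \<phi> -` Q)"
proof -
  let ?P = "\<lambda>W. W \<subseteq> points A \<and> (\<forall>(U, \<phi>)\<in>A. \<exists>Q. open Q \<and> W \<inter> U = U \<inter> \<phi> -` Q)"
  have "istopology ?P"
    unfolding istopology_def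
  proof (intro conjI allI impI)
    fix S T assume S: "?P S" and T: "?P T"
    show "S \<inter> T \<subseteq> points A" using S by auto
    show "\<forall>(U, \<phi>)\<in>A. \<exists>Q. open Q \<and> S \<inter> T \<inter> U = U \<inter> \<phi> -` Q"
    proof clarify
      fix U \<phi> assume c: "(U, \<phi>) \<in> A"
      obtain Q1 where Q1: "open Q1" "S \<inter> U = U \<inter> \<phi> -` Q1"
        using bspec[OF conjunct2[OF S] c] by auto
      obtain Q2 where Q2: "open Q2" "T \<inter> U = U \<inter> \<phi> -` Q2"
        using bspec[OF conjunct2[OF T] c] by auto
      have "S \<inter> T \<inter> U = (S \<inter> U) \<inter> (T \<inter> U)" by auto
      also have "\<dots> = U \<inter> \<phi> -` (Q1 \<inter> Q2)" unfolding Q1(2) Q2(2) by auto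
      finally show "\<exists>Q. open Q \<and> S \<inter> T \<inter> U = U \<inter> \<phi> -` Q"
        using open_Int[OF Q1(1) Q2(1)] by metis
    qed
  next
    fix \<K> assume K: "\<forall>W\<in>\<K>. ?P W"
    show "\<Union>\<K> \<subseteq> points A" using K by auto
    show "\<forall>(U, \<phi>)\<in>A. \<exists>Q. open Q \<and> \<Union>\<K> \<inter> U = U \<inter> \<phi> -` Q"
    proof clarify
      fix U \<phi> assume c: "(U, \<phi>) \<in> A"
      have "\<forall>W\<in>\<K>. \<exists>Q. open Q \<and> W \<inter> U = U \<inter> \<phi> -` Q"
        using K c by auto
      then obtain q where q: "\<And>W. W \<in> \<K> \<Longrightarrow> open (q W)"
        "\<And>W. W \<in> \<K> \<Longrightarrow> W \<inter> U = U \<inter> \<phi> -` q W" by metis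
      have "\<Union>\<K> \<inter> U = (\<Union>W\<in>\<K>. W \<inter> U)" by auto
      also have "\<dots> = (\<Union>W\<in>\<K>. U \<inter> \<phi> -` q W)" using q(2) by simp
      also have "\<dots> = U \<inter> \<phi> -` (\<Union>W\<in>\<K>. q W)" by auto
      finally show "\<exists>Q. open Q \<and> \<Union>\<K> \<inter> U = U \<inter> \<phi> -` Q"
        using q(1) by (metis open_UN)
    qed
  qed
  then show ?thesis
    unfolding manifold_topology_def by (simp add: topology_inverse')
qed

definition manifold :: "enat \<Rightarrow> ('a, 'e::lcs) chart set \<Rightarrow> bool" where
  "manifold k A \<longleftrightarrow>
     (\<forall>(U, \<phi>)\<in>A. inj_on \<phi> U \<and> open (\<phi> ` U)) \<and>
     (\<forall>(U, \<phi>)\<in>A. \<forall>(V, \<psi>)\<in>A. Ck_on k (\<psi> \<circ> inv_into U \<phi>) (\<phi> ` (U \<inter> V))) \<and>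
     Hausdorff_space (manifold_topology A)"

definition product_atlas ::
  "('a, 'e) chart set \<Rightarrow> ('b, 'f) chart set \<Rightarrow> ('a \<times> 'b, 'e \<times> 'f) chart set" where
  "product_atlas A B = {(U \<times> V, map_prod \<phi> \<psi>) |U \<phi> V \<psi>. (U, \<phi>) \<in> A \<and> (V, \<psi>) \<in> B}"

text \<open>\<open>Ck_on\<close> includes openness of the set, so \<open>Ck_map\<close> includes continuity.\<close>

definition Ck_map :: "enat \<Rightarrow> ('a, 'e::lcs) chart set \<Rightarrow> ('b, 'f::lcs) chart set \<Rightarrow> ('a \<Rightarrow> 'b) \<Rightarrow> bool"
  where
  "Ck_map k A B f \<longleftrightarrow> f ` points A \<subseteq> points B \<and>
     (\<forall>(U, \<phi>)\<in>A. \<forall>(V, \<psi>)\<in>B. Ck_on k (\<psi> \<circ> f \<circ> inv_into U \<phi>) (\<phi> ` (U \<inter> f -` V)))"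

definition Ck_path :: "enat \<Rightarrow> ('a, 'e::lcs) chart set \<Rightarrow> real \<Rightarrow> real \<Rightarrow> (real \<Rightarrow> 'a) \<Rightarrow> bool" where
  "Ck_path k A a b \<alpha> \<longleftrightarrow> a < b \<and> \<alpha> ` {a..b} \<subseteq> points A \<and>
     (\<forall>(U, \<phi>)\<in>A. openin (top_of_set {a..b}) ({a..b} \<inter> \<alpha> -` U) \<and>
        Ck_curve k (\<phi> \<circ> \<alpha>) ({a..b} \<inter> \<alpha> -` U))"

definition piecewise_Ck_path ::
  "enat \<Rightarrow> ('a, 'e::lcs) chart set \<Rightarrow> real \<Rightarrow> real \<Rightarrow> (real \<Rightarrow> 'a) \<Rightarrow> bool" where
  "piecewise_Ck_path k A a b \<alpha> \<longleftrightarrow> a < b \<and>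
     (\<exists>n (\<tau>::nat \<Rightarrow> real). \<tau> 0 = a \<and> \<tau> n = b \<and> (\<forall>i<n. Ck_path k A (\<tau> i) (\<tau> (Suc i)) \<alpha>))"

section \<open>Tangent vectors\<close>

text \<open>A tangent vector at \<open>x\<close> is the family of its coordinate representations in the charts
  around \<open>x\<close>, related by the differentials of the transition maps; it is set to \<open>0\<close> on all other
  arguments, so that the vector space operations of the tangent space are pointwise.\<close>

type_synonym ('a, 'e) tangent = "('a, 'e) chart \<Rightarrow> 'e"

definition tangent_space :: "('a, 'e::lcs) chart set \<Rightarrow> 'a \<Rightarrow> ('a, 'e) tangent set" where
  "tangent_space A x = {\<xi>. (\<forall>c. c \<notin> charts_at A x \<longrightarrow> \<xi> c = 0) \<and>
     (\<forall>(U, \<phi>)\<in>charts_at A x. \<forall>(V, \<psi>)\<in>charts_at A x.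
        \<xi> (V, \<psi>) = dir_deriv (\<psi> \<circ> inv_into U \<phi>) (\<phi> x) (\<xi> (U, \<phi>)))}"

definition tangent_bundle_atlas ::
  "('a, 'e::lcs) chart set \<Rightarrow> ('a \<times> ('a, 'e) tangent, 'e \<times> 'e) chart set" where
  "tangent_bundle_atlas A =
     {(Sigma U (tangent_space A), \<lambda>(x, \<xi>). (\<phi> x, \<xi> (U, \<phi>))) |U \<phi>. (U, \<phi>) \<in> A}"

text \<open>\<open>differential A B f x\<close> is $f_{*x}$. The choice of the chart around \<open>x\<close> is immaterial for
  maps of class $C^1$.\<close>

definition differential ::
  "('a, 'e::lcs) chart set \<Rightarrow> ('b, 'f::lcs) chart set \<Rightarrow> ('a \<Rightarrow> 'b) \<Rightarrow> 'a \<Rightarrow>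
     ('a, 'e) tangent \<Rightarrow> ('b, 'f) tangent" where
  "differential A B f x \<xi> = (\<lambda>d. if d \<in> charts_at B (f x) then
     (let c = (SOME c. c \<in> charts_at A x) in
        dir_deriv (snd d \<circ> f \<circ> inv_into (fst c) (snd c)) (snd c x) (\<xi> c)) else 0)"

definition differentiable_at ::
  "('a, 'e::lcs) chart set \<Rightarrow> real set \<Rightarrow> (real \<Rightarrow> 'a) \<Rightarrow> real \<Rightarrow> bool" where
  "differentiable_at A S \<alpha> t \<longleftrightarrow> (\<forall>d\<in>charts_at A (\<alpha> t). \<exists>y. has_curve_deriv (snd d \<circ> \<alpha>) S t y)"

definition velocity ::
  "('a, 'e::lcs) chart set \<Rightarrow> real set \<Rightarrow> (real \<Rightarrow> 'a) \<Rightarrow> real \<Rightarrow> ('a, 'e) tangent" where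
  "velocity A S \<alpha> t = (\<lambda>d. if d \<in> charts_at A (\<alpha> t) then curve_deriv (snd d \<circ> \<alpha>) S t else 0)"

section \<open>Lie groups and initial Lie subgroups\<close>

text \<open>The parameter \<open>s\<close> is the class of the manifold, and ``smooth'' means $C^s$ throughout;
  \<open>s = \<infinity>\<close> is the usual case.\<close>

definition lie_group :: "enat \<Rightarrow> ('g, 'x) monoid_scheme \<Rightarrow> ('g, 'e::lcs) chart set \<Rightarrow> bool" where
  "lie_group s G A \<longleftrightarrow> 2 \<le> s \<and> group G \<and> carrier G = points A \<and> manifold s A \<and>
     Ck_map 2 (product_atlas A A) A (\<lambda>(x, y). x \<otimes>\<^bsub>G\<^esub> inv\<^bsub>G\<^esub> y)"

definition left_trans ::
  "('g, 'x) monoid_scheme \<Rightarrow> ('g, 'e::lcs) chart set \<Rightarrow> 'g \<Rightarrow> 'g \<Rightarrow>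
     ('g, 'e) tangent \<Rightarrow> ('g, 'e) tangent" where
  "left_trans G A g h v = differential A A (\<lambda>x. g \<otimes>\<^bsub>G\<^esub> x) h v"

definition right_trans ::
  "('g, 'x) monoid_scheme \<Rightarrow> ('g, 'e::lcs) chart set \<Rightarrow> 'g \<Rightarrow> 'g \<Rightarrow>
     ('g, 'e) tangent \<Rightarrow> ('g, 'e) tangent" where
  "right_trans G A g h v = differential A A (\<lambda>x. x \<otimes>\<^bsub>G\<^esub> g) h v"

text \<open>\<open>initial_in TYPE('n) TYPE('w) s AK A K\<close>: \<open>AK\<close> makes \<open>K\<close> a manifold smoothly included in
  the manifold \<open>A\<close>, and $C^s$ maps into \<open>A\<close> with values in \<open>K\<close> are $C^s$ into \<open>K\<close>. The test
  manifolds have points in \<open>'n\<close> and are modeled on \<open>'w\<close>.\<close>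

definition initial_in ::
  "'n itself \<Rightarrow> 'w::lcs itself \<Rightarrow> enat \<Rightarrow> ('g, 'k::lcs) chart set \<Rightarrow> ('g, 'e::lcs) chart set \<Rightarrow>
     'g set \<Rightarrow> bool" where
  "initial_in _ _ s AK A K \<longleftrightarrow> Ck_map s AK A (\<lambda>x. x) \<and>
     (\<forall>(N :: ('n, 'w) chart set) f.
        manifold s N \<and> Ck_map s N A f \<and> f ` points N \<subseteq> K \<longrightarrow> Ck_map s N AK f)"

definition lie_subalgebra ::
  "('g, 'x) monoid_scheme \<Rightarrow> ('g, 'k::lcs) chart set \<Rightarrow> ('g, 'e::lcs) chart set \<Rightarrow>
     ('g, 'e) tangent set" where
  "lie_subalgebra G AK A = differential AK A (\<lambda>x. x) \<one>\<^bsub>G\<^esub> ` tangent_space AK \<one>\<^bsub>G\<^esub>"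

text \<open>Derivatives of piecewise smooth paths are considered where they exist; the remaining
  finitely many one-sided derivatives are limits of these.\<close>

definition detects_paths ::
  "enat \<Rightarrow> ('g, 'x) monoid_scheme \<Rightarrow> ('g, 'e::lcs) chart set \<Rightarrow> 'g set \<Rightarrow> ('g, 'e) tangent set \<Rightarrow> bool"
  where
  "detects_paths s G A K \<kk> \<longleftrightarrow>
     (\<forall>a b \<alpha>. piecewise_Ck_path s A a b \<alpha> \<longrightarrow>
        (\<alpha> ` {a..b} \<subseteq> K \<longleftrightarrow>
         \<alpha> ` {a..b} \<inter> K \<noteq> {} \<and>
         (\<forall>t\<in>{a..b}. differentiable_at A {a..b} \<alpha> t \<longrightarrow>
            left_trans G A (inv\<^bsub>G\<^esub> (\<alpha> t)) (\<alpha> t) (velocity A {a..b} \<alpha> t) \<in> \<kk>)))"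

text \<open>Solvability of $\dot\alpha\alpha^{-1}=\xi$, $\alpha(0)=1$ for smooth paths $\xi$ in the Lie
  algebra, whose topology is that of the model space, read off in any chart around the unit.\<close>

definition has_evolutions :: "enat \<Rightarrow> ('g, 'x) monoid_scheme \<Rightarrow> ('g, 'e::lcs) chart set \<Rightarrow> bool" where
  "has_evolutions s G A \<longleftrightarrow>
     (\<forall>\<xi>. (\<forall>t\<in>{0..1}. \<xi> t \<in> tangent_space A \<one>\<^bsub>G\<^esub>) \<and>
        (\<forall>c\<in>charts_at A \<one>\<^bsub>G\<^esub>. Ck_curve s (\<lambda>t. \<xi> t c) {0..1}) \<longrightarrow>
        (\<exists>\<alpha>. Ck_path s A 0 1 \<alpha> \<and> \<alpha> 0 = \<one>\<^bsub>G\<^esub> \<and>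
           (\<forall>t\<in>{0..1}. right_trans G A (inv\<^bsub>G\<^esub> (\<alpha> t)) (\<alpha> t) (velocity A {0..1} \<alpha> t) = \<xi> t)))"

definition path_lifting ::
  "('g, 'x) monoid_scheme \<Rightarrow> ('g, 'e::lcs) chart set \<Rightarrow> ('m, 'f::lcs) chart set \<Rightarrow>
     ('g \<Rightarrow> 'm \<Rightarrow> 'm) \<Rightarrow> 'm \<Rightarrow> bool" where
  "path_lifting G A B \<pi> p \<longleftrightarrow>
     (\<forall>a b \<gamma>. piecewise_Ck_path 1 B a b \<gamma> \<and> \<gamma> a = p \<longrightarrow>
        (\<exists>\<alpha>. piecewise_Ck_path 1 A a b \<alpha> \<and> \<alpha> a = \<one>\<^bsub>G\<^esub> \<and> (\<forall>t\<in>{a..b}. \<pi> (\<alpha> t) p = \<gamma> t)))"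

section \<open>Finsler metrics, length and distance\<close>

definition finsler_metric ::
  "('a, 'e::lcs) chart set \<Rightarrow> ('a \<Rightarrow> ('a, 'e) tangent \<Rightarrow> real) \<Rightarrow> bool" where
  "finsler_metric A \<mu> \<longleftrightarrow>
     continuous_map (manifold_topology (tangent_bundle_atlas A)) euclideanreal (\<lambda>(x, v). \<mu> x v) \<and>
     (\<forall>x\<in>points A. \<forall>v\<in>tangent_space A x.
        0 \<le> \<mu> x v \<and>
        (\<forall>w\<in>tangent_space A x. \<mu> x (\<lambda>c. v c + w c) \<le> \<mu> x v + \<mu> x w) \<and>
        (\<forall>r\<ge>0. \<mu> x (\<lambda>c. r *\<^sub>R v c) = r * \<mu> x v))"

definition uniform_metric ::
  "('g, 'x) monoid_scheme \<Rightarrow> ('g, 'e::lcs) chart set \<Rightarrow> ('g \<Rightarrow> ('g, 'e) tangent \<Rightarrow> real) \<Rightarrow>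
     ('g \<Rightarrow> real) \<Rightarrow> bool" where
  "uniform_metric G A \<mu> L \<longleftrightarrow>
     (\<forall>r. openin (manifold_topology A) {g \<in> carrier G. L g < r}) \<and>
     (\<forall>g\<in>carrier G. 0 \<le> L g) \<and> L \<one>\<^bsub>G\<^esub> = 1 \<and>
     (\<forall>g\<in>carrier G. \<forall>h\<in>carrier G. \<forall>v\<in>tangent_space A h.
        \<mu> (g \<otimes>\<^bsub>G\<^esub> h) (left_trans G A g h v) \<le> L g * \<mu> h v)"

definition right_invariant ::
  "('g, 'x) monoid_scheme \<Rightarrow> ('g, 'e::lcs) chart set \<Rightarrow> 'g set \<Rightarrow>
     ('g \<Rightarrow> ('g, 'e) tangent \<Rightarrow> real) \<Rightarrow> bool" where
  "right_invariant G A K \<mu> \<longleftrightarrow>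
     (\<forall>g\<in>carrier G. \<forall>u\<in>K. \<forall>v\<in>tangent_space A g.
        \<mu> (g \<otimes>\<^bsub>G\<^esub> u) (right_trans G A u g v) = \<mu> g v)"

text \<open>Lengths and distances take values in \<open>ennreal\<close>, so that the distance between points not
  joined by a path is \<open>\<infinity>\<close>. The velocity is meaningless only at the finitely many break points.\<close>

definition path_length ::
  "('a, 'e::lcs) chart set \<Rightarrow> ('a \<Rightarrow> ('a, 'e) tangent \<Rightarrow> real) \<Rightarrow> real \<Rightarrow> real \<Rightarrow> (real \<Rightarrow> 'a) \<Rightarrow> ennreal"
  where
  "path_length A \<mu> a b \<alpha> =
     (\<integral>\<^sup>+t\<in>{a..b}. ennreal (\<mu> (\<alpha> t) (velocity A {a..b} \<alpha> t)) \<partial>lborel)"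

definition path_dist ::
  "('a, 'e::lcs) chart set \<Rightarrow> ('a \<Rightarrow> ('a, 'e) tangent \<Rightarrow> real) \<Rightarrow> 'a \<Rightarrow> 'a \<Rightarrow> ennreal" where
  "path_dist A \<mu> x y =
     Inf {path_length A \<mu> a b \<alpha> |a b \<alpha>. piecewise_Ck_path 1 A a b \<alpha> \<and> \<alpha> a = x \<and> \<alpha> b = y}"

definition short_path ::
  "('a, 'e::lcs) chart set \<Rightarrow> ('a \<Rightarrow> ('a, 'e) tangent \<Rightarrow> real) \<Rightarrow> real \<Rightarrow> real \<Rightarrow> (real \<Rightarrow> 'a) \<Rightarrow> bool"
  where
  "short_path A \<mu> a b \<alpha> \<longleftrightarrow>
     piecewise_Ck_path 1 A a b \<alpha> \<and> path_length A \<mu> a b \<alpha> = path_dist A \<mu> (\<alpha> a) (\<alpha> b)"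

definition coset_dist ::
  "('g, 'x) monoid_scheme \<Rightarrow> ('g, 'e::lcs) chart set \<Rightarrow> ('g \<Rightarrow> ('g, 'e) tangent \<Rightarrow> real) \<Rightarrow>
     'g \<Rightarrow> 'g \<Rightarrow> 'g set \<Rightarrow> ennreal" where
  "coset_dist G A \<mu> g h K = (INF k\<in>K. path_dist A \<mu> g (h \<otimes>\<^bsub>G\<^esub> k))"

text \<open>The description by \<open>THE\<close> reflects that the value does not depend on the representative
  $\dot g\in T_gG$ of $v=(\pi_p)_{*g}\dot g$.\<close>

definition quotient_metric ::
  "('g, 'x) monoid_scheme \<Rightarrow> ('g, 'e::lcs) chart set \<Rightarrow> ('m, 'f::lcs) chart set \<Rightarrow>
     ('g \<Rightarrow> 'm \<Rightarrow> 'm) \<Rightarrow> 'm \<Rightarrow> ('g, 'e) tangent set \<Rightarrow> ('g \<Rightarrow> ('g, 'e) tangent \<Rightarrow> real) \<Rightarrow>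
     'm \<Rightarrow> ('m, 'f) tangent \<Rightarrow> real" where
  "quotient_metric G A B \<pi> p \<kk> \<mu> x v = (THE r. \<exists>g\<in>carrier G. \<exists>g'\<in>tangent_space A g.
     \<pi> g p = x \<and> differential A B (\<lambda>y. \<pi> y p) g g' = v \<and>
     r = Inf {\<mu> g (\<lambda>c. g' c - left_trans G A g \<one>\<^bsub>G\<^esub> z c) |z. z \<in> \<kk>})"

end

theory Submission
  imports Defs
begin

text \<open>
  Everything follows from one identity: the distance from $g$ to the coset $hK$ in the group equals
  the distance from $g\cdot p$ to $h\cdot p$ in the homogeneous space
  (\<open>coset_dist_eq_path_dist\<close>). Projection of paths does not increase lengths, so along the given
  path $\Gamma$ with projection $\gamma$ one always has
  $d_M(g\cdot p,h\cdot p)\le L_M(\gamma)\le \mathrm{Length}(\Gamma)$; the outer terms agree exactly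
  when both inequalities are equalities, that is, when $\gamma$ is short and $\Gamma$ is an
  isometric lift. As $\mathrm{dist}(g,hK)\le\mathrm{dist}(g,h)\le\mathrm{Length}(\Gamma)$, equality
  of the outer terms also makes $\Gamma$ short and realizes the distance to the coset at $h$ itself.

  In the identity, the inequality from the right to the left is the projection of paths. For the
  other one, let $\alpha$ be a lift of a path $\gamma$ from $g\cdot p$ to $h\cdot p$. If $u$ is a
  path in $K$ with $\dot u u^{-1}=-z$, the path $\alpha u$ is again a lift, and its velocity is the
  right translate of $\dot\alpha-\alpha z$ by $u$; so its speed is
  $F(t,z)=|\dot\alpha_t-\alpha_t z|_{\alpha_t}$ by right invariance (\<open>modify_path\<close>). The quotient
  speed of $\gamma$ is $\inf_z F(t,z)$. It remains to choose $z$ piecewise constant in $t$ with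
  $\int F(t,z(t))\,dt\le\int\inf_z F(t,z)\,dt+\varepsilon$. As all $F(\cdot,z)$ are continuous on
  the $C^1$ pieces, a countable set of vectors $z$ suffices for the infimum, and by monotone
  convergence its integral is approximated by that of a minimum $m$ of finitely many $F(\cdot,z)$
  (\<open>integral_Inf_approx\<close>). Near each parameter one of these vectors satisfies
  $F(\cdot,z)<m+\varepsilon$, and a subdivision of the interval finishes the proof
  (\<open>lift_below_continuous\<close>).

  The quotient metric is well defined because the vectors at $g$ with a given image in the
  homogeneous space form one coset of the left translates of $\mathrm{Lie}(K)$, and right
  translation by $K$ carries these sets to each other without changing the metric
  (\<open>quotient_metric_eq\<close>).

  The calculus in locally convex spaces rests on a mean value theorem that is proved by bisection
  (\<open>mean_value_convex\<close>): slopes of secants stay in every open convex set that contains the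
  derivatives. It gives strict differentiability of maps of class $C^1$ (\<open>C1_strict\<close>), hence the
  linearity of derivatives and the chain rules for maps and for curves.
\<close>

section \<open>Directional derivatives in locally convex spaces\<close>

lemma locally_convex_at:
  fixes y :: "'a::lcs"
  assumes "open U" "y \<in> U"
  obtains V where "open V" "convex V" "y \<in> V" "V \<subseteq> U"
proof -
  have cont: "continuous_on UNIV ((+) y)" "continuous_on UNIV ((+) (- y))"
    by (auto intro!: continuous_intros)
  have "open ((+) y -` U)" using assms(1) cont(1) by (rule open_vimage)
  moreover have "0 \<in> (+) y -` U" using assms(2) by simp
  ultimately obtain V where V: "open V" "convex V" "0 \<in> V" "V \<subseteq> (+) y -` U"
    using locally_convex by meson
  have eq: "(+) y ` V = (+) (- y) -` V"
  proof
    show "(+) (- y) -` V \<subseteq> (+) y ` V"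
    proof
      fix x assume "x \<in> (+) (- y) -` V"
      then have "- y + x \<in> V" by simp
      moreover have "x = y + (- y + x)" by simp
      ultimately show "x \<in> (+) y ` V" by blast
    qed
  qed auto
  show thesis
  proof
    show "open ((+) y ` V)" unfolding eq using V(1) cont(2) by (rule open_vimage)
    show "convex ((+) y ` V)" using V(2) by (rule convex_translation)
    show "y \<in> (+) y ` V" using V(3) by force
    show "(+) y ` V \<subseteq> U" using V(4) by auto
  qed
qed

lemma has_curve_deriv_unique:
  assumes "has_curve_deriv c S t y" "has_curve_deriv c S t z" "at t within S \<noteq> bot"
  shows "y = z"
  using assms unfolding has_curve_deriv_def by (blast intro: tendsto_unique)

lemma curve_deriv_eqI:
  assumes "has_curve_deriv c S t y" "at t within S \<noteq> bot"
  shows "curve_deriv c S t = y"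
  unfolding curve_deriv_def using assms by (blast intro: has_curve_deriv_unique)

lemma has_curve_deriv_cong_filter:
  assumes "has_curve_deriv c S t y" "at t within S' \<le> at t within S"
    and "eventually (\<lambda>s. c' s = c s) (at t within S')" "c' t = c t"
  shows "has_curve_deriv c' S' t y"
proof -
  have "((\<lambda>s. (1 / (s - t)) *\<^sub>R (c s - c t)) \<longlongrightarrow> y) (at t within S')"
    using assms(1,2) unfolding has_curve_deriv_def by (blast intro: tendsto_mono)
  then show ?thesis
    unfolding has_curve_deriv_def
    by (rule Lim_transform_eventually) (use assms(3,4) in \<open>auto elim: eventually_mono\<close>)
qed

lemma has_dir_deriv_curve:
  "has_dir_deriv f x v y \<longleftrightarrow> has_curve_deriv (\<lambda>t. f (x + t *\<^sub>R v)) UNIV 0 y"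
  unfolding has_dir_deriv_def has_curve_deriv_def by simp

lemma dir_deriv_curve:
  "dir_deriv f x v = curve_deriv (\<lambda>t. f (x + t *\<^sub>R v)) UNIV 0"
  unfolding dir_deriv_def curve_deriv_def has_dir_deriv_curve ..

lemma dir_deriv_eqI: "has_dir_deriv f x v y \<Longrightarrow> dir_deriv f x v = y"
  unfolding has_dir_deriv_curve dir_deriv_curve by (rule curve_deriv_eqI) auto

lemma tendsto_line:
  fixes x v :: "'a::lcs"
  shows "((\<lambda>t. x + t *\<^sub>R v) \<longlongrightarrow> x) (nhds 0)"
proof -
  have "((\<lambda>t. x + t *\<^sub>R v) \<longlongrightarrow> x + 0 *\<^sub>R v) (nhds 0)"
    by (intro tendsto_add tendsto_const tendsto_scaleR_lcs filterlim_ident)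
  then show ?thesis by simp
qed

lemma has_dir_deriv_cong:
  fixes x v :: "'a::lcs"
  assumes "has_dir_deriv f x v y" "open N" "x \<in> N" "\<And>z. z \<in> N \<Longrightarrow> f' z = f z"
  shows "has_dir_deriv f' x v y"
proof -
  have "eventually (\<lambda>t. x + t *\<^sub>R v \<in> N) (nhds 0)"
    using topological_tendstoD[OF tendsto_line assms(2,3)] .
  then have "eventually (\<lambda>t. f' (x + t *\<^sub>R v) = f (x + t *\<^sub>R v)) (at 0)"
    by (auto simp: eventually_at_filter elim!: eventually_mono intro: assms(4))
  then show ?thesis
    using has_curve_deriv_cong_filter[of "\<lambda>t. f (x + t *\<^sub>R v)" UNIV 0 y UNIV "\<lambda>t. f' (x + t *\<^sub>R v)"]
      assms(1,3,4) unfolding has_dir_deriv_curve by simp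
qed

lemma dir_deriv_cong:
  fixes x v :: "'a::lcs"
  assumes "open N" "x \<in> N" "\<And>z. z \<in> N \<Longrightarrow> f' z = f z"
  shows "dir_deriv f' x v = dir_deriv f x v"
proof -
  have "has_dir_deriv f' x v y \<longleftrightarrow> has_dir_deriv f x v y" for y
    using has_dir_deriv_cong[of f x v y N f'] has_dir_deriv_cong[of f' x v y N f] assms by auto
  then show ?thesis unfolding dir_deriv_def by presburger
qed

text \<open>The pointwise form of membership in the class $C^1$.\<close>

definition C1_at :: "('e::lcs \<Rightarrow> 'f::lcs) \<Rightarrow> 'e \<Rightarrow> bool" where
  "C1_at f x \<longleftrightarrow> isCont f x \<and>
     (\<forall>v. (\<exists>y. has_dir_deriv f x v y) \<and> isCont (\<lambda>(x, v). dir_deriv f x v) (x, v))"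

lemma Ck_on_mono: "Ck_on k f U \<Longrightarrow> j \<le> k \<Longrightarrow> Ck_on j f U"
  unfolding Ck_on_def by (meson order.trans order.strict_trans2)

lemma Ck_on_1_iff: "Ck_on 1 f U \<longleftrightarrow> open U \<and> (\<forall>x\<in>U. C1_at f x)"
proof (cases "open U")
  case True
  have le1: "enat n \<le> 1 \<longleftrightarrow> n = 0 \<or> n = 1" and lt1: "enat n < 1 \<longleftrightarrow> n = 0" for n
    by (auto simp: one_enat_def)
  have all2: "(\<forall>n. n = 0 \<or> n = 1 \<longrightarrow> P n) \<longleftrightarrow> P 0 \<and> P 1" for P :: "nat \<Rightarrow> bool"
    by auto
  \<comment> \<open>Of the sequence of directions the derivative of order one uses only the entry \<open>0\<close>.\<close>
  have it0: "iter_dir_deriv 0 f = (\<lambda>x v. f x)" and it1: "iter_dir_deriv 1 f = (\<lambda>x v. dir_deriv f x (v 0))"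
    by (auto simp: fun_eq_iff)
  have fst: "continuous_on (U \<times> (UNIV::(nat \<Rightarrow> 'a) set)) (\<lambda>(x, v). f x) \<longleftrightarrow> continuous_on U f"
    (is "?L \<longleftrightarrow> ?R")
  proof
    assume ?L
    have c: "continuous_on U (\<lambda>x. (x, (\<lambda>_. 0) :: nat \<Rightarrow> 'a))"
      by (rule continuous_on_Pair[OF continuous_on_id continuous_on_const])
    have "(\<lambda>x. (x, (\<lambda>_. 0) :: nat \<Rightarrow> 'a)) ` U \<subseteq> U \<times> UNIV" by blast
    from continuous_on_compose2[OF \<open>?L\<close> c this] show ?R by simp
  next
    assume ?R
    have "fst ` (U \<times> (UNIV::(nat \<Rightarrow> 'a) set)) \<subseteq> U" by auto
    from continuous_on_compose2[OF \<open>?R\<close> continuous_on_fst[OF continuous_on_id] this]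
    show ?L by (simp add: case_prod_unfold)
  qed
  have snd: "continuous_on (U \<times> (UNIV::(nat \<Rightarrow> 'a) set)) (\<lambda>(x, v). dir_deriv f x (v 0)) \<longleftrightarrow>
     continuous_on (U \<times> UNIV) (\<lambda>(x, v). dir_deriv f x v)" (is "?L \<longleftrightarrow> ?R")
  proof
    assume ?L
    have c: "continuous_on (U \<times> UNIV) (\<lambda>z. (fst z, (\<lambda>_. snd z) :: nat \<Rightarrow> 'a))"
    proof (rule continuous_on_Pair)
      show "continuous_on (U \<times> UNIV) (\<lambda>z. (\<lambda>_. snd z) :: nat \<Rightarrow> 'a)"
        by (rule continuous_on_coordinatewise_then_product) (rule continuous_on_snd[OF continuous_on_id])
    qed (rule continuous_on_fst[OF continuous_on_id])
    have "(\<lambda>z. (fst z, (\<lambda>_. snd z) :: nat \<Rightarrow> 'a)) ` (U \<times> UNIV) \<subseteq> U \<times> UNIV" by auto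
    from continuous_on_compose2[OF \<open>?L\<close> c this] show ?R by (simp add: case_prod_unfold)
  next
    assume ?R
    have c: "continuous_on (U \<times> UNIV) (\<lambda>z. (fst z, snd z 0) :: 'a \<times> 'a)"
      by (rule continuous_on_Pair[OF continuous_on_fst[OF continuous_on_id]
            continuous_on_product_then_coordinatewise[OF continuous_on_snd[OF continuous_on_id]]])
    have "(\<lambda>z. (fst z, snd z 0) :: 'a \<times> 'a) ` (U \<times> UNIV) \<subseteq> U \<times> UNIV" by auto
    from continuous_on_compose2[OF \<open>?R\<close> c this] show ?L by (simp add: case_prod_unfold)
  qed
  have "Ck_on 1 f U \<longleftrightarrow> continuous_on U f \<and> continuous_on (U \<times> UNIV) (\<lambda>(x, v). dir_deriv f x v) \<and>
      (\<forall>x\<in>U. \<forall>v. \<exists>y. has_dir_deriv f x v y)"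
    unfolding Ck_on_def le1 lt1 using True fst snd
    by (simp only: all2 it0 it1 simp_thms conj_assoc)
  also have "\<dots> \<longleftrightarrow> (\<forall>x\<in>U. C1_at f x)"
    unfolding C1_at_def continuous_on_eq_continuous_at[OF True]
      continuous_on_eq_continuous_at[OF open_Times[OF True open_UNIV]] by auto
  finally show ?thesis using True by simp
qed (simp add: Ck_on_def)

lemma C1_at_has_dir_deriv: "C1_at f x \<Longrightarrow> has_dir_deriv f x v (dir_deriv f x v)"
  unfolding C1_at_def by (metis dir_deriv_eqI)

lemma C1_at_cong:
  fixes x :: "'a::lcs"
  assumes "C1_at f x" "open N" "x \<in> N" "\<And>z. z \<in> N \<Longrightarrow> f' z = f z"
  shows "C1_at f' x"
  unfolding C1_at_def
proof (intro conjI allI)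
  have ev: "eventually (\<lambda>z. f' z = f z) (nhds x)"
    using assms(2-4) eventually_nhds by blast
  show "isCont f' x" using assms(1) isCont_cong[OF ev] unfolding C1_at_def by blast
  fix v
  show "\<exists>y. has_dir_deriv f' x v y"
    using has_dir_deriv_cong[OF C1_at_has_dir_deriv[OF assms(1)] assms(2-4)] by blast
  have "eventually (\<lambda>z. z \<in> N \<times> UNIV) (nhds (x, v))"
    using assms(2,3) by (intro eventually_nhds_in_open open_Times) auto
  then have ev: "eventually (\<lambda>z. (\<lambda>(x, v). dir_deriv f' x v) z = (\<lambda>(x, v). dir_deriv f x v) z) (nhds (x, v))"
    by (rule eventually_mono) (auto intro!: dir_deriv_cong[OF assms(2)] assms(4))
  show "isCont (\<lambda>(x, v). dir_deriv f' x v) (x, v)"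
    unfolding isCont_cong[OF ev] using assms(1) unfolding C1_at_def by blast
qed

lemma Ck_on_1_cong: "Ck_on 1 f U \<Longrightarrow> (\<And>x. x \<in> U \<Longrightarrow> f' x = f x) \<Longrightarrow> Ck_on 1 f' U"
  unfolding Ck_on_1_iff by (metis C1_at_cong)

text \<open>A mean value theorem without functionals: a secant whose slope leaves an open convex set
  has a half of the same kind, and near a point the secants around it have slopes close to the
  derivative.\<close>

lemma mean_value_convex:
  fixes c :: "real \<Rightarrow> 'a::lcs"
  assumes "s < t" "open Q" "convex Q"
    and deriv: "\<And>r. r \<in> {s..t} \<Longrightarrow> \<exists>y\<in>Q. has_curve_deriv c {s..t} r y"
  shows "(1 / (t - s)) *\<^sub>R (c t - c s) \<in> Q"
proof -
  let ?q = "\<lambda>x y. (1 / (y - x)) *\<^sub>R (c y - c x)"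
  let ?P = "\<lambda>x y. s \<le> x \<and> x < y \<and> y \<le> t \<longrightarrow> ?q x y \<in> Q"
  have comb: "?q x z \<in> Q" if "x < y" "y < z" "?q x y \<in> Q" "?q y z \<in> Q" for x y z
  proof -
    have "?q x z = ((y - x) / (z - x)) *\<^sub>R ?q x y + ((z - y) / (z - x)) *\<^sub>R ?q y z"
      using that(1,2) by (simp add: scaleR_diff_right)
    moreover have "(y - x) / (z - x) + (z - y) / (z - x) = 1"
      using that(1,2) by (simp add: add_divide_distrib[symmetric])
    ultimately show ?thesis
      using convexD[OF assms(3) that(3,4), of "(y - x) / (z - x)" "(z - y) / (z - x)"] that(1,2)
      by (simp del: scaleR_scaleR)
  qed
  have "?P s t"
  proof (rule Bolzano[of s t ?P])
    fix x y z assume P: "?P x y" "?P y z" and xyz: "x \<le> y" "y \<le> z"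
    show "?P x z"
    proof (rule impI)
      assume st: "s \<le> x \<and> x < z \<and> z \<le> t"
      consider "x = y" | "y = z" | "x < y" "y < z" using xyz by linarith
      then show "?q x z \<in> Q"
      proof cases
        case 3
        with st have "?q x y \<in> Q" "?q y z \<in> Q"
          by (intro P[rule_format]; simp)+
        then show ?thesis using comb 3 by blast
      qed (use P st in \<open>simp_all only: simp_thms\<close>)
    qed
  next
    fix x assume x: "s \<le> x" "x \<le> t"
    then obtain y where y: "y \<in> Q" "has_curve_deriv c {s..t} x y" using deriv by auto
    have "eventually (\<lambda>r. ?q x r \<in> Q) (at x within {s..t})"
      using topological_tendstoD[OF y(2)[unfolded has_curve_deriv_def] \<open>open Q\<close> y(1)] .
    then obtain d where d: "d > 0" "\<And>r. r \<in> {s..t} \<Longrightarrow> r \<noteq> x \<Longrightarrow> dist r x < d \<Longrightarrow> ?q x r \<in> Q"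
      unfolding eventually_at by auto
    have "?q u v \<in> Q" if "u \<le> x" "x \<le> v" "v - u < d" "s \<le> u" "u < v" "v \<le> t" for u v
    proof -
      have 1: "?q x v \<in> Q" if "x < v"
        using d(2)[of v] that \<open>u \<le> x\<close> \<open>v - u < d\<close> \<open>v \<le> t\<close> x by (auto simp: dist_real_def)
      have 2: "?q u x \<in> Q" if "u < x"
      proof -
        have "?q x u \<in> Q"
          using d(2)[of u] that \<open>x \<le> v\<close> \<open>v - u < d\<close> \<open>s \<le> u\<close> x by (auto simp: dist_real_def)
        moreover have "?q x u = ?q u x"
        proof -
          have "1 / (u - x) = - (1 / (x - u))" by (metis minus_diff_eq minus_divide_right)
          then have "?q x u = (- (1 / (x - u))) *\<^sub>R (c u - c x)" by (rule arg_cong)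
          also have "\<dots> = ?q u x" by (simp add: scaleR_diff_right)
          finally show ?thesis .
        qed
        ultimately show ?thesis by simp
      qed
      consider "u = x" | "x = v" | "u < x" "x < v" using \<open>u \<le> x\<close> \<open>x \<le> v\<close> by linarith
      then show ?thesis
      proof cases
        case 1
        then show ?thesis using \<open>x < v \<Longrightarrow> ?q x v \<in> Q\<close> \<open>u < v\<close> by simp
      next
        case 2
        then show ?thesis using \<open>u < x \<Longrightarrow> ?q u x \<in> Q\<close> \<open>u < v\<close> by simp
      next
        case 3
        then show ?thesis using comb \<open>x < v \<Longrightarrow> ?q x v \<in> Q\<close> \<open>u < x \<Longrightarrow> ?q u x \<in> Q\<close> by blast
      qed
    qed
    then show "\<exists>d>0. \<forall>u v. u \<le> x \<and> x \<le> v \<and> v - u < d \<longrightarrow> ?P u v"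
      using d(1) by blast
  qed (use assms(1) in simp)
  then show ?thesis using assms(1) by simp
qed

lemma has_curve_deriv_line:
  fixes x v :: "'a::lcs"
  assumes "has_dir_deriv f (x + r *\<^sub>R v) v y"
  shows "has_curve_deriv (\<lambda>t. f (x + t *\<^sub>R v)) S r y"
proof -
  have "filterlim (\<lambda>s. s - r) (at 0) (at r within S)"
    by (rule filterlim_atI) (auto intro!: tendsto_eq_intros simp: eventually_at_filter)
  from filterlim_compose[OF assms[unfolded has_dir_deriv_def] this]
  have "((\<lambda>s. (1 / (s - r)) *\<^sub>R (f (x + r *\<^sub>R v + (s - r) *\<^sub>R v) - f (x + r *\<^sub>R v))) \<longlongrightarrow> y) (at r within S)" .
  then show ?thesis
    unfolding has_curve_deriv_def by (simp add: algebra_simps)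
qed

lemma eventually_nhds_PairE:
  assumes "eventually P (nhds (x, y))"
  obtains A B where "open A" "open B" "x \<in> A" "y \<in> B" "\<And>a b. a \<in> A \<Longrightarrow> b \<in> B \<Longrightarrow> P (a, b)"
proof -
  obtain S where S: "open S" "(x, y) \<in> S" "\<forall>z\<in>S. P z"
    using assms unfolding eventually_nhds by blast
  obtain A B where "open A" "open B" "(x, y) \<in> A \<times> B" "A \<times> B \<subseteq> S"
    using open_prod_elim[OF S(1,2)] .
  then show thesis using S(3) that[of A B] by blast
qed

text \<open>Maps of class $C^1$ are strictly differentiable: the base point and the direction of the
  difference quotient may move. Linearity of the derivative and all chain rules follow.\<close>

lemma C1_strict:
  fixes f :: "'a::lcs \<Rightarrow> 'b::lcs"
  assumes "Ck_on 1 f U" "x \<in> U"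
  shows "((\<lambda>(t, y, w). (1 / t) *\<^sub>R (f (y + t *\<^sub>R w) - f y)) \<longlongrightarrow> dir_deriv f x v)
           (at 0 \<times>\<^sub>F nhds (x, v))"
proof (rule topological_tendstoI)
  fix Q :: "'b set" assume "open Q" "dir_deriv f x v \<in> Q"
  then obtain V where V: "open V" "convex V" "dir_deriv f x v \<in> V" "V \<subseteq> Q"
    by (rule locally_convex_at)
  have U: "open U" "\<And>y. y \<in> U \<Longrightarrow> C1_at f y" using assms(1) unfolding Ck_on_1_iff by auto
  have "isCont (\<lambda>(x, v). dir_deriv f x v) (x, v)"
    using U(2)[OF assms(2)] unfolding C1_at_def by blast
  then have "((\<lambda>(x, v). dir_deriv f x v) \<longlongrightarrow> dir_deriv f x v) (nhds (x, v))"
    using tendsto_at_iff_tendsto_nhds[of "\<lambda>(x, v). dir_deriv f x v" "(x, v)"] by (simp add: isCont_def)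
  from topological_tendstoD[OF this V(1,3)]
  have "eventually (\<lambda>(y, w). dir_deriv f y w \<in> V) (nhds (x, v))" by (simp add: case_prod_unfold)
  moreover have "eventually (\<lambda>(y, w). y \<in> U) (nhds (x, v))"
    using eventually_nhds_in_open[OF open_Times[OF U(1) open_UNIV], of "(x, v)"] assms(2)
    by (auto elim: eventually_mono)
  ultimately have "eventually (\<lambda>(y, w). y \<in> U \<and> dir_deriv f y w \<in> V) (nhds (x, v))"
    by eventually_elim auto
  then obtain N1 W1 where N1: "open N1" "open W1" "x \<in> N1" "v \<in> W1"
    "\<And>y w. y \<in> N1 \<Longrightarrow> w \<in> W1 \<Longrightarrow> y \<in> U \<and> dir_deriv f y w \<in> V"
    by (rule eventually_nhds_PairE) simp
  let ?F = "nhds (0::real, x, v)"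
  have id: "((\<lambda>z. z) \<longlongrightarrow> (0, x, v)) ?F" by (rule filterlim_ident)
  note sndid = tendsto_snd[OF id]
  have "((\<lambda>z. fst (snd z) + fst z *\<^sub>R snd (snd z)) \<longlongrightarrow>
      fst (snd (0::real, x, v)) + fst (0::real, x, v) *\<^sub>R snd (snd (0::real, x, v))) ?F"
    by (rule tendsto_add[OF tendsto_fst[OF sndid] tendsto_scaleR_lcs[OF tendsto_fst[OF id] tendsto_snd[OF sndid]]])
  then have "((\<lambda>(r, y, w). y + r *\<^sub>R w) \<longlongrightarrow> x) ?F"
    by (simp add: case_prod_unfold)
  from topological_tendstoD[OF this N1(1,3)]
  have "eventually (\<lambda>(r, y, w). y + r *\<^sub>R w \<in> N1) (nhds (0::real, x, v))"
    by (simp add: case_prod_unfold)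
  then obtain D S2 where S2: "open D" "open S2" "(0::real) \<in> D" "(x, v) \<in> S2"
     "\<And>r z. r \<in> D \<Longrightarrow> z \<in> S2 \<Longrightarrow> case (r, z) of (r, y, w) \<Rightarrow> y + r *\<^sub>R w \<in> N1"
    by (rule eventually_nhds_PairE) (rule that)
  obtain d where d: "d > 0" "\<And>r. \<bar>r\<bar> < d \<Longrightarrow> r \<in> D"
    using S2(1,3) unfolding open_dist by (auto simp: dist_real_def)
  have key: "(1 / t) *\<^sub>R (f (y + t *\<^sub>R w) - f y) \<in> V"
    if t: "t \<noteq> 0" "\<bar>t\<bar> < d" and yw: "(y, w) \<in> S2" "w \<in> W1" for t y w
  proof -
    have der: "\<exists>z\<in>V. has_curve_deriv (\<lambda>r. f (y + r *\<^sub>R w)) T r z" if "\<bar>r\<bar> < d" for r T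
    proof -
      have "y + r *\<^sub>R w \<in> U" "dir_deriv f (y + r *\<^sub>R w) w \<in> V"
        using N1(5)[OF _ yw(2)] S2(5)[OF d(2)[OF that] yw(1)] by auto
      then show ?thesis
        using has_curve_deriv_line[OF C1_at_has_dir_deriv[OF U(2)]] by blast
    qed
    show ?thesis
    proof (cases "t > 0")
      case True
      then show ?thesis
        using mean_value_convex[of 0 t V "\<lambda>r. f (y + r *\<^sub>R w)"] V(1,2) der t by auto
    next
      case False
      then have "(1 / (0 - t)) *\<^sub>R (f (y + 0 *\<^sub>R w) - f (y + t *\<^sub>R w)) \<in> V"
        using mean_value_convex[of t 0 V "\<lambda>r. f (y + r *\<^sub>R w)"] V(1,2) der t by auto
      then show ?thesis by (simp add: scaleR_diff_right)
    qed
  qed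
  have "eventually (\<lambda>t. t \<noteq> 0 \<and> \<bar>t\<bar> < d) (at (0::real))"
    using d(1) by (auto simp: eventually_at dist_real_def)
  moreover have "eventually (\<lambda>(y, w). (y, w) \<in> S2 \<and> w \<in> W1) (nhds (x, v))"
  proof -
    have "open (S2 \<inter> UNIV \<times> W1)" "(x, v) \<in> S2 \<inter> UNIV \<times> W1"
      using S2(2,4) N1(2,4) by (auto intro: open_Int open_Times)
    from eventually_nhds_in_open[OF this] show ?thesis by (rule eventually_mono) auto
  qed
  ultimately have "eventually (\<lambda>(t, z). (t \<noteq> 0 \<and> \<bar>t\<bar> < d) \<and> (case z of (y, w) \<Rightarrow> (y, w) \<in> S2 \<and> w \<in> W1)) (at 0 \<times>\<^sub>F nhds (x, v))"
    by (auto simp: eventually_prod_filter)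
  then show "eventually (\<lambda>z. (case z of (t, y, w) \<Rightarrow> (1 / t) *\<^sub>R (f (y + t *\<^sub>R w) - f y)) \<in> Q) (at 0 \<times>\<^sub>F nhds (x, v))"
    by (rule eventually_mono) (use key V(4) in auto)
qed

lemma C1_strict_compose:
  fixes f :: "'a::lcs \<Rightarrow> 'b::lcs"
  assumes "Ck_on 1 f U" "x \<in> U"
    and "filterlim t (at 0) F" "(y \<longlongrightarrow> x) F" "(w \<longlongrightarrow> v) F"
  shows "((\<lambda>i. (1 / t i) *\<^sub>R (f (y i + t i *\<^sub>R w i) - f (y i))) \<longlongrightarrow> dir_deriv f x v) F"
proof -
  have "filterlim (\<lambda>i. (t i, y i, w i)) (at 0 \<times>\<^sub>F nhds (x, v)) F"
    unfolding nhds_prod using assms(3-5) by (intro filterlim_Pair) auto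
  from filterlim_compose[OF C1_strict[OF assms(1,2)] this] show ?thesis by simp
qed

lemma linear_dir_deriv:
  fixes f :: "'a::lcs \<Rightarrow> 'b::lcs"
  assumes "Ck_on 1 f U" "x \<in> U"
  shows "linear (dir_deriv f x)"
proof (rule linearI)
  have "C1_at f x" using assms unfolding Ck_on_1_iff by auto
  note hd = C1_at_has_dir_deriv[OF this, unfolded has_dir_deriv_def]
  fix v w
  have "((\<lambda>t. x + t *\<^sub>R v) \<longlongrightarrow> x) (at 0)"
    using tendsto_line by (rule tendsto_mono[rotated]) (simp add: at_within_def)
  then have "((\<lambda>t. (1 / t) *\<^sub>R (f (x + t *\<^sub>R v + t *\<^sub>R w) - f (x + t *\<^sub>R v))) \<longlongrightarrow> dir_deriv f x w) (at 0)"
    by (intro C1_strict_compose[OF assms]) (auto intro: filterlim_ident)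
  from tendsto_add[OF hd[of v] this]
  have "((\<lambda>t. (1 / t) *\<^sub>R (f (x + t *\<^sub>R (v + w)) - f x)) \<longlongrightarrow> dir_deriv f x v + dir_deriv f x w) (at 0)"
    by (simp add: algebra_simps)
  then show "dir_deriv f x (v + w) = dir_deriv f x v + dir_deriv f x w"
    by (intro dir_deriv_eqI) (simp add: has_dir_deriv_def)
next
  fix r v
  have "C1_at f x" using assms unfolding Ck_on_1_iff by auto
  note hd = C1_at_has_dir_deriv[OF this, unfolded has_dir_deriv_def]
  show "dir_deriv f x (r *\<^sub>R v) = r *\<^sub>R dir_deriv f x v"
  proof (cases "r = 0")
    case True
    have "has_dir_deriv f x (0 *\<^sub>R v) 0" by (simp add: has_dir_deriv_def)
    then show ?thesis using True dir_deriv_eqI by fastforce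
  next
    case False
    have "filterlim (\<lambda>t. t * r) (at 0) (at 0)"
      by (rule filterlim_atI) (use False in \<open>auto intro!: tendsto_eq_intros simp: eventually_at_filter\<close>)
    from filterlim_compose[OF hd[of v] this]
    have "((\<lambda>t. r *\<^sub>R ((1 / (t * r)) *\<^sub>R (f (x + (t * r) *\<^sub>R v) - f x))) \<longlongrightarrow> r *\<^sub>R dir_deriv f x v) (at 0)"
      by (intro tendsto_scaleR_lcs tendsto_const)
    then have "has_dir_deriv f x (r *\<^sub>R v) (r *\<^sub>R dir_deriv f x v)"
      unfolding has_dir_deriv_def using False by simp
    then show ?thesis by (rule dir_deriv_eqI)
  qed
qed

lemma has_curve_deriv_compose:
  fixes f :: "'a::lcs \<Rightarrow> 'b::lcs"
  assumes "Ck_on 1 f U" "c t \<in> U" "has_curve_deriv c S t v"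
  shows "has_curve_deriv (\<lambda>s. f (c s)) S t (dir_deriv f (c t) v)"
proof -
  have "filterlim (\<lambda>s. s - t) (at 0) (at t within S)"
    by (rule filterlim_atI) (auto intro!: tendsto_eq_intros simp: eventually_at_filter)
  then have "((\<lambda>s. (1 / (s - t)) *\<^sub>R (f (c t + (s - t) *\<^sub>R ((1 / (s - t)) *\<^sub>R (c s - c t))) - f (c t)))
     \<longlongrightarrow> dir_deriv f (c t) v) (at t within S)"
    using assms(3) unfolding has_curve_deriv_def by (intro C1_strict_compose[OF assms(1,2)]) auto
  then show ?thesis
    unfolding has_curve_deriv_def
    by (rule Lim_transform_eventually) (auto simp: eventually_at_filter)
qed

lemma has_dir_deriv_compose:
  fixes g :: "'b::lcs \<Rightarrow> 'c::lcs"
  assumes "Ck_on 1 g U" "f x \<in> U" "has_dir_deriv f x v y"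
  shows "has_dir_deriv (\<lambda>z. g (f z)) x v (dir_deriv g (f x) y)"
  using has_curve_deriv_compose[OF assms(1), of "\<lambda>t. f (x + t *\<^sub>R v)" 0 UNIV y] assms(2,3)
  by (simp add: has_dir_deriv_curve)

lemma isCont_dir_deriv_tendsto:
  fixes f :: "'a::lcs \<Rightarrow> 'b::lcs"
  assumes "C1_at f x" "(y \<longlongrightarrow> x) F" "(w \<longlongrightarrow> v) F"
  shows "((\<lambda>i. dir_deriv f (y i) (w i)) \<longlongrightarrow> dir_deriv f x v) F"
proof -
  have "isCont (\<lambda>(x, v). dir_deriv f x v) (x, v)"
    using assms(1) unfolding C1_at_def by blast
  from isCont_tendsto_compose[OF this tendsto_Pair[OF assms(2,3)]] show ?thesis by simp
qed

lemma Ck_on_1_compose: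
  fixes f :: "'a::lcs \<Rightarrow> 'b::lcs" and g :: "'b \<Rightarrow> 'c::lcs"
  assumes f: "Ck_on 1 f U" and g: "Ck_on 1 g V" and W: "open W" "W \<subseteq> U" "f ` W \<subseteq> V"
  shows "Ck_on 1 (\<lambda>x. g (f x)) W"
  unfolding Ck_on_1_iff
proof (intro conjI ballI)
  have fx: "C1_at f x" "C1_at g (f x)" "f x \<in> V" if "x \<in> W" for x
    using f g W that unfolding Ck_on_1_iff by auto
  have dd: "has_dir_deriv (\<lambda>x. g (f x)) x v (dir_deriv g (f x) (dir_deriv f x v))" if "x \<in> W" for x v
    by (rule has_dir_deriv_compose[OF g]) (use fx[OF that] in \<open>auto intro: C1_at_has_dir_deriv\<close>)
  fix x assume x: "x \<in> W"
  have c: "isCont f x" "isCont g (f x)" using fx[OF x] unfolding C1_at_def by auto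
  show "C1_at (\<lambda>x. g (f x)) x"
    unfolding C1_at_def
  proof (intro conjI allI)
    show "isCont (\<lambda>x. g (f x)) x" using isCont_o2[OF c] .
    fix v
    show "\<exists>y. has_dir_deriv (\<lambda>x. g (f x)) x v y" using dd[OF x] by blast
    have "eventually (\<lambda>z. z \<in> W \<times> UNIV) (nhds (x, v))"
      using W(1) x by (intro eventually_nhds_in_open open_Times) auto
    then have ev: "eventually (\<lambda>z. (\<lambda>(x, v). dir_deriv (\<lambda>x. g (f x)) x v) z =
        dir_deriv g (f (fst z)) (dir_deriv f (fst z) (snd z))) (nhds (x, v))"
      by (rule eventually_mono) (auto intro!: dir_deriv_eqI dd)
    have fst: "(fst \<longlongrightarrow> x) (at (x, v))" and snd: "(snd \<longlongrightarrow> v) (at (x, v))"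
      by (auto intro!: tendsto_eq_intros)
    have "isCont (\<lambda>z. dir_deriv g (f (fst z)) (dir_deriv f (fst z) (snd z))) (x, v)"
      unfolding isCont_def fst_conv snd_conv
      by (intro isCont_dir_deriv_tendsto fx[OF x] fst snd isCont_tendsto_compose[OF c(1) fst])
    then show "isCont (\<lambda>(x, v). dir_deriv (\<lambda>x. g (f x)) x v) (x, v)"
      unfolding isCont_cong[OF ev] .
  qed
qed (rule W(1))

lemma Ck_on_1_subset: "Ck_on 1 f U \<Longrightarrow> open W \<Longrightarrow> W \<subseteq> U \<Longrightarrow> Ck_on 1 f W"
  unfolding Ck_on_1_iff by auto

lemma Ck_on_1_locally:
  assumes "\<And>x. x \<in> U \<Longrightarrow> \<exists>N. x \<in> N \<and> N \<subseteq> U \<and> Ck_on 1 f N"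
  shows "Ck_on 1 f U"
proof -
  have "\<exists>T. open T \<and> x \<in> T \<and> T \<subseteq> U" if "x \<in> U" for x
    using assms[OF that] unfolding Ck_on_1_iff by blast
  then have "open U" by (subst open_subopen) blast
  then show ?thesis using assms unfolding Ck_on_1_iff by blast
qed

lemma Ck_on_1_linear:
  fixes f :: "'a::lcs \<Rightarrow> 'b::lcs"
  assumes "open U" "linear f" "\<And>x. isCont f x"
  shows "Ck_on 1 f U"
  unfolding Ck_on_1_iff
proof (intro conjI ballI)
  have d: "has_dir_deriv f x v (f v)" for x v
  proof -
    have "\<forall>\<^sub>F t in at 0. f v = (1 / t) *\<^sub>R (f (x + t *\<^sub>R v) - f x)"
      by (auto simp: linear_add[OF assms(2)] linear_cmul[OF assms(2)] eventually_at_filter)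
    then show ?thesis unfolding has_dir_deriv_def by (rule tendsto_eventually[OF eventually_mono]) simp
  qed
  have eq: "(\<lambda>(x, v). dir_deriv f x v) = (\<lambda>z. f (snd z))" using dir_deriv_eqI[OF d] by auto
  show "C1_at f x" for x
    unfolding C1_at_def eq using d assms(3) isCont_o2[OF isCont_snd[OF continuous_ident] assms(3)] by blast
qed (rule assms(1))

lemma Ck_on_1_const: "open U \<Longrightarrow> Ck_on 1 (\<lambda>_. c) (U :: 'a::lcs set)"
proof -
  assume U: "open U"
  have d: "has_dir_deriv (\<lambda>_. c) x v 0" for x v :: 'a by (simp add: has_dir_deriv_def)
  have eq: "(\<lambda>(x, v). dir_deriv (\<lambda>_::'a. c) x v) = (\<lambda>z. 0)" using dir_deriv_eqI[OF d] by auto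
  show ?thesis unfolding Ck_on_1_iff C1_at_def eq using d U by auto
qed

lemma has_dir_deriv_Pair:
  assumes "has_dir_deriv f x v y" "has_dir_deriv g x v z"
  shows "has_dir_deriv (\<lambda>x. (f x, g x)) x v (y, z)"
  using tendsto_Pair[OF assms[unfolded has_dir_deriv_def]]
  by (simp add: has_dir_deriv_def)

lemma Ck_on_1_Pair:
  fixes f :: "'a::lcs \<Rightarrow> 'b::lcs" and g :: "'a \<Rightarrow> 'c::lcs"
  assumes f: "Ck_on 1 f U" and g: "Ck_on 1 g U"
  shows "Ck_on 1 (\<lambda>x. (f x, g x)) U"
  unfolding Ck_on_1_iff
proof (intro conjI ballI)
  have c: "C1_at f x" "C1_at g x" if "x \<in> U" for x
    using f g that unfolding Ck_on_1_iff by auto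
  show U: "open U" using f unfolding Ck_on_1_iff by simp
  have d: "has_dir_deriv (\<lambda>x. (f x, g x)) x v (dir_deriv f x v, dir_deriv g x v)" if "x \<in> U" for x v
    using c[OF that] by (intro has_dir_deriv_Pair C1_at_has_dir_deriv)
  fix x assume x: "x \<in> U"
  show "C1_at (\<lambda>x. (f x, g x)) x"
    unfolding C1_at_def
  proof (intro conjI allI)
    show "isCont (\<lambda>x. (f x, g x)) x"
      using c[OF x] unfolding C1_at_def by (auto intro: isCont_Pair)
    fix v
    show "\<exists>y. has_dir_deriv (\<lambda>x. (f x, g x)) x v y" using d[OF x] by blast
    have "eventually (\<lambda>z. z \<in> U \<times> UNIV) (nhds (x, v))"
      using U x by (intro eventually_nhds_in_open open_Times) auto
    then have ev: "eventually (\<lambda>z. (\<lambda>(x, v). dir_deriv (\<lambda>x. (f x, g x)) x v) z =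
        ((\<lambda>(x, v). dir_deriv f x v) z, (\<lambda>(x, v). dir_deriv g x v) z)) (nhds (x, v))"
      by (rule eventually_mono) (auto intro!: dir_deriv_eqI d)
    show "isCont (\<lambda>(x, v). dir_deriv (\<lambda>x. (f x, g x)) x v) (x, v)"
      unfolding isCont_cong[OF ev]
      by (intro isCont_Pair) (use c[OF x] in \<open>simp_all add: C1_at_def\<close>)
  qed
qed

lemma has_curve_deriv_Pair:
  assumes "has_curve_deriv f S x y" "has_curve_deriv g S x z"
  shows "has_curve_deriv (\<lambda>x. (f x, g x)) S x (y, z)"
  using tendsto_Pair[OF assms[unfolded has_curve_deriv_def]]
  by (simp add: has_curve_deriv_def)

section \<open>Maps of class $C^1$ between manifolds\<close>

text \<open>The local representation of \<open>f\<close> in the charts \<open>c\<close> (source) and \<open>d\<close> (target).\<close>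

definition local_rep :: "('a, 'e) chart \<Rightarrow> ('b, 'f) chart \<Rightarrow> ('a \<Rightarrow> 'b) \<Rightarrow> 'e \<Rightarrow> 'f" where
  "local_rep c d f = snd d \<circ> f \<circ> inv_into (fst c) (snd c)"

text \<open>The only property of an atlas on which composition of maps rests is injectivity of its
  charts.\<close>

definition inj_charts :: "('a, 'e) chart set \<Rightarrow> bool" where
  "inj_charts A \<longleftrightarrow> (\<forall>c\<in>A. inj_on (snd c) (fst c))"

lemma local_rep_apply:
  "inj_charts A \<Longrightarrow> c \<in> A \<Longrightarrow> x \<in> fst c \<Longrightarrow> local_rep c d f (snd c x) = snd d (f x)"
  unfolding local_rep_def inj_charts_def by (simp add: inv_into_f_f)

lemma manifold_mono: "manifold k A \<Longrightarrow> j \<le> k \<Longrightarrow> manifold j A"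
  unfolding manifold_def split_beta by (blast intro: Ck_on_mono[of k _ _ j])

lemma Ck_map_mono: "Ck_map k A B f \<Longrightarrow> j \<le> k \<Longrightarrow> Ck_map j A B f"
  unfolding Ck_map_def split_beta by (blast intro: Ck_on_mono[of k _ _ j])

lemma manifold_inj_charts: "manifold k A \<Longrightarrow> inj_charts A"
  unfolding manifold_def inj_charts_def by auto

lemma manifold_open_chart: "manifold k A \<Longrightarrow> c \<in> A \<Longrightarrow> open (snd c ` fst c)"
  unfolding manifold_def by auto

lemma charts_atD: "c \<in> charts_at A x \<Longrightarrow> c \<in> A \<and> x \<in> fst c"
  unfolding charts_at_def by simp

lemma charts_at_nonempty: "x \<in> points A \<longleftrightarrow> (\<exists>c. c \<in> charts_at A x)"
  unfolding charts_at_def points_def by auto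

lemma points_iff: "x \<in> points A \<longleftrightarrow> (\<exists>c\<in>A. x \<in> fst c)"
  unfolding points_def by (auto simp: split_beta)

lemma C1_mapI:
  assumes "f ` points A \<subseteq> points B"
    and "\<And>c d. c \<in> A \<Longrightarrow> d \<in> B \<Longrightarrow> Ck_on 1 (local_rep c d f) (snd c ` (fst c \<inter> f -` fst d))"
  shows "Ck_map 1 A B f"
  using assms unfolding Ck_map_def local_rep_def by fastforce

lemma C1_map_local_rep:
  assumes "Ck_map 1 A B f" "c \<in> A" "d \<in> B"
  shows "Ck_on 1 (local_rep c d f) (snd c ` (fst c \<inter> f -` fst d))"
  using assms unfolding Ck_map_def local_rep_def by fastforce

lemma C1_map_points: "Ck_map k A B f \<Longrightarrow> x \<in> points A \<Longrightarrow> f x \<in> points B"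
  unfolding Ck_map_def by auto

lemma Ck_on_1_open_vimage:
  assumes "Ck_on 1 f U" "open V"
  shows "open (U \<inter> f -` V)"
proof -
  have "open U" "continuous_on U f"
    using assms(1) unfolding Ck_on_1_iff C1_at_def by (auto intro: continuous_at_imp_continuous_on)
  then show ?thesis using assms(2) continuous_open_preimage by blast
qed

lemma C1_map_compose:
  assumes f: "Ck_map 1 A B f" and g: "Ck_map 1 B C g" and inj: "inj_charts A" "inj_charts B"
  shows "Ck_map 1 A C (\<lambda>x. g (f x))"
proof (rule C1_mapI)
  show "(\<lambda>x. g (f x)) ` points A \<subseteq> points C"
    using C1_map_points[OF f] C1_map_points[OF g] by blast
  fix c e assume c: "c \<in> A" and e: "e \<in> C"
  show "Ck_on 1 (local_rep c e (\<lambda>x. g (f x))) (snd c ` (fst c \<inter> (\<lambda>x. g (f x)) -` fst e))"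
  proof (rule Ck_on_1_locally)
    fix y assume "y \<in> snd c ` (fst c \<inter> (\<lambda>x. g (f x)) -` fst e)"
    then obtain x where x: "x \<in> fst c" "g (f x) \<in> fst e" "y = snd c x" by auto
    have "f x \<in> points B" using C1_map_points[OF f] c x(1) unfolding points_iff by blast
    then obtain d where d: "d \<in> B" "f x \<in> fst d" unfolding points_iff by blast
    let ?U = "snd c ` (fst c \<inter> f -` fst d)" and ?V = "snd d ` (fst d \<inter> g -` fst e)"
    let ?N = "?U \<inter> local_rep c d f -` ?V"
    have rf: "Ck_on 1 (local_rep c d f) ?U" and rg: "Ck_on 1 (local_rep d e g) ?V"
      using C1_map_local_rep[OF f c d(1)] C1_map_local_rep[OF g d(1) e] .
    have "open ?N" using Ck_on_1_open_vimage[OF rf] rg unfolding Ck_on_1_iff by blast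
    then have "Ck_on 1 (\<lambda>y. local_rep d e g (local_rep c d f y)) ?N"
      by (rule Ck_on_1_compose[OF rf rg]) auto
    then have "Ck_on 1 (local_rep c e (\<lambda>x. g (f x))) ?N"
    proof (rule Ck_on_1_cong)
      fix y assume "y \<in> ?N"
      then obtain z where z: "z \<in> fst c" "f z \<in> fst d" "y = snd c z" by auto
      then show "local_rep c e (\<lambda>x. g (f x)) y = local_rep d e g (local_rep c d f y)"
        by (simp add: local_rep_apply[OF inj(1) c] local_rep_apply[OF inj(2) d(1)])
    qed
    moreover have "y \<in> ?N"
      using x d(2) by (auto simp: local_rep_apply[OF inj(1) c])
    moreover have "?N \<subseteq> snd c ` (fst c \<inter> (\<lambda>x. g (f x)) -` fst e)"
    proof
      fix y assume y: "y \<in> ?N"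
      then obtain z where z: "z \<in> fst c" "f z \<in> fst d" "y = snd c z" by auto
      with y obtain w where w: "w \<in> fst d" "g w \<in> fst e" "snd d (f z) = snd d w"
        by (auto simp: local_rep_apply[OF inj(1) c])
      then have "f z = w" using inj(2) d(1) z(2) unfolding inj_charts_def by (metis inj_onD)
      then show "y \<in> snd c ` (fst c \<inter> (\<lambda>x. g (f x)) -` fst e)" using z w by auto
    qed
    ultimately show "\<exists>N. y \<in> N \<and> N \<subseteq> snd c ` (fst c \<inter> (\<lambda>x. g (f x)) -` fst e) \<and>
        Ck_on 1 (local_rep c e (\<lambda>x. g (f x))) N" by (intro exI[of _ ?N] conjI)
  qed
qed

lemma C1_map_id:
  assumes "manifold 1 A"
  shows "Ck_map 1 A A (\<lambda>x. x)"
proof (rule C1_mapI)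
  fix c d assume "c \<in> A" "d \<in> A"
  then have "Ck_on 1 (snd d \<circ> inv_into (fst c) (snd c)) (snd c ` (fst c \<inter> fst d))"
    using assms unfolding manifold_def by (cases c; cases d) fastforce
  then show "Ck_on 1 (local_rep c d (\<lambda>x. x)) (snd c ` (fst c \<inter> (\<lambda>x. x) -` fst d))"
    by (simp add: local_rep_def comp_def)
qed auto

lemma C1_map_const:
  assumes "manifold 1 A" "y \<in> points B"
  shows "Ck_map 1 A B (\<lambda>_. y)"
proof (rule C1_mapI)
  fix c d assume "c \<in> A" "d \<in> B"
  show "Ck_on 1 (local_rep c d (\<lambda>_. y)) (snd c ` (fst c \<inter> (\<lambda>_. y) -` fst d))"
  proof (cases "y \<in> fst d")
    case True
    then have "fst c \<inter> (\<lambda>_. y) -` fst d = fst c" by auto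
    then show ?thesis
      using Ck_on_1_const[OF manifold_open_chart[OF assms(1) \<open>c \<in> A\<close>]]
      by (simp add: local_rep_def comp_def)
  next
    case False
    then have "fst c \<inter> (\<lambda>_. y) -` fst d = {}" by auto
    then show ?thesis by (simp add: Ck_on_1_iff)
  qed
qed (use assms in auto)

lemma C1_map_cong:
  assumes f: "Ck_map 1 A B f" and eq: "\<And>x. x \<in> points A \<Longrightarrow> f' x = f x" and inj: "inj_charts A"
  shows "Ck_map 1 A B f'"
proof (rule C1_mapI)
  show "f' ` points A \<subseteq> points B" using f eq unfolding Ck_map_def by auto
  fix c d assume c: "c \<in> A" and d: "d \<in> B"
  have eqc: "f' x = f x" if "x \<in> fst c" for x using eq c that unfolding points_iff by blast
  then have "fst c \<inter> f' -` fst d = fst c \<inter> f -` fst d" by auto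
  moreover have "local_rep c d f' y = local_rep c d f y" if "y \<in> snd c ` (fst c \<inter> f -` fst d)" for y
    using that eqc by (auto simp: local_rep_apply[OF inj c])
  ultimately show "Ck_on 1 (local_rep c d f') (snd c ` (fst c \<inter> f' -` fst d))"
    using Ck_on_1_cong[OF C1_map_local_rep[OF f c d]] by metis
qed

section \<open>Products\<close>

text \<open>The chart of a product that belongs to two charts of the factors.\<close>

definition chart_times :: "('a, 'e) chart \<Rightarrow> ('b, 'f) chart \<Rightarrow> ('a \<times> 'b, 'e \<times> 'f) chart" where
  "chart_times c d = (fst c \<times> fst d, map_prod (snd c) (snd d))"

lemma fst_chart_times [simp]: "fst (chart_times c d) = fst c \<times> fst d"
  and snd_chart_times [simp]: "snd (chart_times c d) = map_prod (snd c) (snd d)"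
  by (simp_all add: chart_times_def)

lemma product_atlas_iff: "q \<in> product_atlas A B \<longleftrightarrow> (\<exists>c\<in>A. \<exists>d\<in>B. q = chart_times c d)"
  unfolding product_atlas_def chart_times_def Bex_def split_paired_Ex mem_Collect_eq
  by (auto simp del: split_paired_Ex)

lemma points_product_atlas: "points (product_atlas A B) = points A \<times> points B"
proof -
  have "z \<in> points (product_atlas A B) \<longleftrightarrow> z \<in> points A \<times> points B" for z
    unfolding points_iff Bex_def product_atlas_iff mem_Times_iff
    by (metis fst_chart_times mem_Times_iff)
  then show ?thesis by blast
qed

lemma inj_charts_product: "inj_charts A \<Longrightarrow> inj_charts B \<Longrightarrow> inj_charts (product_atlas A B)"
  unfolding inj_charts_def Ball_def product_atlas_iff
  by (metis fst_chart_times map_prod_inj_on snd_chart_times)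

lemma C1_map_Pair:
  assumes f: "Ck_map 1 C A f" and g: "Ck_map 1 C B g" and inj: "inj_charts C"
  shows "Ck_map 1 C (product_atlas A B) (\<lambda>x. (f x, g x))"
proof (rule C1_mapI)
  show "(\<lambda>x. (f x, g x)) ` points C \<subseteq> points (product_atlas A B)"
    using f g unfolding Ck_map_def points_product_atlas by auto
  fix c q assume c: "c \<in> C" and "q \<in> product_atlas A B"
  then obtain d e where d: "d \<in> A" and e: "e \<in> B" and q: "q = chart_times d e"
    unfolding product_atlas_iff by auto
  have "fst c \<inter> (\<lambda>x. (f x, g x)) -` fst q = (fst c \<inter> f -` fst d) \<inter> (fst c \<inter> g -` fst e)"
    unfolding q by auto
  moreover have "snd c ` ((fst c \<inter> f -` fst d) \<inter> (fst c \<inter> g -` fst e)) =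
      snd c ` (fst c \<inter> f -` fst d) \<inter> snd c ` (fst c \<inter> g -` fst e)" (is "_ = ?U \<inter> ?V")
    using inj c unfolding inj_charts_def by (intro inj_on_image_Int[of _ "fst c"]) auto
  ultimately have eq: "snd c ` (fst c \<inter> (\<lambda>x. (f x, g x)) -` fst q) = ?U \<inter> ?V" by simp
  have *: "Ck_on 1 (local_rep c d f) ?U" "Ck_on 1 (local_rep c e g) ?V"
    using C1_map_local_rep[OF f c d] C1_map_local_rep[OF g c e] .
  then have "open (?U \<inter> ?V)" unfolding Ck_on_1_iff by auto
  then have "Ck_on 1 (\<lambda>y. (local_rep c d f y, local_rep c e g y)) (?U \<inter> ?V)"
    by (intro Ck_on_1_Pair Ck_on_1_subset[OF *(1)] Ck_on_1_subset[OF *(2)]) auto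
  moreover have "local_rep c q (\<lambda>x. (f x, g x)) = (\<lambda>y. (local_rep c d f y, local_rep c e g y))"
    unfolding local_rep_def q by auto
  ultimately show "Ck_on 1 (local_rep c q (\<lambda>x. (f x, g x))) (snd c ` (fst c \<inter> (\<lambda>x. (f x, g x)) -` fst q))"
    unfolding eq by simp
qed

text \<open>A map that is continuous and linear in suitable charts, such as a projection of a product, is
  of class $C^1$.\<close>

lemma C1_map_if_linear:
  assumes inj: "inj_charts P" and op: "\<And>q. q \<in> P \<Longrightarrow> open (snd q ` fst q)" and D: "manifold 1 D"
    and lin: "\<And>q. q \<in> P \<Longrightarrow> \<exists>c\<in>D. \<exists>l. linear l \<and> (\<forall>y. isCont l y) \<and>
      (\<forall>x\<in>fst q. f x \<in> fst c \<and> snd c (f x) = l (snd q x))"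
  shows "Ck_map 1 P D f"
proof (rule C1_mapI)
  show "f ` points P \<subseteq> points D" unfolding points_iff image_subset_iff by (meson lin points_iff)
  fix q e assume q: "q \<in> P" and e: "e \<in> D"
  obtain c l where c: "c \<in> D" and l: "linear l" "\<And>y. isCont l y"
    and f: "\<And>x. x \<in> fst q \<Longrightarrow> f x \<in> fst c" "\<And>x. x \<in> fst q \<Longrightarrow> snd c (f x) = l (snd q x)"
    using lin[OF q] by blast
  let ?U = "snd q ` fst q" and ?V = "snd c ` (fst c \<inter> fst e)"
  have injc: "inj_on (snd c) (fst c)" using manifold_inj_charts[OF D] c unfolding inj_charts_def by blast
  have rep: "Ck_on 1 (local_rep c e (\<lambda>x. x)) ?V"
    using C1_map_local_rep[OF C1_map_id[OF D] c e] by simp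
  then have "open ?V" unfolding Ck_on_1_iff by blast
  then have o: "open (?U \<inter> l -` ?V)"
    by (rule Ck_on_1_open_vimage[OF Ck_on_1_linear[OF op[OF q] l]])
  have "f x \<in> fst e \<longleftrightarrow> l (snd q x) \<in> ?V" if "x \<in> fst q" for x
    using inj_on_image_mem_iff[OF injc f(1)[OF that], of "fst c \<inter> fst e"] f[OF that] by auto
  then have eq: "snd q ` (fst q \<inter> f -` fst e) = ?U \<inter> l -` ?V" by blast
  have "Ck_on 1 (\<lambda>y. local_rep c e (\<lambda>x. x) (l y)) (?U \<inter> l -` ?V)"
    by (rule Ck_on_1_compose[OF Ck_on_1_linear[OF o l] rep o]) auto
  then show "Ck_on 1 (local_rep q e f) (snd q ` (fst q \<inter> f -` fst e))"
    unfolding eq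
  proof (rule Ck_on_1_cong)
    fix y assume "y \<in> ?U \<inter> l -` ?V"
    then obtain x where x: "x \<in> fst q" "y = snd q x" by blast
    show "local_rep q e f y = local_rep c e (\<lambda>x. x) (l y)"
      unfolding x(2) f(2)[OF x(1), symmetric]
      by (simp add: local_rep_apply[OF inj q x(1)] local_rep_apply[OF manifold_inj_charts[OF D] c f(1)[OF x(1)]])
  qed
qed

lemma
  assumes A: "manifold 1 A" and B: "manifold 1 B"
  shows C1_map_fst: "Ck_map 1 (product_atlas A B) A fst"
    and C1_map_snd: "Ck_map 1 (product_atlas A B) B snd"
proof -
  have inj: "inj_charts (product_atlas A B)"
    using A B by (intro inj_charts_product manifold_inj_charts)
  have op: "open (snd q ` fst q)" if q: "q \<in> product_atlas A B" for q
  proof -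
    obtain c d where "c \<in> A" "d \<in> B" and q: "q = chart_times c d"
      using q unfolding product_atlas_iff by blast
    then have "open ((snd c ` fst c) \<times> (snd d ` fst d))"
      using A B by (intro open_Times manifold_open_chart)
    then show ?thesis unfolding q by (simp add: map_prod_surj_on[OF refl refl])
  qed
  show "Ck_map 1 (product_atlas A B) A fst"
  proof (rule C1_map_if_linear[OF inj op A])
    fix q assume "q \<in> product_atlas A B"
    then obtain c d where "c \<in> A" "q = chart_times c d" unfolding product_atlas_iff by blast
    then show "\<exists>c\<in>A. \<exists>l. linear l \<and> (\<forall>y. isCont l y) \<and> (\<forall>x\<in>fst q. fst x \<in> fst c \<and> snd c (fst x) = l (snd q x))"
      by (intro bexI[of _ c] exI[of _ fst]) (auto intro: linear_fst)
  qed
  show "Ck_map 1 (product_atlas A B) B snd"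
  proof (rule C1_map_if_linear[OF inj op B])
    fix q assume "q \<in> product_atlas A B"
    then obtain c d where "d \<in> B" "q = chart_times c d" unfolding product_atlas_iff by blast
    then show "\<exists>c\<in>B. \<exists>l. linear l \<and> (\<forall>y. isCont l y) \<and> (\<forall>x\<in>fst q. snd x \<in> fst c \<and> snd c (snd x) = l (snd q x))"
      by (intro bexI[of _ d] exI[of _ snd]) (auto intro: linear_snd)
  qed
qed

lemma C1_map_slice1:
  assumes "Ck_map 1 (product_atlas A B) C m" "manifold 1 A" "manifold 1 B" "y \<in> points B"
  shows "Ck_map 1 A C (\<lambda>x. m (x, y))"
  using assms
  by (intro C1_map_compose[OF C1_map_Pair[OF C1_map_id C1_map_const]] inj_charts_product
      manifold_inj_charts)

lemma C1_map_slice2: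
  assumes "Ck_map 1 (product_atlas A B) C m" "manifold 1 A" "manifold 1 B" "x \<in> points A"
  shows "Ck_map 1 B C (\<lambda>y. m (x, y))"
  using assms
  by (intro C1_map_compose[OF C1_map_Pair[OF C1_map_const C1_map_id]] inj_charts_product
      manifold_inj_charts)

section \<open>Tangent spaces and differentials\<close>

lemma tangent_space_iff:
  "\<xi> \<in> tangent_space A x \<longleftrightarrow> (\<forall>c. c \<notin> charts_at A x \<longrightarrow> \<xi> c = 0) \<and>
     (\<forall>c\<in>charts_at A x. \<forall>d\<in>charts_at A x. \<xi> d = dir_deriv (local_rep c d (\<lambda>x. x)) (snd c x) (\<xi> c))"
  unfolding tangent_space_def local_rep_def by (simp add: comp_def split_beta)

lemma local_rep_linear:
  assumes "Ck_map 1 A B f" "c \<in> charts_at A x" "d \<in> charts_at B (f x)"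
  shows "linear (dir_deriv (local_rep c d f) (snd c x))"
  using linear_dir_deriv[OF C1_map_local_rep[OF assms(1)]] assms(2,3)
  unfolding charts_at_def by auto

lemma dir_deriv_local_rep_compose:
  assumes f: "Ck_map 1 A B f" and g: "Ck_map 1 B C g" and inj: "inj_charts A" "inj_charts B"
    and c: "c \<in> charts_at A x" and d: "d \<in> charts_at B (f x)" and e: "e \<in> charts_at C (g (f x))"
  shows "dir_deriv (local_rep c e (\<lambda>x. g (f x))) (snd c x) v =
    dir_deriv (local_rep d e g) (snd d (f x)) (dir_deriv (local_rep c d f) (snd c x) v)"
proof -
  have mem: "c \<in> A" "x \<in> fst c" "d \<in> B" "f x \<in> fst d" "e \<in> C" "g (f x) \<in> fst e"
    using c d e by (auto dest: charts_atD)
  let ?U = "snd c ` (fst c \<inter> f -` fst d)"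
  have rf: "Ck_on 1 (local_rep c d f) ?U" and rg: "Ck_on 1 (local_rep d e g) (snd d ` (fst d \<inter> g -` fst e))"
    using C1_map_local_rep[OF f mem(1,3)] C1_map_local_rep[OF g mem(3,5)] .
  have xU: "snd c x \<in> ?U" using mem by auto
  have app: "local_rep c d f (snd c x) = snd d (f x)" using mem by (simp add: local_rep_apply[OF inj(1)])
  have "has_dir_deriv (\<lambda>y. local_rep d e g (local_rep c d f y)) (snd c x) v
     (dir_deriv (local_rep d e g) (local_rep c d f (snd c x)) (dir_deriv (local_rep c d f) (snd c x) v))"
    using rf xU mem app
    by (intro has_dir_deriv_compose[OF rg] C1_at_has_dir_deriv) (auto simp: Ck_on_1_iff)
  then have "has_dir_deriv (local_rep c e (\<lambda>x. g (f x))) (snd c x) v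
     (dir_deriv (local_rep d e g) (local_rep c d f (snd c x)) (dir_deriv (local_rep c d f) (snd c x) v))"
  proof (rule has_dir_deriv_cong[OF _ _ xU])
    show "open ?U" using rf unfolding Ck_on_1_iff by simp
    fix y assume "y \<in> ?U"
    then show "local_rep c e (\<lambda>x. g (f x)) y = local_rep d e g (local_rep c d f y)"
      by (auto simp: local_rep_apply[OF inj(1) mem(1)] local_rep_apply[OF inj(2) mem(3)])
  qed
  then show ?thesis unfolding app by (rule dir_deriv_eqI)
qed

text \<open>The chart chosen in the definition of the differential is immaterial.\<close>

lemma differential_apply:
  assumes A: "manifold 1 A" and f: "Ck_map 1 A B f" and \<xi>: "\<xi> \<in> tangent_space A x"
    and c: "c \<in> charts_at A x" and d: "d \<in> charts_at B (f x)"
  shows "differential A B f x \<xi> d = dir_deriv (local_rep c d f) (snd c x) (\<xi> c)"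
proof -
  define c' where "c' = (SOME c. c \<in> charts_at A x)"
  have c': "c' \<in> charts_at A x" unfolding c'_def using c by (rule someI)
  have inj: "inj_charts A" using A by (rule manifold_inj_charts)
  have "differential A B f x \<xi> d = dir_deriv (local_rep c' d f) (snd c' x) (\<xi> c')"
    using d unfolding differential_def local_rep_def Let_def c'_def by simp
  also have "\<xi> c' = dir_deriv (local_rep c c' (\<lambda>x. x)) (snd c x) (\<xi> c)"
    using \<xi> c c' unfolding tangent_space_iff by blast
  also have "dir_deriv (local_rep c' d f) (snd c' x) \<dots> = dir_deriv (local_rep c d f) (snd c x) (\<xi> c)"
    by (rule dir_deriv_local_rep_compose[OF C1_map_id[OF A] f inj inj c c' d, symmetric])
  finally show ?thesis .
qed

lemma differential_outside: "d \<notin> charts_at B (f x) \<Longrightarrow> differential A B f x \<xi> d = 0"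
  unfolding differential_def by simp

lemma differential_in_tangent_space:
  assumes A: "manifold 1 A" and B: "manifold 1 B" and f: "Ck_map 1 A B f"
    and \<xi>: "\<xi> \<in> tangent_space A x" and x: "x \<in> points A"
  shows "differential A B f x \<xi> \<in> tangent_space B (f x)"
proof -
  obtain c where c: "c \<in> charts_at A x" using x charts_at_nonempty by metis
  show ?thesis
    unfolding tangent_space_iff
  proof (intro conjI ballI allI impI)
    fix d e assume d: "d \<in> charts_at B (f x)" and e: "e \<in> charts_at B (f x)"
    show "differential A B f x \<xi> e =
        dir_deriv (local_rep d e (\<lambda>x. x)) (snd d (f x)) (differential A B f x \<xi> d)"
      unfolding differential_apply[OF A f \<xi> c d] differential_apply[OF A f \<xi> c e]
      by (rule dir_deriv_local_rep_compose[OF f C1_map_id[OF B] manifold_inj_charts[OF A]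
            manifold_inj_charts[OF B] c d e])
  qed (rule differential_outside)
qed

lemma differential_compose:
  assumes A: "manifold 1 A" and B: "manifold 1 B"
    and f: "Ck_map 1 A B f" and g: "Ck_map 1 B C g" and \<xi>: "\<xi> \<in> tangent_space A x" and x: "x \<in> points A"
  shows "differential A C (\<lambda>x. g (f x)) x \<xi> = differential B C g (f x) (differential A B f x \<xi>)"
proof
  fix e
  obtain c where c: "c \<in> charts_at A x" using x charts_at_nonempty by metis
  have "f x \<in> points B" using f x by (rule C1_map_points)
  then obtain d where d: "d \<in> charts_at B (f x)" using charts_at_nonempty by metis
  have inj: "inj_charts A" "inj_charts B" using A B manifold_inj_charts by auto
  show "differential A C (\<lambda>x. g (f x)) x \<xi> e = differential B C g (f x) (differential A B f x \<xi>) e"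
  proof (cases "e \<in> charts_at C (g (f x))")
    case True
    then show ?thesis
      using differential_apply[OF A C1_map_compose[OF f g inj] \<xi> c True]
        differential_apply[OF B g differential_in_tangent_space[OF A B f \<xi> x] d True]
        differential_apply[OF A f \<xi> c d] dir_deriv_local_rep_compose[OF f g inj c d True]
      by simp
  qed (simp add: differential_outside)
qed

lemma differential_cong:
  assumes A: "manifold 1 A" and eq: "\<And>x. x \<in> points A \<Longrightarrow> f' x = f x" and x: "x \<in> points A"
  shows "differential A B f' x \<xi> = differential A B f x \<xi>"
proof -
  define c where "c = (SOME c. c \<in> charts_at A x)"
  have c: "c \<in> A" "x \<in> fst c"
    unfolding c_def using someI_ex[OF x[unfolded charts_at_nonempty]] by (auto dest: charts_atD)
  have rep: "dir_deriv (local_rep c d f') (snd c x) v = dir_deriv (local_rep c d f) (snd c x) v" for d v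
  proof (rule dir_deriv_cong[of "snd c ` fst c"])
    show "open (snd c ` fst c)" using manifold_open_chart[OF A c(1)] .
    fix z assume "z \<in> snd c ` fst c"
    then obtain y where y: "y \<in> fst c" "z = snd c y" by auto
    then have "y \<in> points A" using c(1) unfolding points_iff by blast
    then show "local_rep c d f' z = local_rep c d f z"
      using y eq by (simp add: local_rep_apply[OF manifold_inj_charts[OF A] c(1)])
  qed (use c in auto)
  show ?thesis
    unfolding differential_def c_def[symmetric] Let_def local_rep_def[symmetric] eq[OF x]
    by (simp only: rep)
qed

lemma differential_id:
  assumes A: "manifold 1 A" and \<xi>: "\<xi> \<in> tangent_space A x" and x: "x \<in> points A"
  shows "differential A A (\<lambda>x. x) x \<xi> = \<xi>"
proof
  fix d
  obtain c where c: "c \<in> charts_at A x" using x charts_at_nonempty by metis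
  show "differential A A (\<lambda>x. x) x \<xi> d = \<xi> d"
  proof (cases "d \<in> charts_at A x")
    case True
    then show ?thesis
      using differential_apply[OF A C1_map_id[OF A] \<xi> c True] \<xi> c unfolding tangent_space_iff by metis
  next
    case False
    then show ?thesis using \<xi> differential_outside[of d A "\<lambda>x. x"] unfolding tangent_space_iff by metis
  qed
qed

lemma tangent_space_lincomb:
  assumes A: "manifold 1 A" and "\<xi> \<in> tangent_space A x" "\<eta> \<in> tangent_space A x"
  shows "(\<lambda>c. r *\<^sub>R \<xi> c + s *\<^sub>R \<eta> c) \<in> tangent_space A x"
proof -
  have lin: "linear (dir_deriv (local_rep c d (\<lambda>x. x)) (snd c x))"
    if "c \<in> charts_at A x" "d \<in> charts_at A x" for c d
    using local_rep_linear[OF C1_map_id[OF A] that] .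
  show ?thesis
    unfolding tangent_space_iff
  proof (intro conjI ballI allI impI)
    fix c assume "c \<notin> charts_at A x"
    then have "\<xi> c = 0" "\<eta> c = 0" using assms(2,3) unfolding tangent_space_iff by blast+
    then show "r *\<^sub>R \<xi> c + s *\<^sub>R \<eta> c = 0" by simp
  next
    fix c d assume cd: "c \<in> charts_at A x" "d \<in> charts_at A x"
    let ?D = "dir_deriv (local_rep c d (\<lambda>x. x)) (snd c x)"
    have "\<xi> d = ?D (\<xi> c)" "\<eta> d = ?D (\<eta> c)"
      using assms(2,3) cd unfolding tangent_space_iff by blast+
    then show "r *\<^sub>R \<xi> d + s *\<^sub>R \<eta> d = ?D (r *\<^sub>R \<xi> c + s *\<^sub>R \<eta> c)"
      by (simp only: linear_add[OF lin[OF cd]] linear_cmul[OF lin[OF cd]])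
  qed
qed

lemma differential_lincomb:
  assumes A: "manifold 1 A" and f: "Ck_map 1 A B f" and x: "x \<in> points A"
    and \<xi>: "\<xi> \<in> tangent_space A x" and \<eta>: "\<eta> \<in> tangent_space A x"
  shows "differential A B f x (\<lambda>c. r *\<^sub>R \<xi> c + s *\<^sub>R \<eta> c) =
    (\<lambda>d. r *\<^sub>R differential A B f x \<xi> d + s *\<^sub>R differential A B f x \<eta> d)"
proof
  fix d
  obtain c where c: "c \<in> charts_at A x" using x charts_at_nonempty by metis
  show "differential A B f x (\<lambda>c. r *\<^sub>R \<xi> c + s *\<^sub>R \<eta> c) d =
    r *\<^sub>R differential A B f x \<xi> d + s *\<^sub>R differential A B f x \<eta> d"
  proof (cases "d \<in> charts_at B (f x)")
    case True
    have "linear (dir_deriv (local_rep c d f) (snd c x))" using local_rep_linear[OF f c True] .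
    then show ?thesis
      unfolding differential_apply[OF A f tangent_space_lincomb[OF A \<xi> \<eta>] c True]
        differential_apply[OF A f \<xi> c True] differential_apply[OF A f \<eta> c True]
      by (simp only: linear_add linear_cmul)
  qed (simp add: differential_outside)
qed

lemma zero_in_tangent_space:
  assumes A: "manifold 1 A"
  shows "(\<lambda>_. 0) \<in> tangent_space A x"
  unfolding tangent_space_iff
  using linear_0[OF local_rep_linear[OF C1_map_id[OF A]]] by auto

lemma differential_zero:
  assumes A: "manifold 1 A" and f: "Ck_map 1 A B f" and x: "x \<in> points A"
  shows "differential A B f x (\<lambda>_. 0) = (\<lambda>_. 0)"
  using differential_lincomb[OF A f x zero_in_tangent_space[OF A] zero_in_tangent_space[OF A], of 0 0] by simp

lemma tangent_space_diff:
  "manifold 1 A \<Longrightarrow> \<xi> \<in> tangent_space A x \<Longrightarrow> \<eta> \<in> tangent_space A x \<Longrightarrow>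
    (\<lambda>c. \<xi> c - \<eta> c) \<in> tangent_space A x"
  using tangent_space_lincomb[of A \<xi> x \<eta> 1 "- 1"] by simp

lemma differential_diff:
  assumes "manifold 1 A" "Ck_map 1 A B f" "x \<in> points A" "\<xi> \<in> tangent_space A x" "\<eta> \<in> tangent_space A x"
  shows "differential A B f x (\<lambda>c. \<xi> c - \<eta> c) =
    (\<lambda>d. differential A B f x \<xi> d - differential A B f x \<eta> d)"
  using differential_lincomb[OF assms, of 1 "- 1"] by simp

lemma differential_scale:
  assumes "manifold 1 A" "Ck_map 1 A B f" "x \<in> points A" "\<xi> \<in> tangent_space A x"
  shows "differential A B f x (\<lambda>c. r *\<^sub>R \<xi> c) = (\<lambda>d. r *\<^sub>R differential A B f x \<xi> d)"
  using differential_lincomb[OF assms assms(4), of r 0] by simp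

lemma tangent_space_scale:
  "manifold 1 A \<Longrightarrow> \<xi> \<in> tangent_space A x \<Longrightarrow> (\<lambda>c. r *\<^sub>R \<xi> c) \<in> tangent_space A x"
  using tangent_space_lincomb[of A \<xi> x \<xi> r 0] by simp

section \<open>Paths of class $C^1$\<close>

lemma at_within_Icc_neq_bot:
  fixes a b t :: real
  assumes "a < b" "t \<in> {a..b}"
  shows "at t within {a..b} \<noteq> bot"
  using assms islimpt_Icc[of a b t] by (simp add: trivial_limit_within)

lemma has_curve_deriv_imp_tendsto:
  assumes "has_curve_deriv c S t y"
  shows "(c \<longlongrightarrow> c t) (at t within S)"
proof -
  have "((\<lambda>s. s - t) \<longlongrightarrow> 0) (at t within S)" by (auto intro!: tendsto_eq_intros)
  from tendsto_add[OF tendsto_const tendsto_scaleR_lcs[OF this assms[unfolded has_curve_deriv_def]]]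
  have "((\<lambda>s. c t + (s - t) *\<^sub>R ((1 / (s - t)) *\<^sub>R (c s - c t))) \<longlongrightarrow> c t) (at t within S)"
    by simp
  then show ?thesis
    by (rule Lim_transform_eventually) (auto simp: eventually_at_filter)
qed

lemma has_curve_deriv_subset:
  "has_curve_deriv c S t y \<Longrightarrow> S' \<subseteq> S \<Longrightarrow> has_curve_deriv c S' t y"
  unfolding has_curve_deriv_def by (rule tendsto_within_subset)

lemma at_within_cong_open:
  fixes t :: "'a::topological_space"
  assumes "open T" "t \<in> T" "S \<inter> T = S' \<inter> T"
  shows "at t within S = at t within S'"
  by (rule at_within_nhd[OF assms(2,1)]) (use assms(3) in auto)

text \<open>Near the parameter \<open>t\<close>, the path \<open>\<alpha>\<close> runs in the chart \<open>c\<close> and has there the continuous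
  derivative \<open>D\<close>.\<close>

definition C1_near :: "real set \<Rightarrow> (real \<Rightarrow> 'a) \<Rightarrow> ('a, 'e::lcs) chart \<Rightarrow> real \<Rightarrow> (real \<Rightarrow> 'e) \<Rightarrow> bool" where
  "C1_near S \<alpha> c t D \<longleftrightarrow> (\<exists>T. open T \<and> t \<in> T \<and>
     (\<forall>r\<in>S \<inter> T. \<alpha> r \<in> fst c \<and> has_curve_deriv (\<lambda>r. snd c (\<alpha> r)) S r (D r)) \<and>
     continuous_on (S \<inter> T) D)"

abbreviation chart_velocity :: "('a, 'e::lcs) chart \<Rightarrow> real set \<Rightarrow> (real \<Rightarrow> 'a) \<Rightarrow> real \<Rightarrow> 'e" where
  "chart_velocity c S \<alpha> \<equiv> curve_deriv (\<lambda>r. snd c (\<alpha> r)) S"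

lemma C1_nearE:
  assumes "C1_near S \<alpha> c t D"
  obtains T where "open T" "t \<in> T" "\<And>r. r \<in> S \<Longrightarrow> r \<in> T \<Longrightarrow> \<alpha> r \<in> fst c"
    "\<And>r. r \<in> S \<Longrightarrow> r \<in> T \<Longrightarrow> has_curve_deriv (\<lambda>r. snd c (\<alpha> r)) S r (D r)"
    "continuous_on (S \<inter> T) D" "continuous_on (S \<inter> T) (\<lambda>r. snd c (\<alpha> r))"
proof -
  obtain T where T: "open T" "t \<in> T" "continuous_on (S \<inter> T) D"
    "\<And>r. r \<in> S \<inter> T \<Longrightarrow> \<alpha> r \<in> fst c \<and> has_curve_deriv (\<lambda>r. snd c (\<alpha> r)) S r (D r)"
    using assms unfolding C1_near_def by metis
  have "continuous_on (S \<inter> T) (\<lambda>r. snd c (\<alpha> r))"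
    unfolding continuous_on_def
  proof
    fix r assume "r \<in> S \<inter> T"
    then have "has_curve_deriv (\<lambda>r. snd c (\<alpha> r)) (S \<inter> T) r (D r)"
      using T(4) has_curve_deriv_subset by blast
    then show "((\<lambda>r. snd c (\<alpha> r)) \<longlongrightarrow> snd c (\<alpha> r)) (at r within S \<inter> T)"
      by (rule has_curve_deriv_imp_tendsto)
  qed
  then show thesis using that T by blast
qed

lemma C1_nearI:
  assumes "open T" "t \<in> T" "\<And>r. r \<in> S \<Longrightarrow> r \<in> T \<Longrightarrow> \<alpha> r \<in> fst c"
    "\<And>r. r \<in> S \<Longrightarrow> r \<in> T \<Longrightarrow> has_curve_deriv (\<lambda>r. snd c (\<alpha> r)) S r (D r)"
    "continuous_on (S \<inter> T) D"
  shows "C1_near S \<alpha> c t D"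
  unfolding C1_near_def using assms by (intro exI[of _ T]) auto

lemma C1_near_at:
  assumes "C1_near S \<alpha> c t D" "t \<in> S"
  shows "\<alpha> t \<in> fst c" "has_curve_deriv (\<lambda>r. snd c (\<alpha> r)) S t (D t)"
  using C1_nearE[OF assms(1)] assms(2) by metis+

lemma C1_near_subset:
  assumes "C1_near S \<alpha> c t D" "S' \<subseteq> S"
  shows "C1_near S' \<alpha> c t D"
proof -
  obtain T where T: "open T" "t \<in> T" "\<And>r. r \<in> S \<Longrightarrow> r \<in> T \<Longrightarrow> \<alpha> r \<in> fst c"
    "\<And>r. r \<in> S \<Longrightarrow> r \<in> T \<Longrightarrow> has_curve_deriv (\<lambda>r. snd c (\<alpha> r)) S r (D r)"
    "continuous_on (S \<inter> T) D"
    using assms(1) by (rule C1_nearE) (rule that)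
  show ?thesis
  proof (rule C1_nearI[OF T(1,2)])
    fix r assume "r \<in> S'" "r \<in> T"
    then show "\<alpha> r \<in> fst c" "has_curve_deriv (\<lambda>r. snd c (\<alpha> r)) S' r (D r)"
      using T(3) has_curve_deriv_subset[OF T(4) assms(2)] assms(2) by blast+
  next
    show "continuous_on (S' \<inter> T) D" by (rule continuous_on_subset[OF T(5)]) (use assms(2) in blast)
  qed
qed

lemma C1_near_map:
  assumes f: "Ck_map 1 A B f" and inj: "inj_charts A" and c: "c \<in> A" and d: "d \<in> B"
    and \<alpha>: "C1_near S \<alpha> c t D" and t: "t \<in> S" "f (\<alpha> t) \<in> fst d"
  shows "C1_near S (\<lambda>r. f (\<alpha> r)) d t (\<lambda>r. dir_deriv (local_rep c d f) (snd c (\<alpha> r)) (D r))"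
proof -
  obtain T where T: "open T" "t \<in> T" "\<And>r. r \<in> S \<Longrightarrow> r \<in> T \<Longrightarrow> \<alpha> r \<in> fst c"
    "\<And>r. r \<in> S \<Longrightarrow> r \<in> T \<Longrightarrow> has_curve_deriv (\<lambda>r. snd c (\<alpha> r)) S r (D r)"
    "continuous_on (S \<inter> T) D" "continuous_on (S \<inter> T) (\<lambda>r. snd c (\<alpha> r))"
    using \<alpha> by (rule C1_nearE) (rule that)
  let ?U = "snd c ` (fst c \<inter> f -` fst d)"
  have rep: "Ck_on 1 (local_rep c d f) ?U" using C1_map_local_rep[OF f c d] .
  then have U: "open ?U" "\<And>y. y \<in> ?U \<Longrightarrow> C1_at (local_rep c d f) y" unfolding Ck_on_1_iff by blast+
  obtain T0 where T0: "open T0" "S \<inter> T \<inter> (\<lambda>r. snd c (\<alpha> r)) -` ?U = (S \<inter> T) \<inter> T0"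
    using T(6) U(1) unfolding continuous_on_open_invariant by (metis Int_commute)
  have mem: "\<alpha> r \<in> fst c" "f (\<alpha> r) \<in> fst d" "snd c (\<alpha> r) \<in> ?U" if "r \<in> S" "r \<in> T \<inter> T0" for r
  proof -
    show 1: "\<alpha> r \<in> fst c" using T(3) that by blast
    show 2: "snd c (\<alpha> r) \<in> ?U" using T0(2) that by blast
    then obtain y where y: "y \<in> fst c" "f y \<in> fst d" "snd c (\<alpha> r) = snd c y" by auto
    then have "\<alpha> r = y" using inj c 1 unfolding inj_charts_def by (metis inj_onD)
    then show "f (\<alpha> r) \<in> fst d" using y by simp
  qed
  show ?thesis
  proof (rule C1_nearI[of "T \<inter> T0"])
    show "open (T \<inter> T0)" using T(1) T0(1) by auto
    have "snd c (\<alpha> t) \<in> ?U" using T(2,3) t by auto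
    then show "t \<in> T \<inter> T0" using T0(2) T(2) t(1) by blast
    fix r assume r: "r \<in> S" "r \<in> T \<inter> T0"
    show "f (\<alpha> r) \<in> fst d" using mem[OF r] by simp
    have "has_curve_deriv (\<lambda>s. local_rep c d f (snd c (\<alpha> s))) S r
        (dir_deriv (local_rep c d f) (snd c (\<alpha> r)) (D r))"
      using r by (intro has_curve_deriv_compose[OF rep] mem T(4)) auto
    then show "has_curve_deriv (\<lambda>r. snd d (f (\<alpha> r))) S r (dir_deriv (local_rep c d f) (snd c (\<alpha> r)) (D r))"
    proof (rule has_curve_deriv_cong_filter)
      have "eventually (\<lambda>s. s \<in> T \<inter> T0) (nhds r)"
        using \<open>open (T \<inter> T0)\<close> r(2) by (rule eventually_nhds_in_open)
      then have "eventually (\<lambda>s. s \<in> S \<longrightarrow> snd d (f (\<alpha> s)) = local_rep c d f (snd c (\<alpha> s))) (nhds r)"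
        by (rule eventually_mono) (simp add: mem local_rep_apply[OF inj c])
      then show "eventually (\<lambda>s. snd d (f (\<alpha> s)) = local_rep c d f (snd c (\<alpha> s))) (at r within S)"
        unfolding eventually_at_filter by (rule eventually_mono) blast
      show "snd d (f (\<alpha> r)) = local_rep c d f (snd c (\<alpha> r))"
        using mem[OF r] by (simp add: local_rep_apply[OF inj c])
    qed simp
  next
    show "continuous_on (S \<inter> (T \<inter> T0)) (\<lambda>r. dir_deriv (local_rep c d f) (snd c (\<alpha> r)) (D r))"
      unfolding continuous_on_def
    proof
      fix r assume r: "r \<in> S \<inter> (T \<inter> T0)"
      have le: "S \<inter> (T \<inter> T0) \<subseteq> S \<inter> T" by blast
      show "((\<lambda>r. dir_deriv (local_rep c d f) (snd c (\<alpha> r)) (D r)) \<longlongrightarrow>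
          dir_deriv (local_rep c d f) (snd c (\<alpha> r)) (D r)) (at r within S \<inter> (T \<inter> T0))"
      proof (rule isCont_dir_deriv_tendsto)
        show "C1_at (local_rep c d f) (snd c (\<alpha> r))" using r by (intro U(2) mem) auto
        show "((\<lambda>r. snd c (\<alpha> r)) \<longlongrightarrow> snd c (\<alpha> r)) (at r within S \<inter> (T \<inter> T0))"
          using continuous_on_subset[OF T(6) le] r unfolding continuous_on_def by blast
        show "(D \<longlongrightarrow> D r) (at r within S \<inter> (T \<inter> T0))"
          using continuous_on_subset[OF T(5) le] r unfolding continuous_on_def by blast
      qed
    qed
  qed
qed

lemma Ck_curve_1_iff:
  "Ck_curve 1 c S \<longleftrightarrow> continuous_on S c \<and> continuous_on S (curve_deriv c S) \<and>
     (\<forall>t\<in>S. \<exists>y. has_curve_deriv c S t y)"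
proof -
  have le1: "enat n \<le> 1 \<longleftrightarrow> n = 0 \<or> n = 1" and lt1: "enat n < 1 \<longleftrightarrow> n = 0" for n
    by (auto simp: one_enat_def)
  have all2: "(\<forall>n. n = 0 \<or> n = 1 \<longrightarrow> P n) \<longleftrightarrow> P 0 \<and> P 1" for P :: "nat \<Rightarrow> bool"
    by auto
  show ?thesis unfolding Ck_curve_def le1 lt1 all2 by (simp add: conj_assoc)
qed

lemma Ck_curve_const: "Ck_curve k (\<lambda>_. x) {0..1}"
proof -
  have step: "\<exists>y. \<forall>t\<in>{0..1}. has_curve_deriv f {0..1} t y" if "\<forall>t\<in>{0..1}. f t = y" for f :: "real \<Rightarrow> 'a" and y
  proof (intro exI ballI)
    fix t :: real assume t: "t \<in> {0..1}"
    have "((\<lambda>s. 0) \<longlongrightarrow> (0::'a)) (at t within {0..1})" by (rule tendsto_const)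
    then show "has_curve_deriv f {0..1} t 0"
      unfolding has_curve_deriv_def
      by (rule Lim_transform_eventually) (use that t in \<open>auto simp: eventually_at_filter\<close>)
  qed
  have const: "\<exists>y. \<forall>t\<in>{0..1}. ((\<lambda>f. curve_deriv f {0..1}) ^^ n) (\<lambda>_. x) t = y" for n
  proof (induction n)
    case (Suc n)
    let ?f = "((\<lambda>f. curve_deriv f {0..1}) ^^ n) (\<lambda>_. x)"
    obtain y where "\<forall>t\<in>{0..1}. has_curve_deriv ?f {0..1} t y" using Suc step by metis
    then have "\<forall>t\<in>{0..1}. curve_deriv ?f {0..1} t = y"
      using curve_deriv_eqI at_within_Icc_neq_bot[of 0 1] zero_less_one by blast
    then show ?case by auto
  qed simp
  show ?thesis
    unfolding Ck_curve_def
  proof (intro conjI allI impI ballI)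
    fix n :: nat
    let ?f = "((\<lambda>f. curve_deriv f {0..1}) ^^ n) (\<lambda>_. x)"
    obtain y where y: "\<forall>t\<in>{0..1}. ?f t = y" using const by blast
    have "continuous_on {0..1} (\<lambda>_::real. y)" by (rule continuous_on_const)
    then show "continuous_on {0..1} ?f" by (rule continuous_on_eq) (use y in simp)
    fix t :: real assume "t \<in> {0..1}"
    then show "\<exists>y. has_curve_deriv ?f {0..1} t y" using step[OF y] by blast
  qed
qed

lemma Ck_path_mono: "Ck_path k A a b \<alpha> \<Longrightarrow> j \<le> k \<Longrightarrow> Ck_path j A a b \<alpha>"
  unfolding Ck_path_def Ck_curve_def split_beta
  by (blast intro: order.trans order.strict_trans2)

lemma Ck_path_1_near:
  assumes \<alpha>: "Ck_path 1 A a b \<alpha>" and t: "t \<in> {a..b}" and c: "c \<in> charts_at A (\<alpha> t)"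
  shows "C1_near {a..b} \<alpha> c t (chart_velocity c {a..b} \<alpha>)"
proof -
  let ?S = "{a..b} \<inter> \<alpha> -` fst c"
  have cA: "c \<in> A" "\<alpha> t \<in> fst c" using c by (auto dest: charts_atD)
  have ab: "a < b" using \<alpha> unfolding Ck_path_def by simp
  have cur: "openin (top_of_set {a..b}) ?S" "Ck_curve 1 (snd c \<circ> \<alpha>) ?S"
    using \<alpha> cA(1) unfolding Ck_path_def split_beta by blast+
  then obtain T where T: "open T" "?S = {a..b} \<inter> T" unfolding openin_open by blast
  have at: "at r within ?S = at r within {a..b}" if "r \<in> ?S" for r
    by (rule at_within_cong_open[OF T(1)]) (use T(2) that in blast)+
  have hd: "has_curve_deriv (\<lambda>r. snd c (\<alpha> r)) {a..b} r y \<longleftrightarrow> has_curve_deriv (snd c \<circ> \<alpha>) ?S r y"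
    if "r \<in> ?S" for r y
    unfolding has_curve_deriv_def at[OF that] by simp
  have cd: "chart_velocity c {a..b} \<alpha> r = curve_deriv (snd c \<circ> \<alpha>) ?S r"
    if "r \<in> ?S" for r
    unfolding curve_deriv_def hd[OF that] ..
  show ?thesis
  proof (rule C1_nearI[of T])
    show "open T" by (rule T(1))
    show "t \<in> T" using T(2) t cA by blast
    fix r assume "r \<in> {a..b}" "r \<in> T"
    then have r: "r \<in> ?S" using T(2) by blast
    then show "\<alpha> r \<in> fst c" by simp
    obtain y where y: "has_curve_deriv (\<lambda>r. snd c (\<alpha> r)) {a..b} r y"
      using cur(2) r hd unfolding Ck_curve_1_iff by blast
    have "at r within {a..b} \<noteq> bot" using at_within_Icc_neq_bot[OF ab] r by simp
    from curve_deriv_eqI[OF y this] y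
    show "has_curve_deriv (\<lambda>r. snd c (\<alpha> r)) {a..b} r (chart_velocity c {a..b} \<alpha> r)"
      by simp
  next
    have "continuous_on ?S (curve_deriv (snd c \<circ> \<alpha>) ?S)" using cur(2) unfolding Ck_curve_1_iff by simp
    then have "continuous_on ?S (chart_velocity c {a..b} \<alpha>)"
      by (rule continuous_on_eq) (simp add: cd)
    then show "continuous_on ({a..b} \<inter> T) (chart_velocity c {a..b} \<alpha>)"
      unfolding T(2) .
  qed
qed

text \<open>It suffices to look at one chart around each point of the path.\<close>

lemma Ck_path_1I:
  assumes A: "manifold 1 A" and ab: "a < b"
    and near: "\<And>t. t \<in> {a..b} \<Longrightarrow> \<exists>c\<in>A. \<exists>D. C1_near {a..b} \<alpha> c t D"
  shows "Ck_path 1 A a b \<alpha>"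
  unfolding Ck_path_def split_beta
proof (intro conjI ballI)
  show "a < b" by (rule ab)
  show "\<alpha> ` {a..b} \<subseteq> points A"
  proof
    fix x assume "x \<in> \<alpha> ` {a..b}"
    then obtain t where t: "t \<in> {a..b}" "x = \<alpha> t" by blast
    then obtain c D where "c \<in> A" "C1_near {a..b} \<alpha> c t D" using near by blast
    then show "x \<in> points A" using C1_near_at(1)[OF _ t(1)] t(2) unfolding points_iff by blast
  qed
  fix d assume d: "d \<in> A"
  let ?S = "{a..b} \<inter> \<alpha> -` fst d"
  have ex: "\<exists>D. C1_near {a..b} \<alpha> d t D" if "t \<in> ?S" for t
  proof -
    obtain c D where "c \<in> A" "C1_near {a..b} \<alpha> c t D" using near \<open>t \<in> ?S\<close> by blast
    from C1_near_map[OF C1_map_id[OF A] manifold_inj_charts[OF A] this(1) d this(2)] that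
    show ?thesis by blast
  qed
  show op: "openin (top_of_set {a..b}) ?S"
  proof (subst openin_subopen, intro ballI)
    fix t assume t: "t \<in> ?S"
    obtain D where "C1_near {a..b} \<alpha> d t D" using ex[OF t] by blast
    then obtain T where "open T" "t \<in> T" "\<And>r. r \<in> {a..b} \<Longrightarrow> r \<in> T \<Longrightarrow> \<alpha> r \<in> fst d"
      by (rule C1_nearE) (rule that)
    then show "\<exists>T. openin (top_of_set {a..b}) T \<and> t \<in> T \<and> T \<subseteq> ?S"
      using t by (intro exI[of _ "{a..b} \<inter> T"]) auto
  qed
  then obtain T where T: "open T" "?S = {a..b} \<inter> T" unfolding openin_open by blast
  have at: "at r within ?S = at r within {a..b}" if "r \<in> ?S" for r
    by (rule at_within_cong_open[OF T(1)]) (use T(2) that in blast)+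
  show "Ck_curve 1 (snd d \<circ> \<alpha>) ?S"
    unfolding Ck_curve_1_iff
  proof (intro conjI ballI)
    have hd: "has_curve_deriv (snd d \<circ> \<alpha>) ?S r y"
      if "has_curve_deriv (\<lambda>r. snd d (\<alpha> r)) {a..b} r y" for r y
      using has_curve_deriv_subset[OF that, of ?S] by (simp add: comp_def)
    show diff: "\<exists>y. has_curve_deriv (snd d \<circ> \<alpha>) ?S t y" if t: "t \<in> ?S" for t
    proof -
      obtain D where D: "C1_near {a..b} \<alpha> d t D" using ex[OF t] by blast
      have "has_curve_deriv (\<lambda>r. snd d (\<alpha> r)) {a..b} t (D t)"
        by (rule C1_near_at(2)[OF D]) (use t in simp)
      from hd[OF this] show ?thesis by blast
    qed
    then show "continuous_on ?S (snd d \<circ> \<alpha>)"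
      unfolding continuous_on_def using has_curve_deriv_imp_tendsto by blast
    show "continuous_on ?S (curve_deriv (snd d \<circ> \<alpha>) ?S)"
      unfolding continuous_on_def
    proof
      fix t assume t: "t \<in> ?S"
      obtain D where "C1_near {a..b} \<alpha> d t D" using ex[OF t] by blast
      then obtain N where N: "open N" "t \<in> N"
        "\<And>r. r \<in> {a..b} \<Longrightarrow> r \<in> N \<Longrightarrow> has_curve_deriv (\<lambda>r. snd d (\<alpha> r)) {a..b} r (D r)"
        "continuous_on ({a..b} \<inter> N) D"
        by (rule C1_nearE) (rule that)
      have eq: "curve_deriv (snd d \<circ> \<alpha>) ?S r = D r" if "r \<in> ?S" "r \<in> N" for r
      proof (rule curve_deriv_eqI)
        show "has_curve_deriv (snd d \<circ> \<alpha>) ?S r (D r)" using N(3) that by (intro hd) auto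
        show "at r within ?S \<noteq> bot"
          using at_within_Icc_neq_bot[OF ab, of r] at[OF that(1)] that(1) by simp
      qed
      have "(D \<longlongrightarrow> D t) (at t within {a..b} \<inter> N)"
        using N(2,4) t unfolding continuous_on_def by blast
      also have "at t within {a..b} \<inter> N = at t within {a..b}"
        by (rule at_within_cong_open[of N]) (use N in auto)
      finally have "(D \<longlongrightarrow> D t) (at t within ?S)" unfolding at[OF t] .
      moreover have "eventually (\<lambda>r. r \<in> N) (nhds t)"
        using N(1,2) by (rule eventually_nhds_in_open)
      then have "eventually (\<lambda>r. D r = curve_deriv (snd d \<circ> \<alpha>) ?S r) (at t within ?S)"
        unfolding eventually_at_filter by (rule eventually_mono) (simp add: eq)
      ultimately have "(curve_deriv (snd d \<circ> \<alpha>) ?S \<longlongrightarrow> D t) (at t within ?S)"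
        by (rule Lim_transform_eventually)
      then show "(curve_deriv (snd d \<circ> \<alpha>) ?S \<longlongrightarrow> curve_deriv (snd d \<circ> \<alpha>) ?S t) (at t within ?S)"
        using eq[OF t N(2)] by simp
    qed
  qed
qed

lemma Ck_path_less: "Ck_path k A a b \<alpha> \<Longrightarrow> a < b"
  unfolding Ck_path_def by simp

lemma Ck_path_points: "Ck_path k A a b \<alpha> \<Longrightarrow> t \<in> {a..b} \<Longrightarrow> \<alpha> t \<in> points A"
  unfolding Ck_path_def by blast

lemma Ck_path_1_chart:
  assumes "Ck_path 1 A a b \<alpha>" "t \<in> {a..b}"
  obtains c where "c \<in> charts_at A (\<alpha> t)" "C1_near {a..b} \<alpha> c t (chart_velocity c {a..b} \<alpha>)"
  using Ck_path_points[OF assms] Ck_path_1_near[OF assms] charts_at_nonempty by metis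

lemma velocity_apply:
  "velocity A S \<alpha> t c = (if c \<in> charts_at A (\<alpha> t) then chart_velocity c S \<alpha> t else 0)"
  unfolding velocity_def by (simp add: comp_def)

lemma velocity_eqI:
  assumes "c \<in> charts_at A (\<alpha> t)" "C1_near {a..b} \<alpha> c t D" "a < b" "t \<in> {a..b}"
  shows "velocity A {a..b} \<alpha> t c = D t"
  using curve_deriv_eqI[OF C1_near_at(2)[OF assms(2,4)] at_within_Icc_neq_bot[OF assms(3,4)]] assms(1)
  by (simp add: velocity_apply)

lemma Ck_path_1_map:
  assumes f: "Ck_map 1 A B f" and A: "manifold 1 A" and B: "manifold 1 B" and \<alpha>: "Ck_path 1 A a b \<alpha>"
  shows "Ck_path 1 B a b (\<lambda>t. f (\<alpha> t))"
proof (rule Ck_path_1I[OF B])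
  show "a < b" using \<alpha> by (rule Ck_path_less)
  fix t assume t: "t \<in> {a..b}"
  obtain c where c: "c \<in> charts_at A (\<alpha> t)" "C1_near {a..b} \<alpha> c t (chart_velocity c {a..b} \<alpha>)"
    using Ck_path_1_chart[OF \<alpha> t] .
  have "f (\<alpha> t) \<in> points B" using C1_map_points[OF f Ck_path_points[OF \<alpha> t]] .
  then obtain d where d: "d \<in> B" "f (\<alpha> t) \<in> fst d" unfolding points_iff by blast
  show "\<exists>d\<in>B. \<exists>D. C1_near {a..b} (\<lambda>t. f (\<alpha> t)) d t D"
    using C1_near_map[OF f manifold_inj_charts[OF A] conjunct1[OF charts_atD[OF c(1)]] d(1) c(2) t d(2)] d(1)
    by blast
qed

lemma velocity_in_tangent_space:
  assumes A: "manifold 1 A" and \<alpha>: "Ck_path 1 A a b \<alpha>" and t: "t \<in> {a..b}"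
  shows "velocity A {a..b} \<alpha> t \<in> tangent_space A (\<alpha> t)"
  unfolding tangent_space_iff
proof (intro conjI ballI allI impI)
  fix c assume "c \<notin> charts_at A (\<alpha> t)"
  then show "velocity A {a..b} \<alpha> t c = 0" by (simp add: velocity_apply)
next
  fix c d assume c: "c \<in> charts_at A (\<alpha> t)" and d: "d \<in> charts_at A (\<alpha> t)"
  have mem: "c \<in> A" "d \<in> A" "\<alpha> t \<in> fst d" using charts_atD[OF c] charts_atD[OF d] by auto
  have "velocity A {a..b} \<alpha> t d =
      dir_deriv (local_rep c d (\<lambda>x. x)) (snd c (\<alpha> t)) (chart_velocity c {a..b} \<alpha> t)"
    by (rule velocity_eqI[OF d C1_near_map[OF C1_map_id[OF A] manifold_inj_charts[OF A]
          mem(1,2) Ck_path_1_near[OF \<alpha> t c] t mem(3)] Ck_path_less[OF \<alpha>] t])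
  then show "velocity A {a..b} \<alpha> t d =
      dir_deriv (local_rep c d (\<lambda>x. x)) (snd c (\<alpha> t)) (velocity A {a..b} \<alpha> t c)"
    using c by (simp add: velocity_apply)
qed

lemma velocity_map:
  assumes f: "Ck_map 1 A B f" and A: "manifold 1 A" and \<alpha>: "Ck_path 1 A a b \<alpha>" and t: "t \<in> {a..b}"
  shows "velocity B {a..b} (\<lambda>t. f (\<alpha> t)) t = differential A B f (\<alpha> t) (velocity A {a..b} \<alpha> t)"
proof
  fix d
  obtain c where c: "c \<in> charts_at A (\<alpha> t)" "C1_near {a..b} \<alpha> c t (chart_velocity c {a..b} \<alpha>)"
    using Ck_path_1_chart[OF \<alpha> t] .
  show "velocity B {a..b} (\<lambda>t. f (\<alpha> t)) t d = differential A B f (\<alpha> t) (velocity A {a..b} \<alpha> t) d"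
  proof (cases "d \<in> charts_at B (f (\<alpha> t))")
    case True
    have mem: "c \<in> A" "d \<in> B" "f (\<alpha> t) \<in> fst d" using charts_atD[OF c(1)] charts_atD[OF True] by auto
    have "velocity B {a..b} (\<lambda>t. f (\<alpha> t)) t d =
        dir_deriv (local_rep c d f) (snd c (\<alpha> t)) (chart_velocity c {a..b} \<alpha> t)"
      by (rule velocity_eqI[OF True C1_near_map[OF f manifold_inj_charts[OF A] mem(1,2) c(2) t mem(3)]
            Ck_path_less[OF \<alpha>] t])
    also have "\<dots> = differential A B f (\<alpha> t) (velocity A {a..b} \<alpha> t) d"
      unfolding differential_apply[OF A f velocity_in_tangent_space[OF A \<alpha> t] c(1) True]
      using c(1) by (simp add: velocity_apply)
    finally show ?thesis .
  next
    case False
    then show ?thesis by (simp add: velocity_apply differential_outside)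
  qed
qed

lemma has_curve_deriv_rescale:
  fixes s t :: real
  assumes "s < t" "has_curve_deriv c {0..1} ((r - s) / (t - s)) y" "r \<in> {s..t}"
  shows "has_curve_deriv (\<lambda>r. c ((r - s) / (t - s))) {s..t} r ((1 / (t - s)) *\<^sub>R y)"
proof -
  let ?\<theta> = "\<lambda>r. (r - s) / (t - s)"
  have "filterlim ?\<theta> (at (?\<theta> r) within {0..1}) (at r within {s..t})"
    unfolding filterlim_at
  proof
    have "eventually (\<lambda>x. x \<in> {s..t} \<and> x \<noteq> r) (at r within {s..t})"
      by (auto simp: eventually_at_filter)
    then show "eventually (\<lambda>x. ?\<theta> x \<in> {0..1} \<and> ?\<theta> x \<noteq> ?\<theta> r) (at r within {s..t})"
      by (rule eventually_mono) (use assms(1) in \<open>auto simp: divide_simps\<close>)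
    show "(?\<theta> \<longlongrightarrow> ?\<theta> r) (at r within {s..t})"
      using assms(1) by (auto intro!: tendsto_eq_intros)
  qed
  from tendsto_scaleR_lcs[OF tendsto_const filterlim_compose[OF assms(2)[unfolded has_curve_deriv_def] this]]
  have "((\<lambda>x. (1 / (t - s)) *\<^sub>R ((1 / (?\<theta> x - ?\<theta> r)) *\<^sub>R (c (?\<theta> x) - c (?\<theta> r)))) \<longlongrightarrow> (1 / (t - s)) *\<^sub>R y)
     (at r within {s..t})" .
  moreover have "(1 / (t - s)) * (1 / (?\<theta> x - ?\<theta> r)) = 1 / (x - r)" for x
    using assms(1) by (simp add: diff_divide_distrib[symmetric])
  ultimately show ?thesis
    unfolding has_curve_deriv_def by (simp add: mult.commute)
qed

lemma C1_near_rescale: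
  fixes s t :: real
  assumes st: "s < t" and r: "r \<in> {s..t}" and u: "C1_near {0..1} u c ((r - s) / (t - s)) D"
  shows "C1_near {s..t} (\<lambda>r. u ((r - s) / (t - s))) c r (\<lambda>r. (1 / (t - s)) *\<^sub>R D ((r - s) / (t - s)))"
proof -
  let ?\<theta> = "\<lambda>r. (r - s) / (t - s)"
  obtain T where T: "open T" "?\<theta> r \<in> T" "\<And>x. x \<in> {0..1} \<Longrightarrow> x \<in> T \<Longrightarrow> u x \<in> fst c"
    "\<And>x. x \<in> {0..1} \<Longrightarrow> x \<in> T \<Longrightarrow> has_curve_deriv (\<lambda>x. snd c (u x)) {0..1} x (D x)"
    "continuous_on ({0..1} \<inter> T) D"
    using u by (rule C1_nearE) (rule that)
  have cont: "continuous_on UNIV ?\<theta>" using st by (intro continuous_intros) auto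
  have \<theta>: "?\<theta> x \<in> {0..1}" if "x \<in> {s..t}" for x using that st by (simp add: divide_simps)
  show ?thesis
  proof (rule C1_nearI[of "?\<theta> -` T"])
    show "open (?\<theta> -` T)" using T(1) cont by (rule open_vimage)
    show "r \<in> ?\<theta> -` T" using T(2) by simp
    fix x assume x: "x \<in> {s..t}" "x \<in> ?\<theta> -` T"
    then show "u (?\<theta> x) \<in> fst c" using T(3) \<theta> by simp
    show "has_curve_deriv (\<lambda>r. snd c (u (?\<theta> r))) {s..t} x ((1 / (t - s)) *\<^sub>R D (?\<theta> x))"
      using has_curve_deriv_rescale[OF st T(4) x(1)] \<theta>[OF x(1)] x(2) by simp
  next
    have "continuous_on ({s..t} \<inter> ?\<theta> -` T) (\<lambda>x. D (?\<theta> x))"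
      by (rule continuous_on_compose2[OF T(5) continuous_on_subset[OF cont]]) (use \<theta> in auto)
    then show "continuous_on ({s..t} \<inter> ?\<theta> -` T) (\<lambda>x. (1 / (t - s)) *\<^sub>R D (?\<theta> x))"
      unfolding continuous_on_def by (intro ballI tendsto_scaleR_lcs tendsto_const) blast
  qed
qed

lemma rescale_mem:
  fixes s t :: real
  shows "s < t \<Longrightarrow> x \<in> {s..t} \<Longrightarrow> (x - s) / (t - s) \<in> {0..1}"
  by (simp add: divide_simps)

lemma Ck_path_1_rescale:
  assumes A: "manifold 1 A" and st: "s < t" and u: "Ck_path 1 A 0 1 u"
  shows "Ck_path 1 A s t (\<lambda>r. u ((r - s) / (t - s)))"
proof (rule Ck_path_1I[OF A st])
  fix r assume r: "r \<in> {s..t}"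
  obtain c where "c \<in> charts_at A (u ((r - s) / (t - s)))"
    "C1_near {0..1} u c ((r - s) / (t - s)) (chart_velocity c {0..1} u)"
    using Ck_path_1_chart[OF u rescale_mem[OF st r]] .
  from C1_near_rescale[OF st r this(2)] charts_atD[OF this(1)]
  show "\<exists>c\<in>A. \<exists>D. C1_near {s..t} (\<lambda>r. u ((r - s) / (t - s))) c r D" by blast
qed

lemma velocity_rescale:
  assumes st: "s < t" and u: "Ck_path 1 A 0 1 u" and r: "r \<in> {s..t}"
  shows "velocity A {s..t} (\<lambda>r. u ((r - s) / (t - s))) r =
    (\<lambda>c. (1 / (t - s)) *\<^sub>R velocity A {0..1} u ((r - s) / (t - s)) c)"
proof
  fix c
  let ?v = "\<lambda>c. velocity A {0..1} u ((r - s) / (t - s)) c"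
  show "velocity A {s..t} (\<lambda>r. u ((r - s) / (t - s))) r c = (1 / (t - s)) *\<^sub>R ?v c"
  proof (cases "c \<in> charts_at A (u ((r - s) / (t - s)))")
    case True
    from velocity_eqI[of c A "\<lambda>r. u ((r - s) / (t - s))", OF True
        C1_near_rescale[OF st r Ck_path_1_near[OF u rescale_mem[OF st r] True]] st r]
    show ?thesis using True by (simp add: velocity_apply)
  next
    case False
    then show ?thesis by (simp add: velocity_apply)
  qed
qed

lemma C1_near_Pair:
  assumes "C1_near S \<alpha> c t D" "C1_near S \<beta> d t E"
  shows "C1_near S (\<lambda>r. (\<alpha> r, \<beta> r)) (chart_times c d) t (\<lambda>r. (D r, E r))"
proof -
  obtain T where T: "open T" "t \<in> T" "\<And>r. r \<in> S \<Longrightarrow> r \<in> T \<Longrightarrow> \<alpha> r \<in> fst c"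
    "\<And>r. r \<in> S \<Longrightarrow> r \<in> T \<Longrightarrow> has_curve_deriv (\<lambda>r. snd c (\<alpha> r)) S r (D r)"
    "continuous_on (S \<inter> T) D"
    using assms(1) by (rule C1_nearE) (rule that)
  obtain T' where T': "open T'" "t \<in> T'" "\<And>r. r \<in> S \<Longrightarrow> r \<in> T' \<Longrightarrow> \<beta> r \<in> fst d"
    "\<And>r. r \<in> S \<Longrightarrow> r \<in> T' \<Longrightarrow> has_curve_deriv (\<lambda>r. snd d (\<beta> r)) S r (E r)"
    "continuous_on (S \<inter> T') E"
    using assms(2) by (rule C1_nearE) (rule that)
  show ?thesis
  proof (rule C1_nearI[of "T \<inter> T'"])
    show "open (T \<inter> T')" "t \<in> T \<inter> T'" using T T' by auto
    fix r assume r: "r \<in> S" "r \<in> T \<inter> T'"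
    then show "(\<alpha> r, \<beta> r) \<in> fst (chart_times c d)" using T(3) T'(3) by simp
    show "has_curve_deriv (\<lambda>r. snd (chart_times c d) (\<alpha> r, \<beta> r)) S r (D r, E r)"
      using has_curve_deriv_Pair[OF T(4) T'(4)] r by simp
  next
    show "continuous_on (S \<inter> (T \<inter> T')) (\<lambda>r. (D r, E r))"
      by (intro continuous_on_Pair continuous_on_subset[OF T(5)] continuous_on_subset[OF T'(5)]) auto
  qed
qed

text \<open>The derivative of a map on a product is the sum of its partial derivatives.\<close>

lemma local_rep_product_split:
  assumes m: "Ck_map 1 (product_atlas A B) C m" and A: "manifold 1 A" and B: "manifold 1 B"
    and c: "c \<in> charts_at A x" and d: "d \<in> charts_at B y" and e: "e \<in> charts_at C (m (x, y))"
  shows "dir_deriv (local_rep (chart_times c d) e m) (snd c x, snd d y) (v, w) =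
    dir_deriv (local_rep c e (\<lambda>x. m (x, y))) (snd c x) v +
    dir_deriv (local_rep d e (\<lambda>y. m (x, y))) (snd d y) w"
    (is "?D (v, w) = _")
    and "dir_deriv (local_rep (chart_times c d) e m) (snd c x, snd d y) (0, w) =
    dir_deriv (local_rep d e (\<lambda>y. m (x, y))) (snd d y) w"
proof -
  have mem: "c \<in> A" "x \<in> fst c" "d \<in> B" "y \<in> fst d" using charts_atD[OF c] charts_atD[OF d] by auto
  have inj: "inj_charts A" "inj_charts B" "inj_charts (product_atlas A B)"
    using A B manifold_inj_charts inj_charts_product by metis+
  have q: "chart_times c d \<in> product_atlas A B" using mem unfolding product_atlas_iff by blast
  have lin: "linear ?D"
    using local_rep_linear[OF m, of "chart_times c d" "(x, y)" e] q mem e by (simp add: charts_at_def)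
  have app: "local_rep (chart_times c d) e m (snd c x', snd d y') = snd e (m (x', y'))"
    if "x' \<in> fst c" "y' \<in> fst d" for x' y'
    using local_rep_apply[OF inj(3) q, of "(x', y')" e m] that by simp
  have 1: "?D (v, 0) = dir_deriv (local_rep c e (\<lambda>x. m (x, y))) (snd c x) v"
  proof -
    have "?D (v, 0) = dir_deriv (\<lambda>z. local_rep (chart_times c d) e m (z, snd d y)) (snd c x) v"
      unfolding dir_deriv_def has_dir_deriv_def by simp
    also have "\<dots> = dir_deriv (local_rep c e (\<lambda>x. m (x, y))) (snd c x) v"
      by (rule dir_deriv_cong[OF manifold_open_chart[OF A mem(1)]])
        (use mem in \<open>auto simp: app local_rep_apply[OF inj(1)]\<close>)
    finally show ?thesis .
  qed
  show 2: "?D (0, w) = dir_deriv (local_rep d e (\<lambda>y. m (x, y))) (snd d y) w"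
  proof -
    have "?D (0, w) = dir_deriv (\<lambda>z. local_rep (chart_times c d) e m (snd c x, z)) (snd d y) w"
      unfolding dir_deriv_def has_dir_deriv_def by simp
    also have "\<dots> = dir_deriv (local_rep d e (\<lambda>y. m (x, y))) (snd d y) w"
      by (rule dir_deriv_cong[OF manifold_open_chart[OF B mem(3)]])
        (use mem in \<open>auto simp: app local_rep_apply[OF inj(2)]\<close>)
    finally show ?thesis .
  qed
  have "?D (v, w) = ?D ((v, 0) + (0, w))" by simp
  also have "\<dots> = ?D (v, 0) + ?D (0, w)" using lin by (rule linear_add)
  finally show "?D (v, w) = dir_deriv (local_rep c e (\<lambda>x. m (x, y))) (snd c x) v +
    dir_deriv (local_rep d e (\<lambda>y. m (x, y))) (snd d y) w" unfolding 1 2 .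
qed

text \<open>The product rule: the velocity of \<open>m (\<alpha> t, \<beta> t)\<close> is the sum of the velocities obtained by
  freezing one of the two arguments.\<close>

lemma
  assumes m: "Ck_map 1 (product_atlas A B) C m"
    and A: "manifold 1 A" and B: "manifold 1 B" and C: "manifold 1 C"
    and \<alpha>: "Ck_path 1 A a b \<alpha>" and \<beta>: "Ck_path 1 B a b \<beta>"
  shows Ck_path_1_product: "Ck_path 1 C a b (\<lambda>t. m (\<alpha> t, \<beta> t))"
    and velocity_product: "t \<in> {a..b} \<Longrightarrow> velocity C {a..b} (\<lambda>t. m (\<alpha> t, \<beta> t)) t =
      (\<lambda>e. differential A C (\<lambda>x. m (x, \<beta> t)) (\<alpha> t) (velocity A {a..b} \<alpha> t) e +
           differential B C (\<lambda>y. m (\<alpha> t, y)) (\<beta> t) (velocity B {a..b} \<beta> t) e)"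
      (is "_ \<Longrightarrow> _ = ?V t")
proof -
  have ab: "a < b" using \<alpha> by (rule Ck_path_less)
  have inj: "inj_charts (product_atlas A B)"
    using A B manifold_inj_charts inj_charts_product by metis
  have near: "C1_near {a..b} (\<lambda>r. m (\<alpha> r, \<beta> r)) e t (\<lambda>r. dir_deriv (local_rep (chart_times c d) e m)
      (snd c (\<alpha> r), snd d (\<beta> r)) (chart_velocity c {a..b} \<alpha> r, chart_velocity d {a..b} \<beta> r))"
    if t: "t \<in> {a..b}" and c: "c \<in> charts_at A (\<alpha> t)" and d: "d \<in> charts_at B (\<beta> t)"
      and e: "e \<in> charts_at C (m (\<alpha> t, \<beta> t))" for c d e t
  proof -
    have mem: "e \<in> C" "m (\<alpha> t, \<beta> t) \<in> fst e" using charts_atD[OF e] by auto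
    have q: "chart_times c d \<in> product_atlas A B"
      using charts_atD[OF c] charts_atD[OF d] unfolding product_atlas_iff by blast
    from C1_near_map[OF m inj q mem(1) C1_near_Pair[OF Ck_path_1_near[OF \<alpha> t c] Ck_path_1_near[OF \<beta> t d]] t mem(2)]
    show ?thesis by simp
  qed
  have chA: "\<exists>c. c \<in> charts_at A (\<alpha> t)" if "t \<in> {a..b}" for t
    using Ck_path_points[OF \<alpha> that] charts_at_nonempty by metis
  have chB: "\<exists>c. c \<in> charts_at B (\<beta> t)" if "t \<in> {a..b}" for t
    using Ck_path_points[OF \<beta> that] charts_at_nonempty by metis
  have mC: "m (\<alpha> t, \<beta> t) \<in> points C" if "t \<in> {a..b}" for t
    using C1_map_points[OF m] Ck_path_points[OF \<alpha> that] Ck_path_points[OF \<beta> that]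
    by (simp add: points_product_atlas)
  show "Ck_path 1 C a b (\<lambda>t. m (\<alpha> t, \<beta> t))"
  proof (rule Ck_path_1I[OF C ab])
    fix t assume t: "t \<in> {a..b}"
    obtain e where e: "e \<in> charts_at C (m (\<alpha> t, \<beta> t))" using mC[OF t] charts_at_nonempty by metis
    obtain c d where c: "c \<in> charts_at A (\<alpha> t)" and d: "d \<in> charts_at B (\<beta> t)"
      using chA[OF t] chB[OF t] by blast
    show "\<exists>c\<in>C. \<exists>D. C1_near {a..b} (\<lambda>t. m (\<alpha> t, \<beta> t)) c t D"
      by (rule bexI[OF _ conjunct1[OF charts_atD[OF e]]], rule exI, rule near[OF t c d e])
  qed
  show "velocity C {a..b} (\<lambda>t. m (\<alpha> t, \<beta> t)) t = ?V t" if t: "t \<in> {a..b}"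
  proof
    fix e
    obtain c d where c: "c \<in> charts_at A (\<alpha> t)" and d: "d \<in> charts_at B (\<beta> t)"
      using chA[OF t] chB[OF t] by blast
    show "velocity C {a..b} (\<lambda>t. m (\<alpha> t, \<beta> t)) t e = ?V t e"
    proof (cases "e \<in> charts_at C (m (\<alpha> t, \<beta> t))")
      case True
      have m1: "Ck_map 1 A C (\<lambda>x. m (x, \<beta> t))" and m2: "Ck_map 1 B C (\<lambda>y. m (\<alpha> t, y))"
        using C1_map_slice1[OF m A B Ck_path_points[OF \<beta> t]] C1_map_slice2[OF m A B Ck_path_points[OF \<alpha> t]] .
      show ?thesis
        unfolding velocity_eqI[of e C "\<lambda>t. m (\<alpha> t, \<beta> t)", OF True near[OF t c d True] ab t]
          differential_apply[OF A m1 velocity_in_tangent_space[OF A \<alpha> t] c True]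
          differential_apply[OF B m2 velocity_in_tangent_space[OF B \<beta> t] d True]
          local_rep_product_split(1)[OF m A B c d True]
        using c d by (simp add: velocity_apply)
    qed (simp add: velocity_apply differential_outside)
  qed
qed

lemma C1_near_cong:
  assumes "C1_near S \<alpha> c t D" "\<And>r. r \<in> S \<Longrightarrow> \<beta> r = \<alpha> r"
  shows "C1_near S \<beta> c t D"
proof -
  obtain T where T: "open T" "t \<in> T" "\<And>r. r \<in> S \<Longrightarrow> r \<in> T \<Longrightarrow> \<alpha> r \<in> fst c"
    "\<And>r. r \<in> S \<Longrightarrow> r \<in> T \<Longrightarrow> has_curve_deriv (\<lambda>r. snd c (\<alpha> r)) S r (D r)"
    "continuous_on (S \<inter> T) D"
    using assms(1) by (rule C1_nearE) (rule that)
  show ?thesis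
  proof (rule C1_nearI[OF T(1,2)])
    fix r assume r: "r \<in> S" "r \<in> T"
    then show "\<beta> r \<in> fst c" using T(3) assms(2) by simp
    have ev: "eventually (\<lambda>s. snd c (\<beta> s) = snd c (\<alpha> s)) (at r within S)"
      unfolding eventually_at_filter by (rule always_eventually) (simp add: assms(2))
    show "has_curve_deriv (\<lambda>r. snd c (\<beta> r)) S r (D r)"
      using has_curve_deriv_cong_filter[OF T(4)[OF r] order_refl ev] assms(2)[OF r(1)] by simp
  qed (rule T(5))
qed

lemma Ck_path_1_cong:
  assumes A: "manifold 1 A" and \<alpha>: "Ck_path 1 A a b \<alpha>" and eq: "\<And>r. r \<in> {a..b} \<Longrightarrow> \<beta> r = \<alpha> r"
  shows "Ck_path 1 A a b \<beta>"
proof (rule Ck_path_1I[OF A Ck_path_less[OF \<alpha>]])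
  fix t assume t: "t \<in> {a..b}"
  obtain c where c: "c \<in> charts_at A (\<alpha> t)" "C1_near {a..b} \<alpha> c t (chart_velocity c {a..b} \<alpha>)"
    using Ck_path_1_chart[OF \<alpha> t] .
  from C1_near_cong[OF c(2) eq] charts_atD[OF c(1)]
  show "\<exists>c\<in>A. \<exists>D. C1_near {a..b} \<beta> c t D" by blast
qed

lemma Ck_path_1_subinterval:
  assumes A: "manifold 1 A" and \<alpha>: "Ck_path 1 A a b \<alpha>" and sub: "a \<le> s" "s < t" "t \<le> b"
  shows "Ck_path 1 A s t \<alpha>"
proof (rule Ck_path_1I[OF A sub(2)])
  fix r assume "r \<in> {s..t}"
  then have r: "r \<in> {a..b}" using sub by simp
  obtain c where c: "c \<in> charts_at A (\<alpha> r)" "C1_near {a..b} \<alpha> c r (chart_velocity c {a..b} \<alpha>)"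
    using Ck_path_1_chart[OF \<alpha> r] .
  have "{s..t} \<subseteq> {a..b}" using sub by simp
  from C1_near_subset[OF c(2) this] charts_atD[OF c(1)]
  show "\<exists>c\<in>A. \<exists>D. C1_near {s..t} \<alpha> c r D" by blast
qed

lemma velocity_subinterval:
  assumes \<alpha>: "Ck_path 1 A a b \<alpha>" and sub: "a \<le> s" "s < t" "t \<le> b" and r: "r \<in> {s..t}"
  shows "velocity A {s..t} \<alpha> r = velocity A {a..b} \<alpha> r"
proof
  fix c
  have r': "r \<in> {a..b}" and le: "{s..t} \<subseteq> {a..b}" using r sub by auto
  show "velocity A {s..t} \<alpha> r c = velocity A {a..b} \<alpha> r c"
  proof (cases "c \<in> charts_at A (\<alpha> r)")
    case True
    note near = Ck_path_1_near[OF \<alpha> r' True]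
    show ?thesis
      using velocity_eqI[OF True near Ck_path_less[OF \<alpha>] r']
        velocity_eqI[OF True C1_near_subset[OF near le] sub(2) r] by simp
  qed (simp add: velocity_apply)
qed

section \<open>Piecewise paths\<close>

lemma piecewise_single: "Ck_path k A a b \<alpha> \<Longrightarrow> piecewise_Ck_path k A a b \<alpha>"
  unfolding piecewise_Ck_path_def
  by (rule conjI[OF Ck_path_less], assumption, intro exI[of _ 1] exI[of _ "\<lambda>i. if i = 0 then a else b"]) simp

lemma piecewise_join:
  assumes "piecewise_Ck_path k A a b \<alpha>" "piecewise_Ck_path k A b c \<alpha>"
  shows "piecewise_Ck_path k A a c \<alpha>"
proof -
  obtain n \<tau> where 1: "a < b" "\<tau> 0 = a" "\<tau> n = b" "\<And>i. i < n \<Longrightarrow> Ck_path k A (\<tau> i) (\<tau> (Suc i)) \<alpha>"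
    using assms(1) unfolding piecewise_Ck_path_def by metis
  obtain m \<sigma> where 2: "b < c" "\<sigma> 0 = b" "\<sigma> m = c" "\<And>i. i < m \<Longrightarrow> Ck_path k A (\<sigma> i) (\<sigma> (Suc i)) \<alpha>"
    using assms(2) unfolding piecewise_Ck_path_def by metis
  define \<rho> where "\<rho> i = (if i < n then \<tau> i else \<sigma> (i - n))" for i
  have "Ck_path k A (\<rho> i) (\<rho> (Suc i)) \<alpha>" if "i < n + m" for i
  proof (cases "i < n")
    case True
    have "\<rho> (Suc i) = \<tau> (Suc i)"
    proof (cases "Suc i < n")
      case False
      then have "Suc i = n" using True by simp
      then show ?thesis using 1(3) 2(2) by (simp add: \<rho>_def)
    qed (simp add: \<rho>_def)
    then show ?thesis using 1(4)[OF True] True by (simp add: \<rho>_def)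
  next
    case False
    then have "Suc (i - n) = Suc i - n" "i - n < m" using that by auto
    then show ?thesis using 2(4)[of "i - n"] False by (simp add: \<rho>_def)
  qed
  moreover have "\<rho> 0 = a" using 1 2 by (cases "n = 0") (auto simp: \<rho>_def)
  moreover have "\<rho> (n + m) = c" using 2 by (simp add: \<rho>_def)
  ultimately show ?thesis
    unfolding piecewise_Ck_path_def using 1(1) 2(1) by (intro conjI exI[of _ "n + m"] exI[of _ \<rho>]) auto
qed

lemma piecewise_induct [consumes 1, case_names single join]:
  assumes "piecewise_Ck_path k A a b \<alpha>"
    and "\<And>a b. Ck_path k A a b \<alpha> \<Longrightarrow> P a b"
    and "\<And>a b c. a < b \<Longrightarrow> b < c \<Longrightarrow> piecewise_Ck_path k A a b \<alpha> \<Longrightarrow> Ck_path k A b c \<alpha> \<Longrightarrow> P a b \<Longrightarrow> P b c \<Longrightarrow> P a c"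
  shows "P a b"
proof -
  obtain n \<tau> where 1: "a < b" "\<tau> 0 = a" "\<tau> n = b" "\<And>i. i < n \<Longrightarrow> Ck_path k A (\<tau> i) (\<tau> (Suc i)) \<alpha>"
    using assms(1) unfolding piecewise_Ck_path_def by metis
  have "m < n \<Longrightarrow> \<tau> 0 < \<tau> (Suc m) \<and> piecewise_Ck_path k A (\<tau> 0) (\<tau> (Suc m)) \<alpha> \<and> P (\<tau> 0) (\<tau> (Suc m))" for m
  proof (induction m)
    case 0
    then show ?case using 1(4)[OF 0] Ck_path_less piecewise_single assms(2) by blast
  next
    case (Suc m)
    then have IH: "\<tau> 0 < \<tau> (Suc m)" "piecewise_Ck_path k A (\<tau> 0) (\<tau> (Suc m)) \<alpha>" "P (\<tau> 0) (\<tau> (Suc m))"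
      by auto
    have p: "Ck_path k A (\<tau> (Suc m)) (\<tau> (Suc (Suc m))) \<alpha>" using 1(4)[OF Suc.prems] .
    show ?case
      using assms(3)[OF IH(1) Ck_path_less[OF p] IH(2) p IH(3) assms(2)[OF p]]
        piecewise_join[OF IH(2) piecewise_single[OF p]] IH(1) Ck_path_less[OF p] by simp
  qed
  moreover have "n \<noteq> 0" using 1 by (cases n) auto
  ultimately show ?thesis using 1(2,3) by (cases n) auto
qed

lemma piecewise_map:
  assumes f: "Ck_map 1 A B f" and A: "manifold 1 A" and B: "manifold 1 B" and \<alpha>: "piecewise_Ck_path 1 A a b \<alpha>"
  shows "piecewise_Ck_path 1 B a b (\<lambda>t. f (\<alpha> t))"
  using \<alpha>
proof (induction rule: piecewise_induct)
  case (single a b)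
  then show ?case by (intro piecewise_single Ck_path_1_map[OF f A B])
next
  case (join a b c)
  then show ?case by (blast intro: piecewise_join)
qed

lemma piecewise_less: "piecewise_Ck_path k A a b \<alpha> \<Longrightarrow> a < b"
  unfolding piecewise_Ck_path_def by simp

lemma piecewise_points:
  assumes "piecewise_Ck_path k A a b \<alpha>"
  shows "t \<in> {a..b} \<Longrightarrow> \<alpha> t \<in> points A"
  using assms
proof (induction rule: piecewise_induct)
  case (single a b)
  then show ?case using Ck_path_points by blast
next
  case (join a b c)
  then show ?case by (cases "t \<le> b") auto
qed

lemma piecewise_cong:
  assumes A: "manifold 1 A" and \<alpha>: "piecewise_Ck_path 1 A a b \<alpha>"
  shows "\<forall>r\<in>{a..b}. \<beta> r = \<alpha> r \<Longrightarrow> piecewise_Ck_path 1 A a b \<beta>"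
  using \<alpha>
proof (induction rule: piecewise_induct)
  case (single a b)
  then show ?case by (intro piecewise_single Ck_path_1_cong[OF A single(1)]) blast
next
  case (join a b c)
  have "\<forall>r\<in>{a..b}. \<beta> r = \<alpha> r" "\<forall>r\<in>{b..c}. \<beta> r = \<alpha> r"
    using join(1,2,7) by simp_all
  from piecewise_join[OF join(5)[OF this(1)] join(6)[OF this(2)]] show ?case .
qed

section \<open>Integrals\<close>

text \<open>The integral is the supremum over simple functions below the integrand. It is therefore
  additive over disjoint measurable sets whether or not the integrand is measurable.\<close>

lemma nn_integral_disjoint_Un:
  assumes A: "A \<in> sets M" and B: "B \<in> sets M" and disj: "A \<inter> B = {}"
  shows "(\<integral>\<^sup>+x\<in>A \<union> B. f x \<partial>M) = (\<integral>\<^sup>+x\<in>A. f x \<partial>M) + (\<integral>\<^sup>+x\<in>B. f x \<partial>M)"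
proof (rule antisym)
  let ?fA = "\<lambda>x. f x * indicator A x" and ?fB = "\<lambda>x. f x * indicator B x"
    and ?fAB = "\<lambda>x. f x * indicator (A \<union> B) x"
  show "integral\<^sup>N M ?fAB \<le> integral\<^sup>N M ?fA + integral\<^sup>N M ?fB"
    unfolding nn_integral_def[of M ?fAB]
  proof (rule SUP_least)
    fix g assume "g \<in> {g. simple_function M g \<and> g \<le> ?fAB}"
    then have g: "simple_function M g" "\<And>x. g x \<le> ?fAB x" by (auto simp: le_fun_def)
    have [measurable]: "g \<in> borel_measurable M" using g(1) by (rule borel_measurable_simple_function)
    have "g x = g x * indicator A x + g x * indicator B x" for x
    proof (cases "x \<in> A \<union> B")
      case True
      then show ?thesis using disj by (auto simp: indicator_def)
    next
      case False
      then have "g x = 0" using g(2)[of x] by simp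
      then show ?thesis by simp
    qed
    then have "integral\<^sup>S M g = (\<integral>\<^sup>+x. g x * indicator A x + g x * indicator B x \<partial>M)"
      using nn_integral_eq_simple_integral[OF g(1)] by simp
    also have "\<dots> = (\<integral>\<^sup>+x. g x * indicator A x \<partial>M) + (\<integral>\<^sup>+x. g x * indicator B x \<partial>M)"
      using A B by (intro nn_integral_add borel_measurable_times_ennreal borel_measurable_indicator) auto
    also have "\<dots> \<le> integral\<^sup>N M ?fA + integral\<^sup>N M ?fB"
    proof (intro add_mono nn_integral_mono)
      show "g x * indicator A x \<le> ?fA x" "g x * indicator B x \<le> ?fB x" for x
        using g(2)[of x] by (auto simp: indicator_def split: if_splits)
    qed
    finally show "integral\<^sup>S M g \<le> integral\<^sup>N M ?fA + integral\<^sup>N M ?fB" .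
  qed
  let ?I = "\<lambda>f. {g. simple_function M g \<and> g \<le> f}"
  have ne: "?I f \<noteq> {}" for f :: "_ \<Rightarrow> ennreal"
  proof -
    have "(\<lambda>_. 0) \<in> ?I f" by (simp add: le_fun_def)
    then show ?thesis by blast
  qed
  have "integral\<^sup>S M g + integral\<^sup>S M h \<le> integral\<^sup>N M ?fAB" if "g \<in> ?I ?fA" "h \<in> ?I ?fB" for g h
  proof -
    have g: "simple_function M g" "\<And>x. g x \<le> ?fA x" and h: "simple_function M h" "\<And>x. h x \<le> ?fB x"
      using that by (auto simp: le_fun_def)
    have "integral\<^sup>S M g + integral\<^sup>S M h = (\<integral>\<^sup>+x. g x + h x \<partial>M)"
      using g(1) h(1)
      by (simp add: nn_integral_eq_simple_integral[symmetric] nn_integral_add borel_measurable_simple_function)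
    also have "\<dots> \<le> integral\<^sup>N M ?fAB"
    proof (rule nn_integral_mono)
      show "g x + h x \<le> ?fAB x" for x
        using g(2)[of x] h(2)[of x] disj by (cases "x \<in> A"; cases "x \<in> B") auto
    qed
    finally show ?thesis .
  qed
  then have "(SUP h\<in>?I ?fB. integral\<^sup>S M g + integral\<^sup>S M h) \<le> integral\<^sup>N M ?fAB" if "g \<in> ?I ?fA" for g
    using that by (intro SUP_least)
  then have "integral\<^sup>S M g + integral\<^sup>N M ?fB \<le> integral\<^sup>N M ?fAB" if "g \<in> ?I ?fA" for g
    using that unfolding nn_integral_def[of M ?fB] ennreal_SUP_add_right[OF ne] by blast
  then have "(SUP g\<in>?I ?fA. integral\<^sup>S M g + integral\<^sup>N M ?fB) \<le> integral\<^sup>N M ?fAB"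
    by (intro SUP_least)
  then show "integral\<^sup>N M ?fA + integral\<^sup>N M ?fB \<le> integral\<^sup>N M ?fAB"
    unfolding nn_integral_def[of M ?fA] ennreal_SUP_add_left[OF ne] .
qed

lemma nn_integral_Icc_split:
  fixes a b c :: real
  assumes "a \<le> b" "b \<le> c"
  shows "(\<integral>\<^sup>+x\<in>{a..c}. f x \<partial>lborel) = (\<integral>\<^sup>+x\<in>{a..b}. f x \<partial>lborel) + (\<integral>\<^sup>+x\<in>{b..c}. f x \<partial>lborel)"
proof -
  have "{a..c} = {a..b} \<union> {b<..c}" using assms by auto
  then have "(\<integral>\<^sup>+x\<in>{a..c}. f x \<partial>lborel) = (\<integral>\<^sup>+x\<in>{a..b}. f x \<partial>lborel) + (\<integral>\<^sup>+x\<in>{b<..c}. f x \<partial>lborel)"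
    by (simp only:) (rule nn_integral_disjoint_Un, auto)
  also have "(\<integral>\<^sup>+x\<in>{b<..c}. f x \<partial>lborel) = (\<integral>\<^sup>+x\<in>{b..c}. f x \<partial>lborel)"
    by (rule nn_integral_cong_AE, rule eventually_mono[OF AE_lborel_singleton[of b]])
      (auto simp: indicator_def)
  finally show ?thesis .
qed

lemma measurable_ennreal_Icc:
  fixes m :: "real \<Rightarrow> real"
  assumes "continuous_on {c..d} m"
  shows "(\<lambda>t. ennreal (m t) * indicator {c..d} t) \<in> borel_measurable lborel"
proof -
  have "(\<lambda>t. indicator {c..d} t *\<^sub>R m t) \<in> borel_measurable borel"
    by (rule borel_measurable_continuous_on_indicator[OF _ assms]) simp
  then have "(\<lambda>t. ennreal (indicator {c..d} t *\<^sub>R m t)) \<in> borel_measurable lborel"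
    by measurable
  moreover have "(\<lambda>t. ennreal (indicator {c..d} t *\<^sub>R m t)) = (\<lambda>t. ennreal (m t) * indicator {c..d} t)"
    by (auto simp: fun_eq_iff indicator_def)
  ultimately show ?thesis by simp
qed

text \<open>The integral of an infimum of continuous functions is approximated by the integral of a minimum
  \<open>m\<close> of finitely many of them. By the Lindeloef property of the line countably many of the
  functions have the same infimum, so monotone convergence applies.\<close>

lemma integral_Inf_approx:
  fixes F :: "real \<Rightarrow> 'z \<Rightarrow> real"
  assumes cd: "c \<le> d" and Z: "Z \<noteq> {}" and eps: "0 < \<epsilon>"
    and cont: "\<And>z. z \<in> Z \<Longrightarrow> continuous_on {c..d} (\<lambda>t. F t z)"
    and nonneg: "\<And>t z. t \<in> {c..d} \<Longrightarrow> z \<in> Z \<Longrightarrow> 0 \<le> F t z"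
  obtains m where "continuous_on {c..d} m" "\<And>t. t \<in> {c..d} \<Longrightarrow> \<exists>z\<in>Z. F t z = m t"
    "(\<integral>\<^sup>+t\<in>{c..d}. ennreal (m t) \<partial>lborel) \<le>
     (\<integral>\<^sup>+t\<in>{c..d}. ennreal (Inf (F t ` Z)) \<partial>lborel) + ennreal \<epsilon>"
proof -
  \<comment> \<open>\<open>T z q\<close> is an open set of parameters at which \<open>z\<close> brings the value below \<open>q\<close>. For each rational
    threshold \<open>q\<close> countably many of these sets cover the union of all of them.\<close>
  have "\<exists>T. open T \<and> T \<inter> {c..d} = {t \<in> {c..d}. F t z < q}" if "z \<in> Z" for z q
  proof -
    have "openin (top_of_set {c..d}) ({c..d} \<inter> (\<lambda>t. F t z) -` {..<q})"
      using cont[OF that] by (rule continuous_openin_preimage_gen) simp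
    then obtain T where "open T" "{c..d} \<inter> (\<lambda>t. F t z) -` {..<q} = {c..d} \<inter> T"
      unfolding openin_open by blast
    then show ?thesis by (intro exI[of _ T]) blast
  qed
  then obtain T where T: "\<And>z q. z \<in> Z \<Longrightarrow> open (T z q)"
    "\<And>z q. z \<in> Z \<Longrightarrow> T z q \<inter> {c..d} = {t \<in> {c..d}. F t z < q}" by metis
  have "\<exists>Z'. Z' \<subseteq> Z \<and> countable Z' \<and> (\<Union>z\<in>Z'. T z q) = (\<Union>z\<in>Z. T z q)" for q
  proof -
    obtain \<F> where "\<F> \<subseteq> (\<lambda>z. T z q) ` Z" "countable \<F>" "\<Union>\<F> = (\<Union>z\<in>Z. T z q)"
      using Lindelof[of "(\<lambda>z. T z q) ` Z"] T(1) by blast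
    then show ?thesis using countable_subset_image[of \<F> "\<lambda>z. T z q" Z] by metis
  qed
  then obtain Zq where Zq: "\<And>q. Zq q \<subseteq> Z" "\<And>q. countable (Zq q)"
    "\<And>q. (\<Union>z\<in>Zq q. T z q) = (\<Union>z\<in>Z. T z q)" by metis
  obtain z0 where z0: "z0 \<in> Z" using Z by blast
  define Z0 where "Z0 = insert z0 (\<Union>q\<in>\<rat>. Zq q)"
  have Z0: "Z0 \<noteq> {}" "countable Z0" "Z0 \<subseteq> Z"
    unfolding Z0_def using z0 Zq countable_rat by auto
  define e where "e = from_nat_into Z0"
  have range_e: "range e = Z0" unfolding e_def using Z0 by (intro range_from_nat_into)
  then have e: "e n \<in> Z" for n using Z0(3) by blast
  \<comment> \<open>\<open>m n\<close> is the minimum of the functions that belong to \<open>e 0, \<dots>, e n\<close>.\<close>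
  define m where "m = rec_nat (\<lambda>t. F t (e 0)) (\<lambda>n g t. min (g t) (F t (e (Suc n))))"
  have m0: "m 0 t = F t (e 0)" and mS: "m (Suc n) t = min (m n t) (F t (e (Suc n)))" for n t
    by (simp_all add: m_def)
  have m_cont: "continuous_on {c..d} (m n)" for n
  proof (induction n)
    case 0
    have "m 0 = (\<lambda>t. F t (e 0))" by (rule ext) (rule m0)
    then show ?case using cont[OF e] by simp
  next
    case (Suc n)
    have "m (Suc n) = (\<lambda>t. min (m n t) (F t (e (Suc n))))" by (rule ext) (rule mS)
    then show ?case using continuous_on_min[OF Suc cont[OF e]] by simp
  qed
  have m_att: "\<exists>z\<in>Z. F t z = m n t" for n t
  proof (induction n)
    case 0
    show ?case by (rule bexI[where x = "e 0"]) (simp_all add: m0 e)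
  next
    case (Suc n)
    then show ?case using e[of "Suc n"] unfolding mS min_def by auto
  qed
  have m_le: "m n t \<le> F t (e n)" for n t by (cases n) (simp_all add: m0 mS)
  have m_dec: "m (Suc n) t \<le> m n t" for n t by (simp add: mS)
  have m_nonneg: "0 \<le> m n t" if "t \<in> {c..d}" for n t using m_att[of t n] nonneg[OF that] by metis
  let ?f = "\<lambda>n t. ennreal (m n t) * indicator {c..d} t"
  have dec: "decseq ?f"
    by (rule decseq_SucI) (auto simp: le_fun_def indicator_def intro: ennreal_leI m_dec)
  have meas: "?f n \<in> borel_measurable lborel" for n
    by (rule measurable_ennreal_Icc[OF m_cont])
  have "compact (m 0 ` {c..d})" by (rule compact_continuous_image[OF m_cont]) simp
  then have "bounded (m 0 ` {c..d})" by (rule compact_imp_bounded)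
  then obtain C where "\<forall>x\<in>m 0 ` {c..d}. norm x \<le> C" unfolding bounded_iff by blast
  then have C: "\<And>t. t \<in> {c..d} \<Longrightarrow> \<bar>m 0 t\<bar> \<le> C" by simp
  have "integral\<^sup>N lborel (?f 0) \<le> (\<integral>\<^sup>+t\<in>{c..d}. ennreal C \<partial>lborel)"
    by (rule nn_integral_mono) (use C in \<open>auto simp: indicator_def intro!: ennreal_leI dest!: abs_le_D1\<close>)
  also have "\<dots> < \<infinity>" using cd by (simp add: nn_integral_cmult_indicator ennreal_mult_less_top)
  finally have fin0: "integral\<^sup>N lborel (?f 0) < \<infinity>" .
  have le0: "integral\<^sup>N lborel (?f n) \<le> integral\<^sup>N lborel (?f 0)" for n
    using dec unfolding decseq_def by (intro nn_integral_mono) (simp add: le_fun_def)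
  have "(INF n. integral\<^sup>N lborel (?f n)) = (\<integral>\<^sup>+t. (INF n. ?f n t) \<partial>lborel)"
    by (rule nn_integral_monotone_convergence_INF_decseq[OF dec meas, symmetric])
      (use fin0 in auto)
  also have "\<dots> \<le> (\<integral>\<^sup>+t\<in>{c..d}. ennreal (Inf (F t ` Z)) \<partial>lborel)"
  proof (rule nn_integral_mono)
    fix t
    show "(INF n. ?f n t) \<le> ennreal (Inf (F t ` Z)) * indicator {c..d} t"
    proof (cases "t \<in> {c..d}")
      case True
      have "(INF n. ennreal (m n t)) \<le> ennreal (Inf (F t ` Z))"
      proof (rule ennreal_le_epsilon)
        fix \<delta> :: real assume "0 < \<delta>"
        have bdd: "bdd_below (F t ` Z)" using nonneg[OF True] by (intro bdd_belowI2[of _ 0])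
        obtain z where z: "z \<in> Z" "F t z < Inf (F t ` Z) + \<delta>"
          using cInf_lessD[of "F t ` Z" "Inf (F t ` Z) + \<delta>"] Z \<open>0 < \<delta>\<close> by auto
        obtain q where q: "q \<in> \<rat>" "F t z < q" "q < Inf (F t ` Z) + \<delta>"
          using Rats_dense_in_real[OF z(2)] by blast
        have "t \<in> T z q" using T(2)[OF z(1), of q] True q(2) by blast
        then obtain z' where z': "z' \<in> Zq q" "t \<in> T z' q" using Zq(3)[of q] z(1) by blast
        then have "F t z' < q" using T(2)[of z' q] Zq(1)[of q] True by blast
        moreover obtain k where "z' = e k" using z'(1) q(1) range_e unfolding Z0_def by blast
        ultimately have "m k t \<le> Inf (F t ` Z) + \<delta>" using m_le[of k t] q(3) by simp
        then have "(INF n. ennreal (m n t)) \<le> ennreal (Inf (F t ` Z) + \<delta>)"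
          by (intro INF_lower2[of k]) (auto intro: ennreal_leI)
        also have "\<dots> = ennreal (Inf (F t ` Z)) + ennreal \<delta>"
          using \<open>0 < \<delta>\<close> Z nonneg[OF True] by (intro ennreal_plus cINF_greatest) auto
        finally show "(INF n. ennreal (m n t)) \<le> ennreal (Inf (F t ` Z)) + ennreal \<delta>" .
      qed
      then show ?thesis using True by simp
    qed simp
  qed
  finally have INF_le: "(INF n. integral\<^sup>N lborel (?f n)) \<le> (\<integral>\<^sup>+t\<in>{c..d}. ennreal (Inf (F t ` Z)) \<partial>lborel)"
    (is "_ \<le> ?I") .
  have "\<exists>n. integral\<^sup>N lborel (?f n) \<le> ?I + ennreal \<epsilon>"
  proof (cases "?I = \<infinity>")
    case False
    then have "?I < ?I + ennreal \<epsilon>" using eps by (simp add: ennreal_add_left_cancel_less less_top)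
    with INF_le have "(INF n. integral\<^sup>N lborel (?f n)) < ?I + ennreal \<epsilon>" by (rule le_less_trans)
    then show ?thesis unfolding INF_less_iff using less_imp_le by blast
  qed simp
  then obtain n where "integral\<^sup>N lborel (?f n) \<le> ?I + ennreal \<epsilon>" by blast
  then show thesis using that[of "m n"] m_cont m_att by blast
qed

section \<open>Lengths\<close>

lemma velocity_interior: "t \<in> {a<..<b} \<Longrightarrow> velocity A {a..b} \<alpha> t = velocity A UNIV \<alpha> t"
proof -
  assume "t \<in> {a<..<b}"
  then have eq: "at t within {a..b} = at t" by (intro at_within_interior) simp
  show ?thesis unfolding velocity_def curve_deriv_def has_curve_deriv_def eq ..
qed

text \<open>Away from the end points, a null set, the velocity does not depend on the parameter interval.
  So lengths add up when paths are joined.\<close>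

lemma path_length_UNIV:
  "path_length A \<mu> a b \<alpha> = (\<integral>\<^sup>+t\<in>{a..b}. ennreal (\<mu> (\<alpha> t) (velocity A UNIV \<alpha> t)) \<partial>lborel)"
proof -
  have "AE t in lborel. t \<noteq> a \<and> t \<noteq> b" using AE_lborel_singleton[of a] AE_lborel_singleton[of b] by eventually_elim simp
  then show ?thesis
    unfolding path_length_def
    by (intro nn_integral_cong_AE, elim eventually_mono)
      (auto simp: indicator_def velocity_interior)
qed

lemma path_length_join:
  "a \<le> b \<Longrightarrow> b \<le> c \<Longrightarrow> path_length A \<mu> a c \<alpha> = path_length A \<mu> a b \<alpha> + path_length A \<mu> b c \<alpha>"
  unfolding path_length_UNIV by (rule nn_integral_Icc_split)

lemma velocity_cong:
  assumes "\<And>r. r \<in> S \<Longrightarrow> \<beta> r = \<alpha> r" "t \<in> S"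
  shows "velocity A S \<beta> t = velocity A S \<alpha> t"
proof -
  have eq: "has_curve_deriv (snd c \<circ> \<beta>) S t y \<longleftrightarrow> has_curve_deriv (snd c \<circ> \<alpha>) S t y" for c y
    unfolding has_curve_deriv_def
    by (rule tendsto_cong) (use assms in \<open>auto simp: eventually_at_filter\<close>)
  have cd: "curve_deriv (snd c \<circ> \<beta>) S t = curve_deriv (snd c \<circ> \<alpha>) S t" for c
    unfolding curve_deriv_def eq ..
  show ?thesis unfolding velocity_def assms(1)[OF assms(2)] cd ..
qed

lemma path_length_eqI:
  assumes "\<And>t. t \<in> {a..b} \<Longrightarrow> \<mu> (\<alpha> t) (velocity A {a..b} \<alpha> t) = f t"
  shows "path_length A \<mu> a b \<alpha> = (\<integral>\<^sup>+t\<in>{a..b}. ennreal (f t) \<partial>lborel)"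
  unfolding path_length_def using assms by (intro nn_integral_cong) (auto simp: indicator_def)

lemma path_length_cong:
  assumes "\<And>t. t \<in> {a..b} \<Longrightarrow> \<beta> t = \<alpha> t"
  shows "path_length A \<mu> a b \<beta> = path_length A \<mu> a b \<alpha>"
  unfolding path_length_def[of A \<mu> a b \<alpha>]
  by (rule path_length_eqI) (simp only: assms velocity_cong[of "{a..b}" \<beta> \<alpha>, OF assms])

section \<open>Continuity of a Finsler metric along vector fields\<close>

lemma topspace_manifold_topology: "topspace (manifold_topology A) = points A"
proof
  show "topspace (manifold_topology A) \<subseteq> points A"
    unfolding topspace_def openin_manifold_topology by blast
  have "openin (manifold_topology A) (points A)"
    unfolding openin_manifold_topology
  proof (intro conjI ballI subset_refl)
    fix c assume "c \<in> A"
    then have "fst c \<subseteq> points A" unfolding points_iff subset_iff by blast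
    then show "case c of (U, \<phi>) \<Rightarrow> \<exists>Q. open Q \<and> points A \<inter> U = U \<inter> \<phi> -` Q"
      unfolding split_beta by (intro exI[of _ UNIV]) auto
  qed
  then show "points A \<subseteq> topspace (manifold_topology A)" by (rule openin_subset)
qed

lemma openin_manifold_chart:
  assumes "openin (manifold_topology A) W" "c \<in> A"
  obtains Q where "open Q" "\<And>x. x \<in> fst c \<Longrightarrow> x \<in> W \<longleftrightarrow> snd c x \<in> Q"
proof -
  obtain Q where Q: "open Q" "W \<inter> fst c = fst c \<inter> snd c -` Q"
    using assms unfolding openin_manifold_topology split_beta by blast
  show thesis
  proof (rule that[OF Q(1)])
    show "x \<in> W \<longleftrightarrow> snd c x \<in> Q" if "x \<in> fst c" for x using Q(2) that by blast
  qed
qed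

lemma continuous_map_into_manifold:
  fixes f :: "real \<Rightarrow> 'a" and A :: "('a, 'e::lcs) chart set"
  assumes "\<And>t. t \<in> S \<Longrightarrow> \<exists>c\<in>A. \<exists>T. open T \<and> t \<in> T \<and> (\<forall>r\<in>S \<inter> T. f r \<in> fst c) \<and>
      continuous_on (S \<inter> T) (\<lambda>r. snd c (f r))"
  shows "continuous_map (top_of_set S) (manifold_topology A) f"
  unfolding continuous_map_def
proof (intro conjI allI impI funcsetI)
  fix t assume "t \<in> topspace (top_of_set S)"
  then have "t \<in> S" by simp
  then show "f t \<in> topspace (manifold_topology A)"
    using assms[of t] unfolding topspace_manifold_topology points_iff by blast
next
  fix W assume W: "openin (manifold_topology A) W"
  show "openin (top_of_set S) {t \<in> topspace (top_of_set S). f t \<in> W}"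
  proof (subst openin_subopen, intro ballI)
    fix t assume "t \<in> {t \<in> topspace (top_of_set S). f t \<in> W}"
    then have t: "t \<in> S" "f t \<in> W" by auto
    obtain c T where c: "c \<in> A" and T: "open T" "t \<in> T" "\<forall>r\<in>S \<inter> T. f r \<in> fst c"
      "continuous_on (S \<inter> T) (\<lambda>r. snd c (f r))"
      using assms[OF t(1)] by metis
    obtain Q where Q: "open Q" "\<And>x. x \<in> fst c \<Longrightarrow> x \<in> W \<longleftrightarrow> snd c x \<in> Q"
      by (rule openin_manifold_chart[OF W c]) (rule that)
    have "openin (top_of_set (S \<inter> T)) (S \<inter> T \<inter> (\<lambda>r. snd c (f r)) -` Q)"
      using T(4) Q(1) by (rule continuous_openin_preimage_gen)
    moreover have "openin (top_of_set S) (S \<inter> T)" using T(1) by auto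
    ultimately have "openin (top_of_set S) (S \<inter> T \<inter> (\<lambda>r. snd c (f r)) -` Q)"
      using openin_trans by blast
    moreover have "t \<in> S \<inter> T \<inter> (\<lambda>r. snd c (f r)) -` Q"
      using t T(2,3) Q(2) by blast
    moreover have "S \<inter> T \<inter> (\<lambda>r. snd c (f r)) -` Q \<subseteq> {t \<in> topspace (top_of_set S). f t \<in> W}"
      using T(3) Q(2) by auto
    ultimately show "\<exists>T. openin (top_of_set S) T \<and> t \<in> T \<and> T \<subseteq> {t \<in> topspace (top_of_set S). f t \<in> W}"
      by (intro exI conjI)
  qed
qed

lemma continuous_on_finsler:
  fixes A :: "('a, 'e::lcs) chart set" and S :: "real set"
  assumes \<mu>: "finsler_metric A \<mu>"
    and \<xi>: "\<And>t. t \<in> S \<Longrightarrow> \<xi> t \<in> tangent_space A (\<alpha> t)"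
    and loc: "\<And>t. t \<in> S \<Longrightarrow> \<exists>c\<in>A. \<exists>T. open T \<and> t \<in> T \<and> (\<forall>r\<in>S \<inter> T. \<alpha> r \<in> fst c) \<and>
      continuous_on (S \<inter> T) (\<lambda>r. snd c (\<alpha> r)) \<and> continuous_on (S \<inter> T) (\<lambda>r. \<xi> r c)"
  shows "continuous_on S (\<lambda>t. \<mu> (\<alpha> t) (\<xi> t))"
proof -
  have "continuous_map (top_of_set S) (manifold_topology (tangent_bundle_atlas A)) (\<lambda>t. (\<alpha> t, \<xi> t))"
  proof (rule continuous_map_into_manifold)
    fix t assume t: "t \<in> S"
    obtain c T where c: "c \<in> A" and T: "open T" "t \<in> T" "\<forall>r\<in>S \<inter> T. \<alpha> r \<in> fst c"
      "continuous_on (S \<inter> T) (\<lambda>r. snd c (\<alpha> r))" "continuous_on (S \<inter> T) (\<lambda>r. \<xi> r c)"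
      using loc[OF t] by metis
    let ?c = "(Sigma (fst c) (tangent_space A), \<lambda>(x, \<xi>). (snd c x, \<xi> c))"
    have 1: "?c \<in> tangent_bundle_atlas A"
      unfolding tangent_bundle_atlas_def using c by (cases c) auto
    have 2: "\<forall>r\<in>S \<inter> T. (\<alpha> r, \<xi> r) \<in> fst ?c" using T(3) \<xi> by auto
    have 3: "continuous_on (S \<inter> T) (\<lambda>r. snd ?c (\<alpha> r, \<xi> r))"
      using continuous_on_Pair[OF T(4,5)] by simp
    show "\<exists>c\<in>tangent_bundle_atlas A. \<exists>T. open T \<and> t \<in> T \<and> (\<forall>r\<in>S \<inter> T. (\<alpha> r, \<xi> r) \<in> fst c) \<and>
      continuous_on (S \<inter> T) (\<lambda>r. snd c (\<alpha> r, \<xi> r))"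
      using T(1,2) 2 3 by (intro bexI[OF _ 1] exI[of _ T] conjI)
  qed
  moreover have "continuous_map (manifold_topology (tangent_bundle_atlas A)) euclideanreal (\<lambda>(x, v). \<mu> x v)"
    using \<mu> unfolding finsler_metric_def by blast
  ultimately have "continuous_map (top_of_set S) euclideanreal ((\<lambda>(x, v). \<mu> x v) \<circ> (\<lambda>t. (\<alpha> t, \<xi> t)))"
    by (rule continuous_map_compose)
  then show ?thesis by (simp add: comp_def)
qed

section \<open>Translations in a Lie group\<close>

context
  fixes s :: enat and G :: "('g, 'x) monoid_scheme" (structure) and A :: "('g, 'e::lcs) chart set"
  assumes lie: "lie_group s G A"
begin

lemma lie_group_group: "group G"
  and lie_group_carrier: "carrier G = points A"
  and lie_group_manifold: "manifold 1 A"
  and lie_group_class: "1 \<le> s"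
proof -
  have s: "2 \<le> s" using lie unfolding lie_group_def by blast
  have "(1::enat) \<le> 2" by (simp add: one_enat_def numeral_eq_enat)
  with s show "1 \<le> s" by (rule order.trans[rotated])
  then show "group G" "carrier G = points A" "manifold 1 A"
    using lie manifold_mono[of s A 1] unfolding lie_group_def by blast+
qed

interpretation G: group G by (rule lie_group_group)

lemma C1_map_mult: "Ck_map 1 (product_atlas A A) A (\<lambda>z. fst z \<otimes> snd z)"
proof -
  note A = lie_group_manifold
  have inj: "inj_charts A" using A by (rule manifold_inj_charts)
  have inj2: "inj_charts (product_atlas A A)" using inj inj by (rule inj_charts_product)
  have "(1::enat) \<le> 2" by (simp add: one_enat_def numeral_eq_enat)
  then have q: "Ck_map 1 (product_atlas A A) A (\<lambda>(x, y). x \<otimes> inv y)"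
    using lie Ck_map_mono[of 2 _ _ _ 1] unfolding lie_group_def by blast
  have "\<one> \<in> points A" using G.one_closed unfolding lie_group_carrier .
  from C1_map_slice2[OF q A A this]
  have inv: "Ck_map 1 A A (\<lambda>y. inv y)"
    by (rule C1_map_cong[OF _ _ inj]) (simp add: lie_group_carrier[symmetric])
  have "Ck_map 1 (product_atlas A A) A (\<lambda>z. (\<lambda>(x, y). x \<otimes> inv y) (fst z, inv (snd z)))"
    by (rule C1_map_compose[OF C1_map_Pair[OF C1_map_fst[OF A A] C1_map_compose[OF C1_map_snd[OF A A] inv inj2 inj] inj2]
        q inj2 inj2])
  then show "Ck_map 1 (product_atlas A A) A (\<lambda>z. fst z \<otimes> snd z)"
    by (rule C1_map_cong[OF _ _ inj2])
      (auto simp: points_product_atlas lie_group_carrier[symmetric])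
qed

lemma C1_map_left: "g \<in> carrier G \<Longrightarrow> Ck_map 1 A A (\<lambda>x. g \<otimes> x)"
  and C1_map_right: "g \<in> carrier G \<Longrightarrow> Ck_map 1 A A (\<lambda>x. x \<otimes> g)"
  using C1_map_slice2[OF C1_map_mult lie_group_manifold lie_group_manifold]
    C1_map_slice1[OF C1_map_mult lie_group_manifold lie_group_manifold]
  unfolding lie_group_carrier by simp_all

lemma left_trans_tangent:
  "g \<in> carrier G \<Longrightarrow> h \<in> carrier G \<Longrightarrow> v \<in> tangent_space A h \<Longrightarrow>
    left_trans G A g h v \<in> tangent_space A (g \<otimes> h)"
  unfolding left_trans_def
  by (rule differential_in_tangent_space[OF lie_group_manifold lie_group_manifold C1_map_left])
    (simp_all add: lie_group_carrier)

lemma right_trans_tangent: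
  "g \<in> carrier G \<Longrightarrow> h \<in> carrier G \<Longrightarrow> v \<in> tangent_space A h \<Longrightarrow>
    right_trans G A g h v \<in> tangent_space A (h \<otimes> g)"
  unfolding right_trans_def
  by (rule differential_in_tangent_space[OF lie_group_manifold lie_group_manifold C1_map_right])
    (simp_all add: lie_group_carrier)

lemma differential_left_trans:
  assumes "Ck_map 1 A B f" "g \<in> carrier G" "h \<in> carrier G" "v \<in> tangent_space A h"
  shows "differential A B f (g \<otimes> h) (left_trans G A g h v) =
    differential A B (\<lambda>x. f (g \<otimes> x)) h v"
  unfolding left_trans_def
  by (rule differential_compose[symmetric, OF lie_group_manifold lie_group_manifold C1_map_left])
    (use assms in \<open>simp_all add: lie_group_carrier\<close>)

lemma differential_right_trans:
  assumes "Ck_map 1 A B f" "g \<in> carrier G" "h \<in> carrier G" "v \<in> tangent_space A h"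
  shows "differential A B f (h \<otimes> g) (right_trans G A g h v) =
    differential A B (\<lambda>x. f (x \<otimes> g)) h v"
  unfolding right_trans_def
  by (rule differential_compose[symmetric, OF lie_group_manifold lie_group_manifold C1_map_right])
    (use assms in \<open>simp_all add: lie_group_carrier\<close>)

lemma left_right_trans:
  assumes "g \<in> carrier G" "u \<in> carrier G" "h \<in> carrier G" "v \<in> tangent_space A h"
  shows "left_trans G A g (h \<otimes> u) (right_trans G A u h v) =
    right_trans G A u (g \<otimes> h) (left_trans G A g h v)"
proof -
  have "left_trans G A g (h \<otimes> u) (right_trans G A u h v) =
      differential A A (\<lambda>x. g \<otimes> (x \<otimes> u)) h v"
    unfolding left_trans_def using assms by (intro differential_right_trans C1_map_left)
  also have "\<dots> = differential A A (\<lambda>x. (g \<otimes> x) \<otimes> u) h v"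
    by (rule differential_cong[OF lie_group_manifold])
      (use assms in \<open>simp_all add: lie_group_carrier[symmetric] G.m_assoc\<close>)
  also have "\<dots> = right_trans G A u (g \<otimes> h) (left_trans G A g h v)"
    unfolding right_trans_def using assms by (intro differential_left_trans[symmetric] C1_map_right)
  finally show ?thesis .
qed

lemma left_trans_left_trans:
  assumes "g \<in> carrier G" "h \<in> carrier G" "k \<in> carrier G" "v \<in> tangent_space A k"
  shows "left_trans G A g (h \<otimes> k) (left_trans G A h k v) = left_trans G A (g \<otimes> h) k v"
proof -
  have "left_trans G A g (h \<otimes> k) (left_trans G A h k v) =
      differential A A (\<lambda>x. g \<otimes> (h \<otimes> x)) k v"
    unfolding left_trans_def[of G A g] using assms by (intro differential_left_trans C1_map_left)
  also have "\<dots> = left_trans G A (g \<otimes> h) k v"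
    unfolding left_trans_def by (rule differential_cong[OF lie_group_manifold])
      (use assms in \<open>simp_all add: lie_group_carrier[symmetric] G.m_assoc\<close>)
  finally show ?thesis .
qed

lemma right_trans_right_trans:
  assumes "g \<in> carrier G" "h \<in> carrier G" "k \<in> carrier G" "v \<in> tangent_space A k"
  shows "right_trans G A g (k \<otimes> h) (right_trans G A h k v) = right_trans G A (h \<otimes> g) k v"
proof -
  have "right_trans G A g (k \<otimes> h) (right_trans G A h k v) =
      differential A A (\<lambda>x. (x \<otimes> h) \<otimes> g) k v"
    unfolding right_trans_def[of G A g] using assms by (intro differential_right_trans C1_map_right)
  also have "\<dots> = right_trans G A (h \<otimes> g) k v"
    unfolding right_trans_def by (rule differential_cong[OF lie_group_manifold])
      (use assms in \<open>simp_all add: lie_group_carrier[symmetric] G.m_assoc\<close>)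
  finally show ?thesis .
qed

lemma left_trans_one: "h \<in> carrier G \<Longrightarrow> v \<in> tangent_space A h \<Longrightarrow> left_trans G A \<one> h v = v"
  unfolding left_trans_def
  using differential_cong[OF lie_group_manifold, of "\<lambda>x. \<one> \<otimes> x" "\<lambda>x. x" h A v]
    differential_id[OF lie_group_manifold, of v h]
  by (simp add: lie_group_carrier[symmetric])

lemma right_trans_one: "h \<in> carrier G \<Longrightarrow> v \<in> tangent_space A h \<Longrightarrow> right_trans G A \<one> h v = v"
  unfolding right_trans_def
  using differential_cong[OF lie_group_manifold, of "\<lambda>x. x \<otimes> \<one>" "\<lambda>x. x" h A v]
    differential_id[OF lie_group_manifold, of v h]
  by (simp add: lie_group_carrier[symmetric])

lemma left_trans_zero: "g \<in> carrier G \<Longrightarrow> h \<in> carrier G \<Longrightarrow> left_trans G A g h (\<lambda>_. 0) = (\<lambda>_. 0)"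
  unfolding left_trans_def
  by (rule differential_zero[OF lie_group_manifold C1_map_left]) (simp_all add: lie_group_carrier)

lemma right_trans_diff:
  "g \<in> carrier G \<Longrightarrow> h \<in> carrier G \<Longrightarrow> v \<in> tangent_space A h \<Longrightarrow> w \<in> tangent_space A h \<Longrightarrow>
    right_trans G A g h (\<lambda>c. v c - w c) = (\<lambda>c. right_trans G A g h v c - right_trans G A g h w c)"
  unfolding right_trans_def
  by (rule differential_diff[OF lie_group_manifold C1_map_right]) (simp_all add: lie_group_carrier)

text \<open>The difference of the velocity of a path and a left-invariant vector field is a continuous vector
  field along the path.\<close>

lemma continuous_on_shifted_speed:
  assumes \<mu>: "finsler_metric A \<mu>" and \<alpha>: "Ck_path 1 A a b \<alpha>" and z: "z \<in> tangent_space A \<one>"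
  shows "continuous_on {a..b}
    (\<lambda>t. \<mu> (\<alpha> t) (\<lambda>c. velocity A {a..b} \<alpha> t c - left_trans G A (\<alpha> t) \<one> z c))"
proof (rule continuous_on_finsler[OF \<mu>])
  note A = lie_group_manifold
  have car: "\<alpha> t \<in> carrier G" if "t \<in> {a..b}" for t
    using Ck_path_points[OF \<alpha> that] by (simp add: lie_group_carrier)
  fix t assume t: "t \<in> {a..b}"
  have "left_trans G A (\<alpha> t) \<one> z \<in> tangent_space A (\<alpha> t)"
    using left_trans_tangent[OF car[OF t] _ z] car[OF t] by simp
  then show "(\<lambda>c. velocity A {a..b} \<alpha> t c - left_trans G A (\<alpha> t) \<one> z c) \<in> tangent_space A (\<alpha> t)"
    by (intro tangent_space_diff[OF A] velocity_in_tangent_space[OF A \<alpha> t])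
  obtain c where c: "c \<in> charts_at A (\<alpha> t)" "C1_near {a..b} \<alpha> c t (chart_velocity c {a..b} \<alpha>)"
    using Ck_path_1_chart[OF \<alpha> t] .
  let ?D = "chart_velocity c {a..b} \<alpha>"
  have cA: "c \<in> A" using charts_atD[OF c(1)] by simp
  obtain d where d: "d \<in> charts_at A \<one>"
    using G.one_closed charts_at_nonempty unfolding lie_group_carrier by metis
  obtain T where T: "open T" "t \<in> T" "\<And>r. r \<in> {a..b} \<Longrightarrow> r \<in> T \<Longrightarrow> \<alpha> r \<in> fst c"
    "\<And>r. r \<in> {a..b} \<Longrightarrow> r \<in> T \<Longrightarrow> has_curve_deriv (\<lambda>r. snd c (\<alpha> r)) {a..b} r (?D r)"
    "continuous_on ({a..b} \<inter> T) ?D" "continuous_on ({a..b} \<inter> T) (\<lambda>r. snd c (\<alpha> r))"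
    using c(2) by (rule C1_nearE) (rule that)
  have cr: "c \<in> charts_at A (\<alpha> r)" if "r \<in> {a..b} \<inter> T" for r
    using T(3) that cA unfolding charts_at_def by blast
  let ?m = "\<lambda>z. fst z \<otimes> snd z" and ?S = "{a..b} \<inter> T"
  let ?rep = "local_rep (chart_times c d) c ?m"
  have lt: "left_trans G A (\<alpha> r) \<one> z c = dir_deriv ?rep (snd c (\<alpha> r), snd d \<one>) (0, z d)"
    if r: "r \<in> ?S" for r
  proof -
    have g: "\<alpha> r \<in> carrier G" using r by (intro car) simp
    have "c \<in> charts_at A (fst (\<alpha> r, \<one>) \<otimes> snd (\<alpha> r, \<one>))" using cr[OF r] g by simp
    from local_rep_product_split(2)[OF C1_map_mult A A cr[OF r] d this, of "z d"]
    have "dir_deriv ?rep (snd c (\<alpha> r), snd d \<one>) (0, z d) =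
      dir_deriv (local_rep d c (\<lambda>y. \<alpha> r \<otimes> y)) (snd d \<one>) (z d)" by simp
    also have "\<dots> = left_trans G A (\<alpha> r) \<one> z c"
      unfolding left_trans_def
      by (rule differential_apply[symmetric, OF A C1_map_left[OF g] z d]) (use cr[OF r] g in simp)
    finally show ?thesis by simp
  qed
  have rep: "C1_at ?rep (snd c (\<alpha> r), snd d \<one>)" if r: "r \<in> ?S" for r
  proof -
    have q: "chart_times c d \<in> product_atlas A A" using cA charts_atD[OF d] unfolding product_atlas_iff by blast
    have "C1_at ?rep y" if "y \<in> snd (chart_times c d) ` (fst (chart_times c d) \<inter> ?m -` fst c)" for y
      using C1_map_local_rep[OF C1_map_mult q cA] that unfolding Ck_on_1_iff by blast
    moreover have "(\<alpha> r, \<one>) \<in> fst (chart_times c d) \<inter> ?m -` fst c"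
      using charts_atD[OF cr[OF r]] charts_atD[OF d] car[of r] r by simp
    then have "snd (chart_times c d) (\<alpha> r, \<one>) \<in> snd (chart_times c d) ` (fst (chart_times c d) \<inter> ?m -` fst c)"
      by (rule imageI)
    ultimately have "C1_at ?rep (snd (chart_times c d) (\<alpha> r, \<one>))" by blast
    then show ?thesis by simp
  qed
  have "continuous_on (?S) (\<lambda>r. dir_deriv ?rep (snd c (\<alpha> r), snd d \<one>) (0, z d))"
    unfolding continuous_on_def
  proof
    fix r assume r: "r \<in> ?S"
    show "((\<lambda>r. dir_deriv ?rep (snd c (\<alpha> r), snd d \<one>) (0, z d)) \<longlongrightarrow>
        dir_deriv ?rep (snd c (\<alpha> r), snd d \<one>) (0, z d)) (at r within ?S)"
      using T(6) r unfolding continuous_on_def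
      by (intro isCont_dir_deriv_tendsto[OF rep[OF r]] tendsto_Pair tendsto_const) blast
  qed
  then have "continuous_on (?S) (\<lambda>r. left_trans G A (\<alpha> r) \<one> z c)"
    by (rule continuous_on_eq) (simp add: lt)
  moreover have "continuous_on (?S) (\<lambda>r. velocity A {a..b} \<alpha> r c)"
    by (rule continuous_on_eq[OF T(5)]) (simp add: velocity_apply cr)
  ultimately have "continuous_on (?S)
      (\<lambda>r. velocity A {a..b} \<alpha> r c - left_trans G A (\<alpha> r) \<one> z c)"
    unfolding continuous_on_def by (intro ballI tendsto_diff) blast+
  then show "\<exists>c\<in>A. \<exists>T. open T \<and> t \<in> T \<and> (\<forall>r\<in>{a..b} \<inter> T. \<alpha> r \<in> fst c) \<and>
      continuous_on ({a..b} \<inter> T) (\<lambda>r. snd c (\<alpha> r)) \<and>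
      continuous_on ({a..b} \<inter> T) (\<lambda>r. velocity A {a..b} \<alpha> r c - left_trans G A (\<alpha> r) \<one> z c)"
    using T(1,2,3,6) by (intro bexI[OF _ cA] exI[of _ T] conjI) auto
qed

end

section \<open>The quotient metric\<close>

text \<open>The homogeneous space \<open>B\<close> of the Lie group \<open>G\<close>, with a base point \<open>p\<close> whose isotropy group is
  a Lie group with atlas \<open>AK\<close>, and a metric \<open>\<mu>\<close> on \<open>G\<close> that is invariant under right translations
  by the isotropy group.\<close>

locale homogeneous_space =
  fixes s :: enat and G :: "('g, 'x) monoid_scheme" (structure)
    and A :: "('g, 'e::lcs) chart set"
    and B :: "('m, 'f::lcs) chart set"
    and AK :: "('g, 'k::lcs) chart set"
    and \<pi> :: "'g \<Rightarrow> 'm \<Rightarrow> 'm"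
    and p :: 'm
    and \<mu> :: "'g \<Rightarrow> ('g, 'e) tangent \<Rightarrow> real"
  assumes lie: "lie_group s G A"
    and manifold_B: "manifold 1 B"
    and action: "transitive_action G (points B) \<pi>"
    and C1_action: "Ck_map 1 (product_atlas A B) B (\<lambda>(y, x). \<pi> y x)"
    and base_point: "p \<in> points B"
    and lifting: "path_lifting G A B \<pi> p"
    and lieK: "lie_group s (G\<lparr>carrier := stabilizer G \<pi> p\<rparr>) AK"
    and inclusion: "Ck_map s AK A (\<lambda>x. x)"
    and kernel: "lie_subalgebra G AK A =
      {v \<in> tangent_space A \<one>. differential A B (\<lambda>y. \<pi> y p) \<one> v = (\<lambda>_. 0)}"
    and evolutions: "has_evolutions s (G\<lparr>carrier := stabilizer G \<pi> p\<rparr>) AK"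
    and finsler: "finsler_metric A \<mu>"
    and invariant: "right_invariant G A (stabilizer G \<pi> p) \<mu>"
begin

abbreviation K :: "'g set" where "K \<equiv> stabilizer G \<pi> p"
abbreviation \<kk> :: "('g, 'e) tangent set" where "\<kk> \<equiv> lie_subalgebra G AK A"
abbreviation proj :: "'g \<Rightarrow> 'm" where "proj \<equiv> (\<lambda>y. \<pi> y p)"
abbreviation \<mu>M :: "'m \<Rightarrow> ('m, 'f) tangent \<Rightarrow> real" where "\<mu>M \<equiv> quotient_metric G A B \<pi> p \<kk> \<mu>"

interpretation G: group G by (rule lie_group_group[OF lie])
interpretation transitive_action G "points B" \<pi> by (rule action)

lemma manifold_G: "manifold 1 A" by (rule lie_group_manifold[OF lie])
lemma carrier_eq: "carrier G = points A" by (rule lie_group_carrier[OF lie])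

abbreviation dproj :: "'g \<Rightarrow> ('g, 'e) tangent \<Rightarrow> ('m, 'f) tangent" where
  "dproj \<equiv> differential A B proj"

lemma K_subgroup: "subgroup K G" using base_point by (rule stabilizer_subgroup)

lemma K_carrier: "u \<in> K \<Longrightarrow> u \<in> carrier G" and K_fix: "u \<in> K \<Longrightarrow> \<pi> u p = p"
  unfolding stabilizer_def by auto

lemma act_mult: "g \<in> carrier G \<Longrightarrow> h \<in> carrier G \<Longrightarrow> x \<in> points B \<Longrightarrow> \<pi> (g \<otimes> h) x = \<pi> g (\<pi> h x)"
  by (rule composition_rule)

lemma act_points: "g \<in> carrier G \<Longrightarrow> x \<in> points B \<Longrightarrow> \<pi> g x \<in> points B"
  by (rule element_image[OF _ _ refl])

lemma act_one: "x \<in> points B \<Longrightarrow> \<pi> \<one> x = x"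
  using fun_cong[OF id_eq_one, of x] by simp

lemma proj_mult_K: "g \<in> carrier G \<Longrightarrow> u \<in> K \<Longrightarrow> \<pi> (g \<otimes> u) p = \<pi> g p"
  using act_mult[of g u p] K_carrier K_fix base_point by simp

lemma proj_eq_K:
  assumes "g \<in> carrier G" "h \<in> carrier G" "\<pi> g p = \<pi> h p"
  obtains u where "u \<in> K" "h = g \<otimes> u"
proof
  have "\<pi> (inv g \<otimes> h) p = \<pi> (inv g) (\<pi> g p)" using assms act_mult base_point by simp
  also have "\<dots> = \<pi> (inv g \<otimes> g) p" using assms(1) base_point by (intro act_mult[symmetric]) simp_all
  also have "\<dots> = p" using assms(1) act_one base_point by simp
  finally show "inv g \<otimes> h \<in> K" using assms unfolding stabilizer_def by simp
  show "h = g \<otimes> (inv g \<otimes> h)" using assms by (simp add: G.m_assoc[symmetric])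
qed

lemma C1_proj: "Ck_map 1 A B proj"
  using C1_map_slice1[OF C1_action manifold_G manifold_B base_point] by simp

lemma C1_act: "g \<in> carrier G \<Longrightarrow> Ck_map 1 B B (\<pi> g)"
  using C1_map_slice2[OF C1_action manifold_G manifold_B] by (simp add: carrier_eq)

lemma differential_proj_left:
  assumes g: "g \<in> carrier G" and h: "h \<in> carrier G" and v: "v \<in> tangent_space A h"
  shows "dproj (g \<otimes> h) (left_trans G A g h v) =
    differential B B (\<pi> g) (\<pi> h p) (dproj h v)"
proof -
  have "dproj (g \<otimes> h) (left_trans G A g h v) =
      differential A B (\<lambda>x. \<pi> (g \<otimes> x) p) h v"
    by (rule differential_left_trans[OF lie C1_proj g h v])
  also have "\<dots> = differential A B (\<lambda>x. \<pi> g (\<pi> x p)) h v"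
    by (rule differential_cong[OF manifold_G]) (use g h base_point act_mult in \<open>simp_all add: carrier_eq\<close>)
  also have "\<dots> = differential B B (\<pi> g) (\<pi> h p) (dproj h v)"
    by (rule differential_compose[OF manifold_G manifold_B C1_proj C1_act[OF g] v]) (use h in \<open>simp add: carrier_eq\<close>)
  finally show ?thesis .
qed

lemma differential_proj_right:
  assumes g: "g \<in> carrier G" and u: "u \<in> K" and v: "v \<in> tangent_space A g"
  shows "dproj (g \<otimes> u) (right_trans G A u g v) = dproj g v"
proof -
  have "dproj (g \<otimes> u) (right_trans G A u g v) =
      differential A B (\<lambda>x. \<pi> (x \<otimes> u) p) g v"
    by (rule differential_right_trans[OF lie C1_proj K_carrier[OF u] g v])
  also have "\<dots> = dproj g v"
    by (rule differential_cong[OF manifold_G]) (use g u proj_mult_K in \<open>simp_all add: carrier_eq\<close>)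
  finally show ?thesis .
qed

lemma kk_tangent: "z \<in> \<kk> \<Longrightarrow> z \<in> tangent_space A \<one>"
  unfolding kernel by simp

lemma zero_kk: "(\<lambda>_. 0) \<in> \<kk>"
  unfolding kernel using zero_in_tangent_space[OF manifold_G] differential_zero[OF manifold_G C1_proj, of "\<one>"]
  by (simp add: carrier_eq[symmetric])

lemma left_kk_tangent: "g \<in> carrier G \<Longrightarrow> z \<in> \<kk> \<Longrightarrow> left_trans G A g \<one> z \<in> tangent_space A g"
  using left_trans_tangent[OF lie, of g "\<one>" z] kk_tangent by simp

text \<open>The vertical vectors at \<open>g\<close> are the left translates of the Lie algebra of the isotropy
  group.\<close>

lemma vertical_iff:
  assumes g: "g \<in> carrier G" and w: "w \<in> tangent_space A g"
  shows "dproj g w = (\<lambda>_. 0) \<longleftrightarrow> (\<exists>z\<in>\<kk>. w = left_trans G A g \<one> z)"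
proof
  assume "\<exists>z\<in>\<kk>. w = left_trans G A g \<one> z"
  then obtain z where z: "z \<in> \<kk>" "w = left_trans G A g \<one> z" by blast
  have "dproj g w = differential B B (\<pi> g) (\<pi> \<one> p) (dproj \<one> z)"
    using differential_proj_left[OF g G.one_closed kk_tangent[OF z(1)]] z(2) g by simp
  also have "dproj \<one> z = (\<lambda>_. 0)" using z(1) unfolding kernel by simp
  also have "differential B B (\<pi> g) (\<pi> \<one> p) (\<lambda>_. 0) = (\<lambda>_. 0)"
    by (rule differential_zero[OF manifold_B C1_act[OF g] act_points]) (use base_point in simp_all)
  finally show "dproj g w = (\<lambda>_. 0)" .
next
  assume w0: "dproj g w = (\<lambda>_. 0)"
  have ig: "inv g \<in> carrier G" using g by simp
  let ?z = "left_trans G A (inv g) g w"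
  have "?z \<in> tangent_space A \<one>" using left_trans_tangent[OF lie ig g w] g by simp
  moreover have "dproj \<one> ?z = (\<lambda>_. 0)"
    using differential_proj_left[OF ig g w] w0 g differential_zero[OF manifold_B C1_act[OF ig] act_points[OF g base_point]]
    by simp
  ultimately have "?z \<in> \<kk>" unfolding kernel by simp
  moreover have "left_trans G A g \<one> ?z = w"
    using left_trans_left_trans[OF lie g ig g w] left_trans_one[OF lie g w] g by simp
  ultimately show "\<exists>z\<in>\<kk>. w = left_trans G A g \<one> z" by metis
qed

text \<open>The values of the metric on the representatives at \<open>g\<close> of a tangent vector \<open>V\<close> of the
  homogeneous space. Their infimum is the quotient metric, because representatives differ by
  vertical vectors.\<close>

definition fibre_speeds :: "'g \<Rightarrow> ('m, 'f) tangent \<Rightarrow> real set" where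
  "fibre_speeds g V = {\<mu> g v |v. v \<in> tangent_space A g \<and> dproj g v = V}"

lemma shifted_eq_fibre_speeds:
  assumes g: "g \<in> carrier G" and g': "g' \<in> tangent_space A g"
  shows "{\<mu> g (\<lambda>c. g' c - left_trans G A g \<one> z c) |z. z \<in> \<kk>} =
    fibre_speeds g (dproj g g')" (is "?L = ?R")
proof
  have gA: "g \<in> points A" using g by (simp add: carrier_eq)
  show "?L \<subseteq> ?R"
  proof
    fix r assume "r \<in> ?L"
    then obtain z where z: "z \<in> \<kk>" "r = \<mu> g (\<lambda>c. g' c - left_trans G A g \<one> z c)" by blast
    let ?w = "left_trans G A g \<one> z"
    have w: "?w \<in> tangent_space A g" using g z(1) by (rule left_kk_tangent)
    have "dproj g ?w = (\<lambda>_. 0)" using vertical_iff[OF g w] z(1) by blast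
    then have "dproj g (\<lambda>c. g' c - ?w c) = dproj g g'"
      using differential_diff[OF manifold_G C1_proj gA g' w] by simp
    then show "r \<in> ?R" unfolding fibre_speeds_def using z(2) tangent_space_diff[OF manifold_G g' w] by blast
  qed
  show "?R \<subseteq> ?L"
  proof
    fix r assume "r \<in> ?R"
    then obtain v where v: "v \<in> tangent_space A g" "r = \<mu> g v"
      "dproj g v = dproj g g'" unfolding fibre_speeds_def by blast
    have w: "(\<lambda>c. g' c - v c) \<in> tangent_space A g" by (rule tangent_space_diff[OF manifold_G g' v(1)])
    have "dproj g (\<lambda>c. g' c - v c) = (\<lambda>_. 0)"
      using differential_diff[OF manifold_G C1_proj gA g' v(1)] v(3) by simp
    then obtain z where z: "z \<in> \<kk>" "(\<lambda>c. g' c - v c) = left_trans G A g \<one> z"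
      using vertical_iff[OF g w] by blast
    have "v c = g' c - left_trans G A g \<one> z c" for c
      unfolding z(2)[symmetric] by simp
    then have "v = (\<lambda>c. g' c - left_trans G A g \<one> z c)" by (rule ext)
    then show "r \<in> ?L" using z(1) v(2) by blast
  qed
qed

text \<open>Right invariance identifies the representatives at different points of a fibre.\<close>

lemma fibre_speeds_subset:
  assumes g: "g \<in> carrier G" and u: "u \<in> K"
  shows "fibre_speeds g V \<subseteq> fibre_speeds (g \<otimes> u) V"
proof
  fix r assume "r \<in> fibre_speeds g V"
  then obtain v where v: "v \<in> tangent_space A g" "dproj g v = V" "r = \<mu> g v"
    unfolding fibre_speeds_def by blast
  have "\<mu> (g \<otimes> u) (right_trans G A u g v) = r"
    using invariant g u v unfolding right_invariant_def by simp
  then show "r \<in> fibre_speeds (g \<otimes> u) V"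
    unfolding fibre_speeds_def
    using right_trans_tangent[OF lie K_carrier[OF u] g v(1)] differential_proj_right[OF g u v(1)] v(2) by blast
qed

lemma fibre_speeds_eq:
  assumes g: "g \<in> carrier G" and h: "h \<in> carrier G" and eq: "\<pi> g p = \<pi> h p"
  shows "fibre_speeds g V = fibre_speeds h V"
proof
  obtain u where u: "u \<in> K" "h = g \<otimes> u" using proj_eq_K[OF g h eq] .
  obtain u' where u': "u' \<in> K" "g = h \<otimes> u'" using proj_eq_K[OF h g eq[symmetric]] .
  show "fibre_speeds g V \<subseteq> fibre_speeds h V" using fibre_speeds_subset[OF g u(1)] unfolding u(2)[symmetric] .
  show "fibre_speeds h V \<subseteq> fibre_speeds g V" using fibre_speeds_subset[OF h u'(1)] unfolding u'(2)[symmetric] .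
qed

lemma quotient_metric_eq:
  assumes g: "g \<in> carrier G" and g': "g' \<in> tangent_space A g"
  shows "\<mu>M (\<pi> g p) (dproj g g') =
    Inf {\<mu> g (\<lambda>c. g' c - left_trans G A g \<one> z c) |z. z \<in> \<kk>}"
  unfolding quotient_metric_def
proof (rule the_equality)
  show "\<exists>ga\<in>carrier G. \<exists>ga'\<in>tangent_space A ga. \<pi> ga p = \<pi> g p \<and>
      dproj ga ga' = dproj g g' \<and>
      Inf {\<mu> g (\<lambda>c. g' c - left_trans G A g \<one> z c) |z. z \<in> \<kk>} =
      Inf {\<mu> ga (\<lambda>c. ga' c - left_trans G A ga \<one> z c) |z. z \<in> \<kk>}"
    by (intro bexI[OF _ g] bexI[OF _ g'] conjI refl)
next
  fix r assume "\<exists>h\<in>carrier G. \<exists>h'\<in>tangent_space A h. \<pi> h p = \<pi> g p \<and>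
      dproj h h' = dproj g g' \<and>
      r = Inf {\<mu> h (\<lambda>c. h' c - left_trans G A h \<one> z c) |z. z \<in> \<kk>}"
  then obtain h h' where h: "h \<in> carrier G" "h' \<in> tangent_space A h" "\<pi> h p = \<pi> g p"
    "dproj h h' = dproj g g'"
    "r = Inf {\<mu> h (\<lambda>c. h' c - left_trans G A h \<one> z c) |z. z \<in> \<kk>}" by blast
  show "r = Inf {\<mu> g (\<lambda>c. g' c - left_trans G A g \<one> z c) |z. z \<in> \<kk>}"
    unfolding h(5) shifted_eq_fibre_speeds[OF h(1,2)] shifted_eq_fibre_speeds[OF g g'] h(4) fibre_speeds_eq[OF h(1) g h(3)] ..
qed

section \<open>Projecting and modifying paths\<close>

text \<open>The value of the metric on the velocity of a path minus the vertical vector given by \<open>z\<close>.\<close>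

definition shifted_speed :: "real set \<Rightarrow> (real \<Rightarrow> 'g) \<Rightarrow> real \<Rightarrow> ('g, 'e) tangent \<Rightarrow> real" where
  "shifted_speed S \<alpha> t z = \<mu> (\<alpha> t) (\<lambda>c. velocity A S \<alpha> t c - left_trans G A (\<alpha> t) \<one> z c)"

lemma path_carrier: "Ck_path k A a b \<alpha> \<Longrightarrow> t \<in> {a..b} \<Longrightarrow> \<alpha> t \<in> carrier G"
  unfolding carrier_eq by (rule Ck_path_points)

lemma shifted_tangent:
  assumes "Ck_path 1 A a b \<alpha>" "t \<in> {a..b}" "z \<in> \<kk>"
  shows "(\<lambda>c. velocity A {a..b} \<alpha> t c - left_trans G A (\<alpha> t) \<one> z c) \<in> tangent_space A (\<alpha> t)"
  using assms
  by (intro tangent_space_diff[OF manifold_G] velocity_in_tangent_space[OF manifold_G] left_kk_tangent path_carrier)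

lemma shifted_speed_nonneg:
  assumes "Ck_path 1 A a b \<alpha>" "t \<in> {a..b}" "z \<in> \<kk>"
  shows "0 \<le> shifted_speed {a..b} \<alpha> t z"
  using finsler shifted_tangent[OF assms] Ck_path_points[OF assms(1,2)]
  unfolding finsler_metric_def shifted_speed_def by blast

lemma shifted_speed_zero:
  assumes "Ck_path 1 A a b \<alpha>" "t \<in> {a..b}"
  shows "shifted_speed {a..b} \<alpha> t (\<lambda>_. 0) = \<mu> (\<alpha> t) (velocity A {a..b} \<alpha> t)"
  unfolding shifted_speed_def
  using left_trans_zero[OF lie path_carrier[OF assms] G.one_closed] by simp

lemma path_length_proj:
  assumes \<alpha>: "Ck_path 1 A a b \<alpha>"
  shows "path_length B \<mu>M a b (\<lambda>t. \<pi> (\<alpha> t) p) =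
    (\<integral>\<^sup>+t\<in>{a..b}. ennreal (Inf (shifted_speed {a..b} \<alpha> t ` \<kk>)) \<partial>lborel)"
proof (rule path_length_eqI)
  fix t assume t: "t \<in> {a..b}"
  have "{\<mu> (\<alpha> t) (\<lambda>c. velocity A {a..b} \<alpha> t c - left_trans G A (\<alpha> t) \<one> z c) |z. z \<in> \<kk>} =
      shifted_speed {a..b} \<alpha> t ` \<kk>"
    unfolding shifted_speed_def by blast
  then show "\<mu>M (\<pi> (\<alpha> t) p) (velocity B {a..b} (\<lambda>t. \<pi> (\<alpha> t) p) t) = Inf (shifted_speed {a..b} \<alpha> t ` \<kk>)"
    unfolding velocity_map[OF C1_proj manifold_G \<alpha> t]
      quotient_metric_eq[OF path_carrier[OF \<alpha> t] velocity_in_tangent_space[OF manifold_G \<alpha> t]] by simp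
qed

lemma path_length_proj_le_C1:
  assumes \<alpha>: "Ck_path 1 A a b \<alpha>"
  shows "path_length B \<mu>M a b (\<lambda>t. \<pi> (\<alpha> t) p) \<le> path_length A \<mu> a b \<alpha>"
  unfolding path_length_proj[OF \<alpha>] path_length_def[of A \<mu> a b \<alpha>]
proof (rule nn_integral_mono)
  fix t
  show "ennreal (Inf (shifted_speed {a..b} \<alpha> t ` \<kk>)) * indicator {a..b} t \<le>
      ennreal (\<mu> (\<alpha> t) (velocity A {a..b} \<alpha> t)) * indicator {a..b} t"
  proof (cases "t \<in> {a..b}")
    case True
    have "Inf (shifted_speed {a..b} \<alpha> t ` \<kk>) \<le> shifted_speed {a..b} \<alpha> t (\<lambda>_. 0)"
      using zero_kk shifted_speed_nonneg[OF \<alpha> True] by (intro cINF_lower bdd_belowI2[of _ 0])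
    then show ?thesis using True by (simp add: shifted_speed_zero[OF \<alpha> True] ennreal_leI)
  qed simp
qed

lemma path_length_proj_le:
  assumes "piecewise_Ck_path 1 A a b \<alpha>"
  shows "path_length B \<mu>M a b (\<lambda>t. \<pi> (\<alpha> t) p) \<le> path_length A \<mu> a b \<alpha>"
  using assms
proof (induction rule: piecewise_induct)
  case (single a b)
  then show ?case by (rule path_length_proj_le_C1)
next
  case (join a b c)
  then show ?case
    using path_length_join[of a b c A \<mu> \<alpha>] path_length_join[of a b c B \<mu>M "\<lambda>t. \<pi> (\<alpha> t) p"]
    by (simp add: add_mono)
qed

lemma path_length_right:
  assumes u: "u \<in> K" and \<alpha>: "piecewise_Ck_path 1 A a b \<alpha>"
  shows "path_length A \<mu> a b (\<lambda>t. \<alpha> t \<otimes> u) = path_length A \<mu> a b \<alpha>"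
  using \<alpha>
proof (induction rule: piecewise_induct)
  case (single a b)
  note \<alpha> = single
  have "\<mu> (\<alpha> t \<otimes> u) (velocity A {a..b} (\<lambda>t. \<alpha> t \<otimes> u) t) = \<mu> (\<alpha> t) (velocity A {a..b} \<alpha> t)"
    if t: "t \<in> {a..b}" for t
    using velocity_map[OF C1_map_right[OF lie K_carrier[OF u]] manifold_G \<alpha> t] invariant u path_carrier[OF \<alpha> t]
      velocity_in_tangent_space[OF manifold_G \<alpha> t]
    unfolding right_invariant_def right_trans_def by simp
  from path_length_eqI[of a b \<mu> "\<lambda>t. \<alpha> t \<otimes> u" A, OF this]
  show ?case unfolding path_length_def[of A \<mu> a b \<alpha>] .
next
  case (join a b c)
  then show ?case
    using path_length_join[of a b c A \<mu> \<alpha>] path_length_join[of a b c A \<mu> "\<lambda>t. \<alpha> t \<otimes> u"] by simp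
qed

abbreviation GK :: "('g, 'x) monoid_scheme" where "GK \<equiv> G\<lparr>carrier := K\<rparr>"

lemma manifold_AK: "manifold 1 AK" by (rule lie_group_manifold[OF lieK])
lemma K_points: "K = points AK" using lie_group_carrier[OF lieK] by simp
lemma C1_inclusion: "Ck_map 1 AK A (\<lambda>x. x)"
  using inclusion lie_group_class[OF lie] by (rule Ck_map_mono)

text \<open>A path \<open>u\<close> in the isotropy group with a prescribed constant right logarithmic derivative. The
  inclusion into \<open>G\<close> carries the logarithmic derivative in the isotropy group to that in \<open>G\<close>.\<close>

lemma evolution:
  assumes z: "z \<in> \<kk>"
  obtains u where "Ck_path 1 A 0 1 u" "u 0 = \<one>" "\<And>t. t \<in> {0..1} \<Longrightarrow> u t \<in> K"
    "\<And>t. t \<in> {0..1} \<Longrightarrow> velocity A {0..1} u t = right_trans G A (u t) \<one> (\<lambda>c. r *\<^sub>R z c)"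
proof -
  obtain \<zeta> where \<zeta>: "\<zeta> \<in> tangent_space AK \<one>" "z = differential AK A (\<lambda>x. x) \<one> \<zeta>"
    using z unfolding lie_subalgebra_def by blast
  have oneK: "\<one> \<in> points AK" using subgroup.one_closed[OF K_subgroup] unfolding K_points .
  let ?\<xi> = "\<lambda>c. r *\<^sub>R \<zeta> c"
  have \<xi>: "?\<xi> \<in> tangent_space AK \<one>" by (rule tangent_space_scale[OF manifold_AK \<zeta>(1)])
  have push: "differential AK A (\<lambda>x. x) \<one> ?\<xi> = (\<lambda>c. r *\<^sub>R z c)"
    unfolding \<zeta>(2) by (rule differential_scale[OF manifold_AK C1_inclusion oneK \<zeta>(1)])
  have "\<exists>\<alpha>. Ck_path s AK 0 1 \<alpha> \<and> \<alpha> 0 = \<one>\<^bsub>GK\<^esub> \<and>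
      (\<forall>t\<in>{0..1}. right_trans GK AK (inv\<^bsub>GK\<^esub> (\<alpha> t)) (\<alpha> t) (velocity AK {0..1} \<alpha> t) = ?\<xi>)"
    using evolutions[unfolded has_evolutions_def, rule_format, of "\<lambda>_. ?\<xi>"] \<xi>
    by (simp add: Ck_curve_const)
  then obtain u where us: "Ck_path s AK 0 1 u" and u0: "u 0 = \<one>"
    and ev: "\<And>t. t \<in> {0..1} \<Longrightarrow> right_trans GK AK (inv\<^bsub>GK\<^esub> (u t)) (u t) (velocity AK {0..1} u t) = ?\<xi>"
    by auto
  have u: "Ck_path 1 AK 0 1 u" using us lie_group_class[OF lie] by (rule Ck_path_mono)
  have uA: "Ck_path 1 A 0 1 u" using Ck_path_1_map[OF C1_inclusion manifold_AK manifold_G u] .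
  have uK: "u t \<in> K" if "t \<in> {0..1}" for t using Ck_path_points[OF u that] unfolding K_points .
  have "velocity A {0..1} u t = right_trans G A (u t) \<one> (\<lambda>c. r *\<^sub>R z c)" if t: "t \<in> {0..1}" for t
  proof -
    let ?w = "velocity AK {0..1} u t" and ?i = "inv (u t)"
    have ut: "u t \<in> carrier G" using uK[OF t] by (rule K_carrier)
    have it: "?i \<in> K" using subgroup.m_inv_closed[OF K_subgroup uK[OF t]] .
    have iG: "?i \<in> carrier G" using it by (rule K_carrier)
    have inv: "inv\<^bsub>GK\<^esub> (u t) = ?i" using G.m_inv_consistent[OF K_subgroup uK[OF t]] .
    have w: "?w \<in> tangent_space AK (u t)" by (rule velocity_in_tangent_space[OF manifold_AK u t])
    have vA: "velocity A {0..1} u t = differential AK A (\<lambda>x. x) (u t) ?w"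
      by (rule velocity_map[OF C1_inclusion manifold_AK u t])
    have "(\<lambda>c. r *\<^sub>R z c) = differential AK A (\<lambda>x. x) \<one> (right_trans GK AK ?i (u t) ?w)"
      using push ev[OF t] unfolding inv by simp
    also have "\<dots> = differential AK A (\<lambda>x. x) (u t \<otimes>\<^bsub>GK\<^esub> ?i) (right_trans GK AK ?i (u t) ?w)"
      using ut by simp
    also have "\<dots> = differential AK A (\<lambda>x. x \<otimes>\<^bsub>GK\<^esub> ?i) (u t) ?w"
      by (rule differential_right_trans[OF lieK C1_inclusion _ _ w]) (use it uK[OF t] in simp_all)
    also have "\<dots> = differential AK A (\<lambda>x. x \<otimes> ?i) (u t) ?w" by simp
    also have "\<dots> = right_trans G A ?i (u t) (velocity A {0..1} u t)"
      unfolding right_trans_def vA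
      by (rule differential_compose[OF manifold_AK manifold_G C1_inclusion C1_map_right[OF lie iG] w])
        (use Ck_path_points[OF u t] in simp)
    finally have log: "(\<lambda>c. r *\<^sub>R z c) = right_trans G A ?i (u t) (velocity A {0..1} u t)" .
    have v: "velocity A {0..1} u t \<in> tangent_space A (u t)" by (rule velocity_in_tangent_space[OF manifold_G uA t])
    have "right_trans G A (u t) \<one> (\<lambda>c. r *\<^sub>R z c) =
        right_trans G A (u t) (u t \<otimes> ?i) (right_trans G A ?i (u t) (velocity A {0..1} u t))"
      unfolding log using ut by simp
    also have "\<dots> = right_trans G A (?i \<otimes> u t) (u t) (velocity A {0..1} u t)"
      by (rule right_trans_right_trans[OF lie ut iG ut v])
    also have "\<dots> = velocity A {0..1} u t" using ut right_trans_one[OF lie ut v] by simp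
    finally show ?thesis by simp
  qed
  then show thesis using that[OF uA u0] uK by blast
qed

text \<open>Multiplication of a path from the right by a suitable path in the isotropy group keeps the
  projection, subtracts a prescribed vertical vector from the velocity and translates the result
  from the right, which does not affect the speed.\<close>

lemma modify_path:
  assumes \<alpha>: "Ck_path 1 A a b \<alpha>" and z: "z \<in> \<kk>"
  obtains \<beta> where "Ck_path 1 A a b \<beta>" "\<beta> a = \<alpha> a" "\<And>t. t \<in> {a..b} \<Longrightarrow> \<exists>u\<in>K. \<beta> t = \<alpha> t \<otimes> u"
    "path_length A \<mu> a b \<beta> = (\<integral>\<^sup>+t\<in>{a..b}. ennreal (shifted_speed {a..b} \<alpha> t z) \<partial>lborel)"
proof -
  have ab: "a < b" using \<alpha> by (rule Ck_path_less)
  \<comment> \<open>The factor \<open>b - a\<close> is cancelled by the rescaling of \<open>{0..1}\<close> to \<open>{a..b}\<close>.\<close>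
  obtain u where u: "Ck_path 1 A 0 1 u" "u 0 = \<one>" "\<And>t. t \<in> {0..1} \<Longrightarrow> u t \<in> K"
    "\<And>t. t \<in> {0..1} \<Longrightarrow> velocity A {0..1} u t = right_trans G A (u t) \<one> (\<lambda>c. (- (b - a)) *\<^sub>R z c)"
    using evolution[OF z, of "- (b - a)"] by blast
  define w where "w t = u ((t - a) / (b - a))" for t
  have w: "Ck_path 1 A a b w" unfolding w_def by (rule Ck_path_1_rescale[OF manifold_G ab u(1)])
  have wK: "w t \<in> K" if "t \<in> {a..b}" for t unfolding w_def using u(3) rescale_mem[OF ab that] by blast
  have zt: "z \<in> tangent_space A \<one>" using z by (rule kk_tangent)
  have oneA: "\<one> \<in> points A" using G.one_closed unfolding carrier_eq .
  have vel_w: "velocity A {a..b} w t = (\<lambda>c. (- 1) *\<^sub>R right_trans G A (w t) \<one> z c)" if t: "t \<in> {a..b}" for t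
  proof -
    have "velocity A {a..b} w t =
        (\<lambda>c. (1 / (b - a)) *\<^sub>R right_trans G A (w t) \<one> (\<lambda>c. (- (b - a)) *\<^sub>R z c) c)"
      unfolding w_def velocity_rescale[OF ab u(1) t] u(4)[OF rescale_mem[OF ab t]] ..
    also have "right_trans G A (w t) \<one> (\<lambda>c. (- (b - a)) *\<^sub>R z c) =
        (\<lambda>c. (- (b - a)) *\<^sub>R right_trans G A (w t) \<one> z c)"
      unfolding right_trans_def
      by (rule differential_scale[OF manifold_G C1_map_right[OF lie K_carrier[OF wK[OF t]]] oneA zt])
    also have "(\<lambda>c. (1 / (b - a)) *\<^sub>R (- (b - a)) *\<^sub>R right_trans G A (w t) \<one> z c) =
        (\<lambda>c. (- 1) *\<^sub>R right_trans G A (w t) \<one> z c)"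
    proof -
      have "(1 / (b - a)) * (- (b - a)) = - 1" using ab by (simp add: divide_simps)
      then show ?thesis by (simp only: scaleR_scaleR)
    qed
    finally show ?thesis .
  qed
  define \<beta> where "\<beta> t = \<alpha> t \<otimes> w t" for t
  have \<beta>: "Ck_path 1 A a b \<beta>"
    using Ck_path_1_product[OF C1_map_mult[OF lie] manifold_G manifold_G manifold_G \<alpha> w] unfolding \<beta>_def by simp
  have vel: "velocity A {a..b} \<beta> t = right_trans G A (w t) (\<alpha> t)
      (\<lambda>c. velocity A {a..b} \<alpha> t c - left_trans G A (\<alpha> t) \<one> z c)" if t: "t \<in> {a..b}" for t
  proof -
    let ?v = "velocity A {a..b} \<alpha> t"
    have g: "\<alpha> t \<in> carrier G" using path_carrier[OF \<alpha> t] .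
    have k: "w t \<in> carrier G" using wK[OF t] by (rule K_carrier)
    have kA: "w t \<in> points A" using k unfolding carrier_eq .
    have v: "?v \<in> tangent_space A (\<alpha> t)" by (rule velocity_in_tangent_space[OF manifold_G \<alpha> t])
    have rz: "right_trans G A (w t) \<one> z \<in> tangent_space A (w t)"
      using right_trans_tangent[OF lie k G.one_closed zt] k by simp
    have "velocity A {a..b} \<beta> t = (\<lambda>e. right_trans G A (w t) (\<alpha> t) ?v e +
        left_trans G A (\<alpha> t) (w t) (velocity A {a..b} w t) e)"
      using velocity_product[OF C1_map_mult[OF lie] manifold_G manifold_G manifold_G \<alpha> w t]
      unfolding \<beta>_def right_trans_def left_trans_def by simp
    also have "left_trans G A (\<alpha> t) (w t) (velocity A {a..b} w t) =
        (\<lambda>e. (- 1) *\<^sub>R left_trans G A (\<alpha> t) (w t) (right_trans G A (w t) \<one> z) e)"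
      unfolding vel_w[OF t] left_trans_def
      by (rule differential_scale[OF manifold_G C1_map_left[OF lie g] kA rz])
    also have "left_trans G A (\<alpha> t) (w t) (right_trans G A (w t) \<one> z) =
        right_trans G A (w t) (\<alpha> t) (left_trans G A (\<alpha> t) \<one> z)"
      using left_right_trans[OF lie g k G.one_closed zt] g k by simp
    finally show ?thesis
      unfolding right_trans_diff[OF lie k g v left_kk_tangent[OF g z]] by simp
  qed
  have "\<mu> (\<beta> t) (velocity A {a..b} \<beta> t) = shifted_speed {a..b} \<alpha> t z" if t: "t \<in> {a..b}" for t
    using invariant wK[OF t] path_carrier[OF \<alpha> t] shifted_tangent[OF \<alpha> t z]
    unfolding vel[OF t] \<beta>_def shifted_speed_def right_invariant_def by blast
  from path_length_eqI[of a b \<mu> \<beta> A, OF this]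
  have len: "path_length A \<mu> a b \<beta> = (\<integral>\<^sup>+t\<in>{a..b}. ennreal (shifted_speed {a..b} \<alpha> t z) \<partial>lborel)" .
  have "\<beta> a = \<alpha> a" unfolding \<beta>_def w_def using u(2) path_carrier[OF \<alpha>, of a] ab by simp
  moreover have "\<exists>u\<in>K. \<beta> t = \<alpha> t \<otimes> u" if "t \<in> {a..b}" for t
    using wK[OF that] unfolding \<beta>_def by blast
  ultimately show thesis using that[OF \<beta> _ _ len] by blast
qed

lemma piecewise_carrier: "piecewise_Ck_path k A a b \<alpha> \<Longrightarrow> t \<in> {a..b} \<Longrightarrow> \<alpha> t \<in> carrier G"
  unfolding carrier_eq by (rule piecewise_points)

text \<open>A path from \<open>\<alpha> x\<close> to the coset of \<open>\<alpha> y\<close> of length at most \<open>l\<close>.\<close>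

definition coset_path :: "real \<Rightarrow> real \<Rightarrow> (real \<Rightarrow> 'g) \<Rightarrow> ennreal \<Rightarrow> bool" where
  "coset_path x y \<alpha> l \<longleftrightarrow> (\<exists>\<beta> k. piecewise_Ck_path 1 A x y \<beta> \<and> \<beta> x = \<alpha> x \<and> k \<in> K \<and>
     \<beta> y = \<alpha> y \<otimes> k \<and> path_length A \<mu> x y \<beta> \<le> l)"

lemma coset_pathE:
  assumes "coset_path x y \<alpha> l"
  obtains \<beta> k where "piecewise_Ck_path 1 A x y \<beta>" "\<beta> x = \<alpha> x" "k \<in> K" "\<beta> y = \<alpha> y \<otimes> k"
    "path_length A \<mu> x y \<beta> \<le> l"
  using assms unfolding coset_path_def by blast

text \<open>The second of two such paths is translated from the right to the end point of the first one.\<close>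

lemma coset_path_join:
  assumes \<alpha>: "\<alpha> z \<in> carrier G" and 1: "coset_path x y \<alpha> l1" and 2: "coset_path y z \<alpha> l2"
  shows "coset_path x z \<alpha> (l1 + l2)"
proof -
  obtain \<beta>1 k1 where \<beta>1: "piecewise_Ck_path 1 A x y \<beta>1" "\<beta>1 x = \<alpha> x" "k1 \<in> K" "\<beta>1 y = \<alpha> y \<otimes> k1"
    "path_length A \<mu> x y \<beta>1 \<le> l1" using 1 by (rule coset_pathE)
  obtain \<beta>2 k2 where \<beta>2: "piecewise_Ck_path 1 A y z \<beta>2" "\<beta>2 y = \<alpha> y" "k2 \<in> K" "\<beta>2 z = \<alpha> z \<otimes> k2"
    "path_length A \<mu> y z \<beta>2 \<le> l2" using 2 by (rule coset_pathE)
  have xyz: "x < y" "y < z" using \<beta>1(1) \<beta>2(1) by (auto dest: piecewise_less)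
  define \<beta> where "\<beta> t = (if t \<le> y then \<beta>1 t else \<beta>2 t \<otimes> k1)" for t
  have eq1: "\<beta> t = \<beta>1 t" if "t \<in> {x..y}" for t using that by (simp add: \<beta>_def)
  have eq2: "\<beta> t = \<beta>2 t \<otimes> k1" if "t \<in> {y..z}" for t
    using that \<beta>1(4) \<beta>2(2) by (cases "t = y") (simp_all add: \<beta>_def)
  have p2: "piecewise_Ck_path 1 A y z (\<lambda>t. \<beta>2 t \<otimes> k1)"
    by (rule piecewise_map[OF C1_map_right[OF lie K_carrier[OF \<beta>1(3)]] manifold_G manifold_G \<beta>2(1)])
  have "piecewise_Ck_path 1 A x y \<beta>" "piecewise_Ck_path 1 A y z \<beta>"
    using piecewise_cong[OF manifold_G \<beta>1(1)] piecewise_cong[OF manifold_G p2] eq1 eq2 by blast+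
  then have pw: "piecewise_Ck_path 1 A x z \<beta>" by (rule piecewise_join)
  have "path_length A \<mu> x z \<beta> = path_length A \<mu> x y \<beta> + path_length A \<mu> y z \<beta>"
    using xyz by (intro path_length_join) simp_all
  also have "path_length A \<mu> x y \<beta> = path_length A \<mu> x y \<beta>1" by (rule path_length_cong) (rule eq1)
  also have "path_length A \<mu> y z \<beta> = path_length A \<mu> y z (\<lambda>t. \<beta>2 t \<otimes> k1)"
    by (rule path_length_cong) (rule eq2)
  also have "\<dots> = path_length A \<mu> y z \<beta>2" by (rule path_length_right[OF \<beta>1(3) \<beta>2(1)])
  finally have len: "path_length A \<mu> x z \<beta> \<le> l1 + l2" using add_mono[OF \<beta>1(5) \<beta>2(5)] by simp
  have k: "k2 \<otimes> k1 \<in> K" using subgroup.m_closed[OF K_subgroup \<beta>2(3) \<beta>1(3)] .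
  have "\<beta> z = \<alpha> z \<otimes> (k2 \<otimes> k1)"
    using eq2[of z] \<beta>2(4) xyz \<alpha> K_carrier[OF \<beta>1(3)] K_carrier[OF \<beta>2(3)]
    by (simp add: G.m_assoc)
  moreover have "\<beta> x = \<alpha> x" using eq1[of x] \<beta>1(2) xyz by simp
  ultimately show ?thesis unfolding coset_path_def using pw k len by blast
qed

text \<open>If a continuous function \<open>m\<close> is at every parameter one of the shifted speeds, then near each
  parameter a fixed vertical shift has speed below \<open>m + \<epsilon>\<close>; subdivision reduces the claim to short
  intervals.\<close>

lemma lift_below_continuous:
  assumes \<alpha>: "Ck_path 1 A c d \<alpha>" and \<epsilon>: "0 < \<epsilon>"
    and m: "continuous_on {c..d} m" "\<And>t. t \<in> {c..d} \<Longrightarrow> \<exists>z\<in>\<kk>. shifted_speed {c..d} \<alpha> t z = m t"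
  shows "coset_path c d \<alpha> (\<integral>\<^sup>+t\<in>{c..d}. ennreal (m t + \<epsilon>) \<partial>lborel)"
proof -
  let ?Q = "\<lambda>x y. coset_path x y \<alpha> (\<integral>\<^sup>+t\<in>{x..y}. ennreal (m t + \<epsilon>) \<partial>lborel)"
  let ?P = "\<lambda>x y. c \<le> x \<and> x < y \<and> y \<le> d \<longrightarrow> ?Q x y"
  have cd: "c < d" using \<alpha> by (rule Ck_path_less)
  have "?P c d"
  proof (rule Bolzano[of c d ?P])
    show "c \<le> d" using cd by simp
  next
    fix x y z assume P: "?P x y" "?P y z" and xyz: "x \<le> y" "y \<le> z"
    show "?P x z"
    proof
      assume xz: "c \<le> x \<and> x < z \<and> z \<le> d"
      consider "x = y" | "y = z" | "x < y" "y < z" using xyz by linarith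
      then show "?Q x z"
      proof cases
        case 1
        then show ?thesis using P(2) xz by simp
      next
        case 2
        then show ?thesis using P(1) xz by simp
      next
        case 3
        have "\<alpha> z \<in> carrier G" using path_carrier[OF \<alpha>, of z] xz cd by simp
        then show ?thesis
          unfolding nn_integral_Icc_split[OF xyz] by (rule coset_path_join) (use P xz 3 in simp_all)
      qed
    qed
  next
    fix x assume x: "c \<le> x" "x \<le> d"
    then obtain z where z: "z \<in> \<kk>" "shifted_speed {c..d} \<alpha> x z = m x" using m(2)[of x] by auto
    have "continuous_on {c..d} (\<lambda>t. shifted_speed {c..d} \<alpha> t z)"
      unfolding shifted_speed_def
      by (rule continuous_on_shifted_speed[OF lie finsler \<alpha> kk_tangent[OF z(1)]])
    then have "continuous_on {c..d} (\<lambda>t. shifted_speed {c..d} \<alpha> t z - m t)"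
      using m(1) by (rule continuous_on_diff)
    then obtain \<delta> where \<delta>: "\<delta> > 0" "\<And>t. t \<in> {c..d} \<Longrightarrow> dist t x < \<delta> \<Longrightarrow>
        dist (shifted_speed {c..d} \<alpha> t z - m t) (shifted_speed {c..d} \<alpha> x z - m x) < \<epsilon>"
      using x \<epsilon> unfolding continuous_on_iff by (metis atLeastAtMost_iff)
    have "?P u v" if uv: "u \<le> x" "x \<le> v" "v - u < \<delta>" for u v
    proof
      assume cuvd: "c \<le> u \<and> u < v \<and> v \<le> d"
      have \<alpha>': "Ck_path 1 A u v \<alpha>" using cuvd by (intro Ck_path_1_subinterval[OF manifold_G \<alpha>]) auto
      obtain \<beta> where \<beta>: "Ck_path 1 A u v \<beta>" "\<beta> u = \<alpha> u" "\<And>t. t \<in> {u..v} \<Longrightarrow> \<exists>k\<in>K. \<beta> t = \<alpha> t \<otimes> k"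
        "path_length A \<mu> u v \<beta> = (\<integral>\<^sup>+t\<in>{u..v}. ennreal (shifted_speed {u..v} \<alpha> t z) \<partial>lborel)"
        using modify_path[OF \<alpha>' z(1)] by blast
      obtain k where k: "k \<in> K" "\<beta> v = \<alpha> v \<otimes> k" using \<beta>(3)[of v] cuvd by auto
      have "shifted_speed {u..v} \<alpha> t z \<le> m t + \<epsilon>" if t: "t \<in> {u..v}" for t
      proof -
        have "velocity A {u..v} \<alpha> t = velocity A {c..d} \<alpha> t"
          using cuvd t by (intro velocity_subinterval[OF \<alpha>]) auto
        then have "shifted_speed {u..v} \<alpha> t z = shifted_speed {c..d} \<alpha> t z"
          unfolding shifted_speed_def by simp
        moreover have "dist t x < \<delta>" using t uv by (auto simp: dist_real_def)
        ultimately show ?thesis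
          using \<delta>(2)[of t] z(2) t cuvd by (simp add: dist_real_def)
      qed
      then have "path_length A \<mu> u v \<beta> \<le> (\<integral>\<^sup>+t\<in>{u..v}. ennreal (m t + \<epsilon>) \<partial>lborel)"
        unfolding \<beta>(4) by (intro nn_integral_mono) (auto simp: indicator_def intro: ennreal_leI)
      then show "?Q u v" unfolding coset_path_def using piecewise_single[OF \<beta>(1)] \<beta>(2) k by blast
    qed
    then show "\<exists>\<delta>>0. \<forall>u v. u \<le> x \<and> x \<le> v \<and> v - u < \<delta> \<longrightarrow> ?P u v"
      using \<delta>(1) by blast
  qed
  then show ?thesis using cd by simp
qed

lemma lift_approx_C1:
  assumes \<alpha>: "Ck_path 1 A c d \<alpha>" and \<epsilon>: "0 < \<epsilon>"
  shows "coset_path c d \<alpha> (path_length B \<mu>M c d (\<lambda>t. \<pi> (\<alpha> t) p) + ennreal \<epsilon>)"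
proof -
  have cd: "c < d" using \<alpha> by (rule Ck_path_less)
  have cont: "continuous_on {c..d} (\<lambda>t. shifted_speed {c..d} \<alpha> t z)" if "z \<in> \<kk>" for z
    unfolding shifted_speed_def
    by (rule continuous_on_shifted_speed[OF lie finsler \<alpha> kk_tangent[OF that]])
  have ne: "\<kk> \<noteq> {}" using zero_kk by blast
  have half: "0 < \<epsilon> / 2" using \<epsilon> by simp
  obtain m where m: "continuous_on {c..d} m" "\<And>t. t \<in> {c..d} \<Longrightarrow> \<exists>z\<in>\<kk>. shifted_speed {c..d} \<alpha> t z = m t"
    "(\<integral>\<^sup>+t\<in>{c..d}. ennreal (m t) \<partial>lborel) \<le>
     (\<integral>\<^sup>+t\<in>{c..d}. ennreal (Inf (shifted_speed {c..d} \<alpha> t ` \<kk>)) \<partial>lborel) + ennreal (\<epsilon> / 2)"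
    by (rule integral_Inf_approx[where F = "shifted_speed {c..d} \<alpha>" and Z = \<kk>,
          OF less_imp_le[OF cd] ne half])
      (erule cont, erule (1) shifted_speed_nonneg[OF \<alpha>], rule that)
  have m0: "0 \<le> m t" if "t \<in> {c..d}" for t using m(2)[OF that] shifted_speed_nonneg[OF \<alpha> that] by metis
  define \<delta> where "\<delta> = \<epsilon> / 2 / (d - c)"
  have "d - c \<noteq> 0" using cd by simp
  then have \<delta>: "0 < \<delta>" "\<delta> * (d - c) = \<epsilon> / 2"
    using \<epsilon> cd nonzero_divide_eq_eq[of "d - c" "\<epsilon> / 2" \<delta>] by (simp_all add: \<delta>_def)
  note meas = measurable_ennreal_Icc[OF m(1)]
  have "(\<integral>\<^sup>+t\<in>{c..d}. ennreal (m t + \<delta>) \<partial>lborel) =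
      (\<integral>\<^sup>+t. ennreal (m t) * indicator {c..d} t + ennreal \<delta> * indicator {c..d} t \<partial>lborel)"
    using m0 \<delta>(1) by (intro nn_integral_cong) (auto simp: indicator_def)
  also have "\<dots> = (\<integral>\<^sup>+t\<in>{c..d}. ennreal (m t) \<partial>lborel) + (\<integral>\<^sup>+t\<in>{c..d}. ennreal \<delta> \<partial>lborel)"
    using meas by (intro nn_integral_add) auto
  also have "(\<integral>\<^sup>+t\<in>{c..d}. ennreal \<delta> \<partial>lborel) = ennreal (\<epsilon> / 2)"
    unfolding \<delta>(2)[symmetric] using cd \<delta>(1) by (simp add: nn_integral_cmult_indicator ennreal_mult)
  also have "(\<integral>\<^sup>+t\<in>{c..d}. ennreal (m t) \<partial>lborel) + ennreal (\<epsilon> / 2) \<le>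
      (path_length B \<mu>M c d (\<lambda>t. \<pi> (\<alpha> t) p) + ennreal (\<epsilon> / 2)) + ennreal (\<epsilon> / 2)"
    unfolding path_length_proj[OF \<alpha>] by (rule add_right_mono[OF m(3)])
  also have "\<dots> = path_length B \<mu>M c d (\<lambda>t. \<pi> (\<alpha> t) p) + ennreal \<epsilon>"
    using half ennreal_plus[of "\<epsilon> / 2" "\<epsilon> / 2"] by (simp add: add.assoc)
  finally have "(\<integral>\<^sup>+t\<in>{c..d}. ennreal (m t + \<delta>) \<partial>lborel) \<le> path_length B \<mu>M c d (\<lambda>t. \<pi> (\<alpha> t) p) + ennreal \<epsilon>" .
  then show ?thesis
    using lift_below_continuous[OF \<alpha> \<delta>(1) m(1,2)] order.trans unfolding coset_path_def by blast
qed

lemma lift_approx: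
  assumes "piecewise_Ck_path 1 A a b \<alpha>"
  shows "\<forall>\<epsilon>>0. coset_path a b \<alpha> (path_length B \<mu>M a b (\<lambda>t. \<pi> (\<alpha> t) p) + ennreal \<epsilon>)"
  using assms
proof (induction rule: piecewise_induct)
  case (single a b)
  then show ?case using lift_approx_C1 by blast
next
  case (join a b c)
  show ?case
  proof (intro allI impI)
    fix \<epsilon> :: real assume "0 < \<epsilon>"
    then have half: "0 < \<epsilon> / 2" by simp
    let ?\<gamma> = "\<lambda>t. \<pi> (\<alpha> t) p"
    have "\<alpha> c \<in> carrier G" using path_carrier[OF join(4), of c] join(2) by simp
    from coset_path_join[OF this join(5)[rule_format, OF half] join(6)[rule_format, OF half]]
    have "coset_path a c \<alpha> ((path_length B \<mu>M a b ?\<gamma> + ennreal (\<epsilon> / 2)) + (path_length B \<mu>M b c ?\<gamma> + ennreal (\<epsilon> / 2)))" .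
    also have "(path_length B \<mu>M a b ?\<gamma> + ennreal (\<epsilon> / 2)) + (path_length B \<mu>M b c ?\<gamma> + ennreal (\<epsilon> / 2)) =
        (path_length B \<mu>M a b ?\<gamma> + path_length B \<mu>M b c ?\<gamma>) + (ennreal (\<epsilon> / 2) + ennreal (\<epsilon> / 2))"
      by (simp only: ac_simps)
    also have "path_length B \<mu>M a b ?\<gamma> + path_length B \<mu>M b c ?\<gamma> = path_length B \<mu>M a c ?\<gamma>"
      using join(1,2) by (intro path_length_join[symmetric]) simp_all
    also have "ennreal (\<epsilon> / 2) + ennreal (\<epsilon> / 2) = ennreal \<epsilon>"
      using half ennreal_plus[of "\<epsilon> / 2" "\<epsilon> / 2"] by simp
    finally show "coset_path a c \<alpha> (path_length B \<mu>M a c ?\<gamma> + ennreal \<epsilon>)" .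
  qed
qed

section \<open>Distances\<close>

lemma path_dist_le:
  "piecewise_Ck_path 1 C a b \<alpha> \<Longrightarrow> \<alpha> a = x \<Longrightarrow> \<alpha> b = y \<Longrightarrow> path_dist C \<nu> x y \<le> path_length C \<nu> a b \<alpha>"
  unfolding path_dist_def by (rule Inf_lower) blast

lemma coset_dist_le:
  "k \<in> K \<Longrightarrow> coset_dist G A \<mu> g h K \<le> path_dist A \<mu> g (h \<otimes> k)"
  unfolding coset_dist_def by (rule INF_lower)

lemma lift_path:
  assumes g: "g \<in> carrier G" and \<gamma>: "piecewise_Ck_path 1 B a b \<gamma>" "\<gamma> a = \<pi> g p"
  obtains \<alpha> where "piecewise_Ck_path 1 A a b \<alpha>" "\<alpha> a = g" "\<And>t. t \<in> {a..b} \<Longrightarrow> \<pi> (\<alpha> t) p = \<gamma> t"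
proof -
  have ig: "inv g \<in> carrier G" using g by simp
  have "piecewise_Ck_path 1 B a b (\<lambda>t. \<pi> (inv g) (\<gamma> t))"
    by (rule piecewise_map[OF C1_act[OF ig] manifold_B manifold_B \<gamma>(1)])
  moreover have "\<pi> (inv g) (\<gamma> a) = p"
    using act_mult[OF ig g base_point] act_one[OF base_point] g \<gamma>(2) by simp
  ultimately obtain \<alpha> where \<alpha>: "piecewise_Ck_path 1 A a b \<alpha>" "\<alpha> a = \<one>"
    "\<And>t. t \<in> {a..b} \<Longrightarrow> \<pi> (\<alpha> t) p = \<pi> (inv g) (\<gamma> t)"
    using lifting unfolding path_lifting_def by metis
  show thesis
  proof
    show "piecewise_Ck_path 1 A a b (\<lambda>t. g \<otimes> \<alpha> t)"
      by (rule piecewise_map[OF C1_map_left[OF lie g] manifold_G manifold_G \<alpha>(1)])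
    show "g \<otimes> \<alpha> a = g" using \<alpha>(2) g by simp
    fix t assume t: "t \<in> {a..b}"
    have "\<pi> (g \<otimes> \<alpha> t) p = \<pi> g (\<pi> (inv g) (\<gamma> t))"
      using act_mult[OF g piecewise_carrier[OF \<alpha>(1) t] base_point] \<alpha>(3)[OF t] by simp
    also have "\<dots> = \<pi> (g \<otimes> inv g) (\<gamma> t)"
      using act_mult[OF g ig piecewise_points[OF \<gamma>(1) t]] by simp
    also have "\<dots> = \<gamma> t" using g act_one[OF piecewise_points[OF \<gamma>(1) t]] by simp
    finally show "\<pi> (g \<otimes> \<alpha> t) p = \<gamma> t" .
  qed
qed

text \<open>The projection identifies the distance to a coset with the distance in the homogeneous
  space.\<close>

lemma coset_dist_eq_path_dist:
  assumes g: "g \<in> carrier G" and h: "h \<in> carrier G"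
  shows "coset_dist G A \<mu> g h K = path_dist B \<mu>M (\<pi> g p) (\<pi> h p)"
proof (rule antisym)
  show "coset_dist G A \<mu> g h K \<le> path_dist B \<mu>M (\<pi> g p) (\<pi> h p)"
    unfolding path_dist_def[of B]
  proof (rule Inf_greatest)
    fix l assume "l \<in> {path_length B \<mu>M a b \<gamma> |a b \<gamma>. piecewise_Ck_path 1 B a b \<gamma> \<and> \<gamma> a = \<pi> g p \<and> \<gamma> b = \<pi> h p}"
    then obtain a b \<gamma> where \<gamma>: "piecewise_Ck_path 1 B a b \<gamma>" "\<gamma> a = \<pi> g p" "\<gamma> b = \<pi> h p"
      and l: "l = path_length B \<mu>M a b \<gamma>" by blast
    obtain \<alpha> where \<alpha>: "piecewise_Ck_path 1 A a b \<alpha>" "\<alpha> a = g" "\<And>t. t \<in> {a..b} \<Longrightarrow> \<pi> (\<alpha> t) p = \<gamma> t"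
      using lift_path[OF g \<gamma>(1,2)] by blast
    have ab: "b \<in> {a..b}" using piecewise_less[OF \<gamma>(1)] by simp
    have ab': "\<alpha> b \<in> carrier G" by (rule piecewise_carrier[OF \<alpha>(1) ab])
    have "\<pi> h p = \<pi> (\<alpha> b) p" using \<alpha>(3)[OF ab] \<gamma>(3) by simp
    then obtain u where u: "u \<in> K" "\<alpha> b = h \<otimes> u" using proj_eq_K[OF h ab'] by blast
    have l': "path_length B \<mu>M a b (\<lambda>t. \<pi> (\<alpha> t) p) = l"
      unfolding l by (rule path_length_cong) (rule \<alpha>(3))
    show "coset_dist G A \<mu> g h K \<le> l"
    proof (rule ennreal_le_epsilon)
      fix \<epsilon> :: real assume "0 < \<epsilon>"
      then obtain \<beta> k where \<beta>: "piecewise_Ck_path 1 A a b \<beta>" "\<beta> a = \<alpha> a" "k \<in> K" "\<beta> b = \<alpha> b \<otimes> k"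
        "path_length A \<mu> a b \<beta> \<le> l + ennreal \<epsilon>"
        using lift_approx[OF \<alpha>(1)] unfolding l' coset_path_def by blast
      have "u \<otimes> k \<in> K" using subgroup.m_closed[OF K_subgroup u(1) \<beta>(3)] .
      then have "coset_dist G A \<mu> g h K \<le> path_dist A \<mu> g (h \<otimes> (u \<otimes> k))" by (rule coset_dist_le)
      also have "\<dots> \<le> path_length A \<mu> a b \<beta>"
        using \<beta>(2,4) \<alpha>(2) u h K_carrier[OF u(1)] K_carrier[OF \<beta>(3)]
        by (intro path_dist_le[OF \<beta>(1)]) (simp_all add: G.m_assoc)
      also note \<beta>(5)
      finally show "coset_dist G A \<mu> g h K \<le> l + ennreal \<epsilon>" .
    qed
  qed
  show "path_dist B \<mu>M (\<pi> g p) (\<pi> h p) \<le> coset_dist G A \<mu> g h K"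
    unfolding coset_dist_def
  proof (rule INF_greatest)
    fix k assume k: "k \<in> K"
    show "path_dist B \<mu>M (\<pi> g p) (\<pi> h p) \<le> path_dist A \<mu> g (h \<otimes> k)"
      unfolding path_dist_def[of A]
    proof (rule Inf_greatest)
      fix l assume "l \<in> {path_length A \<mu> a b \<alpha> |a b \<alpha>. piecewise_Ck_path 1 A a b \<alpha> \<and> \<alpha> a = g \<and> \<alpha> b = h \<otimes> k}"
      then obtain a b \<alpha> where \<alpha>: "piecewise_Ck_path 1 A a b \<alpha>" "\<alpha> a = g" "\<alpha> b = h \<otimes> k"
        and l: "l = path_length A \<mu> a b \<alpha>" by blast
      have "path_dist B \<mu>M (\<pi> g p) (\<pi> h p) \<le> path_length B \<mu>M a b (\<lambda>t. \<pi> (\<alpha> t) p)"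
        using \<alpha>(2,3) proj_mult_K[OF h k] by (intro path_dist_le piecewise_map[OF C1_proj manifold_G manifold_B \<alpha>(1)]) simp_all
      also have "\<dots> \<le> l" unfolding l by (rule path_length_proj_le[OF \<alpha>(1)])
      finally show "path_dist B \<mu>M (\<pi> g p) (\<pi> h p) \<le> l" .
    qed
  qed
qed

lemma minimal_iff_short_isometric_lift:
  assumes \<Gamma>: "piecewise_Ck_path 1 A a b \<Gamma>" "\<Gamma> a = g" "\<Gamma> b = h"
  shows "path_length A \<mu> a b \<Gamma> = coset_dist G A \<mu> g h K \<longleftrightarrow>
      short_path B \<mu>M a b (\<lambda>t. \<pi> (\<Gamma> t) p) \<and> path_length A \<mu> a b \<Gamma> = path_length B \<mu>M a b (\<lambda>t. \<pi> (\<Gamma> t) p)"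
    and "path_length A \<mu> a b \<Gamma> = coset_dist G A \<mu> g h K \<Longrightarrow>
      short_path A \<mu> a b \<Gamma> \<and> (\<exists>k\<in>K. path_dist A \<mu> g (h \<otimes> k) = coset_dist G A \<mu> g h K)"
proof -
  have ab: "a \<in> {a..b}" "b \<in> {a..b}" using piecewise_less[OF \<Gamma>(1)] by simp_all
  have gh: "g \<in> carrier G" "h \<in> carrier G"
    using piecewise_carrier[OF \<Gamma>(1) ab(1)] piecewise_carrier[OF \<Gamma>(1) ab(2)] \<Gamma>(2,3) by simp_all
  let ?\<gamma> = "\<lambda>t. \<pi> (\<Gamma> t) p"
  have \<gamma>: "piecewise_Ck_path 1 B a b ?\<gamma>" by (rule piecewise_map[OF C1_proj manifold_G manifold_B \<Gamma>(1)])
  have short: "short_path B \<mu>M a b ?\<gamma> \<longleftrightarrow> path_length B \<mu>M a b ?\<gamma> = coset_dist G A \<mu> g h K"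
    unfolding short_path_def coset_dist_eq_path_dist[OF gh] using \<gamma> \<Gamma>(2,3) by simp
  have le: "path_length B \<mu>M a b ?\<gamma> \<le> path_length A \<mu> a b \<Gamma>" by (rule path_length_proj_le[OF \<Gamma>(1)])
  have ge: "coset_dist G A \<mu> g h K \<le> path_length B \<mu>M a b ?\<gamma>"
    unfolding coset_dist_eq_path_dist[OF gh] using \<Gamma>(2,3) by (intro path_dist_le[OF \<gamma>]) simp_all
  show "path_length A \<mu> a b \<Gamma> = coset_dist G A \<mu> g h K \<longleftrightarrow>
      short_path B \<mu>M a b ?\<gamma> \<and> path_length A \<mu> a b \<Gamma> = path_length B \<mu>M a b ?\<gamma>"
    unfolding short using le ge by auto
  assume eq: "path_length A \<mu> a b \<Gamma> = coset_dist G A \<mu> g h K"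
  have one: "\<one> \<in> K" by (rule subgroup.one_closed[OF K_subgroup])
  have "coset_dist G A \<mu> g h K \<le> path_dist A \<mu> g h" using coset_dist_le[OF one, of g h] gh by simp
  moreover have "path_dist A \<mu> g h \<le> path_length A \<mu> a b \<Gamma>" using \<Gamma> by (rule path_dist_le)
  ultimately have dist: "path_dist A \<mu> g h = coset_dist G A \<mu> g h K" using eq by simp
  have "short_path A \<mu> a b \<Gamma>" unfolding short_path_def using \<Gamma> eq dist by simp
  moreover have "path_dist A \<mu> g (h \<otimes> \<one>) = coset_dist G A \<mu> g h K" using dist gh by simp
  ultimately show "short_path A \<mu> a b \<Gamma> \<and> (\<exists>k\<in>K. path_dist A \<mu> g (h \<otimes> k) = coset_dist G A \<mu> g h K)"
    using one by blast
qed

end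

section \<open>Minimal lifts\<close>

theorem theorem3p29:
  fixes G :: "('g, 'x) monoid_scheme"
    and A :: "('g, 'e::lcs) chart set"
    and B :: "('m, 'f::lcs) chart set"
    and AK :: "('g, 'k::lcs) chart set"
    and \<pi> :: "'g \<Rightarrow> 'm \<Rightarrow> 'm"
    and p :: 'm
    and \<mu> :: "'g \<Rightarrow> ('g, 'e) tangent \<Rightarrow> real"
    and L :: "'g \<Rightarrow> real"
    and s :: enat
    and a b :: real
    and \<Gamma> :: "real \<Rightarrow> 'g"
    and g h :: 'g
  defines "K \<equiv> stabilizer G \<pi> p"
    and "\<kk> \<equiv> lie_subalgebra G AK A"
    and "\<mu>\<^sub>M \<equiv> quotient_metric G A B \<pi> p (lie_subalgebra G AK A) \<mu>"
  assumes "lie_group s G A"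
    and "manifold 1 B"
    and "transitive_action G (points B) \<pi>"
    and "Ck_map 1 (product_atlas A B) B (\<lambda>(y, x). \<pi> y x)"
    and "p \<in> points B"
    and "path_lifting G A B \<pi> p"
    and "closedin (manifold_topology A) K"
    and "lie_group s (G\<lparr>carrier := K\<rparr>) AK"
    and "initial_in TYPE('n) TYPE('w::lcs) s AK A K"
    and "\<kk> = {v \<in> tangent_space A \<one>\<^bsub>G\<^esub>. differential A B (\<lambda>y. \<pi> y p) \<one>\<^bsub>G\<^esub> v = (\<lambda>_. 0)}"
    and "detects_paths s G A K \<kk>"
    and "has_evolutions s (G\<lparr>carrier := K\<rparr>) AK"
    and "finsler_metric A \<mu>"
    and "right_invariant G A K \<mu>"
    and "uniform_metric G A \<mu> L"
    and "piecewise_Ck_path 1 A a b \<Gamma>"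
    and "\<Gamma> a = g"
    and "\<Gamma> b = h"
  shows "(path_length A \<mu> a b \<Gamma> = coset_dist G A \<mu> g h K \<longleftrightarrow>
            short_path B \<mu>\<^sub>M a b (\<lambda>t. \<pi> (\<Gamma> t) p) \<and>
            path_length A \<mu> a b \<Gamma> = path_length B \<mu>\<^sub>M a b (\<lambda>t. \<pi> (\<Gamma> t) p)) \<and>
         (path_length A \<mu> a b \<Gamma> = coset_dist G A \<mu> g h K \<longrightarrow>
            short_path A \<mu> a b \<Gamma> \<and>
            (\<exists>k\<in>K. path_dist A \<mu> g (h \<otimes>\<^bsub>G\<^esub> k) = coset_dist G A \<mu> g h K))"
proof -
  have "homogeneous_space s G A B AK \<pi> p \<mu>"
    using assms unfolding K_def \<kk>_def initial_in_def by (intro homogeneous_space.intro) blast+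
  then interpret homogeneous_space s G A B AK \<pi> p \<mu> .
  show ?thesis
    unfolding K_def \<mu>\<^sub>M_def
    using minimal_iff_short_isometric_lift[of a b \<Gamma> g h] assms by blast
qed

end
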